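(* Let $F:\mathbb{R}^d\to\mathbb{R}$ be convex, differentiable with $L$-Lipschitz continuous gradient ($L>0$), and $\lambda$-strongly convex for some $\lambda\ge 0$ ($\lambda=0$ permitted). Let $\mathcal{H}:\mathcal{P}_2(\mathbb{R}^d)\to\mathbb{R}\cup\{+\infty\}$ be proper, lower semicontinuous (with respect to $W_2$) and convex along generalized geodesics, with $\operatorname{dom}(\mathcal{H})\subset\mathcal{P}_2^r(\mathbb{R}^d)$. Let $\mathcal{G}(\mu)=\int F\,d\mu+\mathcal{H}(\mu)$ and suppose $\operatorname{arg\,min}\mathcal{G}\neq\emptyset$. Let $\{\epsilon_n\}_{n\ge0}\subset \mathbb{R}_{\geq 0}$ with $\sum_{n=0}^{\infty} \epsilon_n < \infty$, let $\{\tau_n\}_{n\ge0} \subset \left(0,\frac{1}{L}\right)$ with $\sum_{i=0}^{\infty}\tau_i= \infty$ and $\sup_i \tau_i < \frac{1}{L}$, and let $\sigma_n:= \sum_{i=0}^{n-1}\tau_i$ for $n\in\mathbb{N}$. For $\tau>0$ let $S_\tau(\mu):=J_{\tau,\mathcal{H}}\big((I-\tau\nabla F)_{\#}\mu\big)$. Let $\{\mu_n\}_{n\ge0}\subset\mathcal{P}_2(\mathbb{R}^d)$ satisfy $$W_2(\mu_{n+1},S_{\tau_n}(\mu_n))\leq \epsilon_n \quad \text{for all } n \in \mathbb{N}.$$ 1. Then $$\mathcal{G}(\bar \beta_n)-\inf \mathcal{G} = O\left(\frac{1}{\sigma_n}\right) \quad \text{as } n\to \infty,$$ where $\bar \beta_n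 := S_{\tau_{j_n}}(\mu_{j_n})$ with $j_n \in \operatorname{arg\,min}_{i=0,\dots,n-1}\mathcal{G}(S_{\tau_i}(\mu_i))$ (the best iterate). 2. If $\sum_{n=1}^{\infty}\frac{\sigma_n}{\tau_n}\epsilon_{n-1} < \infty$, then $$\mathcal{G}(S_{\tau_n}(\mu_n))-\inf \mathcal{G} = O\left(\frac{1}{\sigma_n}\right) \quad \text{as } n\to \infty,$$ and $\{\mu_n\}_n$ converges with respect to the topology $\tau_{w,2}$ to some $\mu^*\in \operatorname{arg\,min} \mathcal{G}$. In particular $W_p(\mu_n,\mu^* )\to 0$ for all $p\in[1,2)$.
   Context: $\mathbb{N}$ includes $0$. $\mathcal{P}_2(\mathbb{R}^d)$ is the set of Borel probability measures on $\mathbb{R}^d$ with finite second moment; $\mathcal{P}_2^r(\mathbb{R}^d)$ is the subset of those absolutely continuous with respect to Lebesgue measure. For $p\in[1,2]$, $W_p$ is the $p$-Wasserstein distance for the Euclidean cost; $\Gamma_{\rm opt}(\mu,\nu)$ is the set of optimal couplings for $p=2$. $I$ is the identity map and $T_{\#}\mu$ the pushforward of $\mu$ by $T$. $\operatorname{dom}(\mathcal{H})=\{\mu:\mathcal{H}(\mu)<+\infty\}$. A generalized geodesic between $\mu_0,\mu_1\in\mathcal{P}_2(\mathbb{R}^d)$ with base $\nu\in\mathcal{P}_2(\mathbb{R}^d)$ is a curve $\mu_t=((1-t)\pi^2+t\pi^3)_{\#}\gamma$, $t\in[0,1]$, where $\gamma$ is a probability measure on $(\mathbb{R}^d)^3$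 with marginals $\nu,\mu_0,\mu_1$ such that $\pi^{1,2}_{\#}\gamma\in\Gamma_{\rm opt}(\nu,\mu_0)$ and $\pi^{1,3}_{\#}\gamma\in\Gamma_{\rm opt}(\nu,\mu_1)$ ($\pi^i$, $\pi^{i,j}$ are the coordinate projections). A proper function $\mathcal{H}$ is convex along generalized geodesics if for every $\mu_0,\mu_1,\nu\in\mathcal{P}_2(\mathbb{R}^d)$ there is a generalized geodesic $(\mu_s)_{s\in[0,1]}$ between $\mu_0$ and $\mu_1$ with base $\nu$ such that $\mathcal{H}(\mu_s)\le(1-s)\mathcal{H}(\mu_0)+s\,\mathcal{H}(\mu_1)$ for all $s\in[0,1]$. For $\tau>0$, $J_{\tau,\mathcal{H}}(\mu)$ is the (unique) minimizer of $\nu\mapsto \mathcal{H}(\nu)+\frac{1}{2\tau}W_2^2(\nu,\mu)$ over $\mathcal{P}_2(\mathbb{R}^d)$. Topology $\tau_{w,2}$: let $C_2^w(\mathbb{R}^d)$ be the space of continuous $f:\mathbb{R}^d\to\mathbb{R}$ with $\lim_{\|x\|\to\infty} f(x)/(1+\|x\|^2)=0$, normed by $\sup_x |f(x)|/(1+\|x\|^2)$. Its dual is the space of signed measures with finite second moment, and $\tau_{w,2}$ is the weak-$*$ topology restricted to $\mathcal{P}_2(\mathbb{R}^d)$; thus $\mu_n\to\mu$ in $\tau_{w,2}$ iff $\int f\,d\mu_n\to\int f\,d\mu$ for all $f\in C_2^w(\mathbb{R}^d)$. *)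

theory Defs
  imports "HOL-Analysis.Analysis" "HOL-Probability.Probability" "HOL-Library.Landau_Symbols"
begin

definition P2 :: "'a::euclidean_space measure set" where
  "P2 = {\<mu>. sets \<mu> = sets borel \<and> prob_space \<mu> \<and> integrable \<mu> (\<lambda>x. (norm x)\<^sup>2)}"

definition P2r :: "'a::euclidean_space measure set" where
  "P2r = {\<mu> \<in> P2. absolutely_continuous lborel \<mu>}"

definition couplings :: "'a::euclidean_space measure \<Rightarrow> 'a measure \<Rightarrow> ('a \<times> 'a) measure set" where
  "couplings \<mu> \<nu> = {\<gamma>. sets \<gamma> = sets borel \<and> prob_space \<gamma>
      \<and> distr \<gamma> borel fst = \<mu> \<and> distr \<gamma> borel snd = \<nu>}"

definition transport_cost :: "real \<Rightarrow> ('a::euclidean_space \<times> 'a) measure \<Rightarrow> ennreal" where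
  "transport_cost p \<gamma> = (\<integral>\<^sup>+ z. ennreal (dist (fst z) (snd z) powr p) \<partial>\<gamma>)"

(* The infimum is finite for \<mu>, \<nu> in P2 and 1 \<le> p \<le> 2, the only case in which the distance
   is used; hence enn2real loses nothing. *)
definition wasserstein :: "real \<Rightarrow> 'a::euclidean_space measure \<Rightarrow> 'a measure \<Rightarrow> real" where
  "wasserstein p \<mu> \<nu> = enn2real (INF \<gamma>\<in>couplings \<mu> \<nu>. transport_cost p \<gamma>) powr (1 / p)"

definition opt_couplings :: "'a::euclidean_space measure \<Rightarrow> 'a measure \<Rightarrow> ('a \<times> 'a) measure set" where
  "opt_couplings \<mu> \<nu> =
    {\<gamma> \<in> couplings \<mu> \<nu>. transport_cost 2 \<gamma> = (INF \<gamma>'\<in>couplings \<mu> \<nu>. transport_cost 2 \<gamma>')}"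

definition generalized_geodesic ::
  "'a::euclidean_space measure \<Rightarrow> 'a measure \<Rightarrow> 'a measure \<Rightarrow> (real \<Rightarrow> 'a measure) \<Rightarrow> bool" where
  "generalized_geodesic \<nu> \<mu>0 \<mu>1 \<mu> \<longleftrightarrow>
    (\<exists>\<gamma> :: ('a \<times> 'a \<times> 'a) measure.
      sets \<gamma> = sets borel \<and> prob_space \<gamma> \<and>
      distr \<gamma> borel (\<lambda>(x, y, z). x) = \<nu> \<and>
      distr \<gamma> borel (\<lambda>(x, y, z). y) = \<mu>0 \<and>
      distr \<gamma> borel (\<lambda>(x, y, z). z) = \<mu>1 \<and>
      distr \<gamma> borel (\<lambda>(x, y, z). (x, y)) \<in> opt_couplings \<nu> \<mu>0 \<and>
      distr \<gamma> borel (\<lambda>(x, y, z). (x, z)) \<in> opt_couplings \<nu> \<mu>1 \<and>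
      (\<forall>t\<in>{0..1}. \<mu> t = distr \<gamma> borel (\<lambda>(x, y, z). (1 - t) *\<^sub>R y + t *\<^sub>R z)))"

(* Functionals on P2 are total functions into ereal; only their values on P2 are ever used. *)

definition dom_P2 :: "('a::euclidean_space measure \<Rightarrow> ereal) \<Rightarrow> 'a measure set" where
  "dom_P2 H = {\<mu> \<in> P2. H \<mu> < \<infinity>}"

definition proper_P2 :: "('a::euclidean_space measure \<Rightarrow> ereal) \<Rightarrow> bool" where
  "proper_P2 H \<longleftrightarrow> (\<forall>\<mu>\<in>P2. H \<mu> \<noteq> -\<infinity>) \<and> dom_P2 H \<noteq> {}"

definition lsc_W2 :: "('a::euclidean_space measure \<Rightarrow> ereal) \<Rightarrow> bool" where
  "lsc_W2 H \<longleftrightarrow>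
    (\<forall>\<mu>\<in>P2. \<forall>c<H \<mu>. \<exists>\<delta>>0. \<forall>\<nu>\<in>P2. wasserstein 2 \<nu> \<mu> < \<delta> \<longrightarrow> c < H \<nu>)"

definition convex_gen_geodesics :: "('a::euclidean_space measure \<Rightarrow> ereal) \<Rightarrow> bool" where
  "convex_gen_geodesics H \<longleftrightarrow>
    (\<forall>\<mu>0\<in>P2. \<forall>\<mu>1\<in>P2. \<forall>\<nu>\<in>P2. \<exists>\<mu>. generalized_geodesic \<nu> \<mu>0 \<mu>1 \<mu> \<and>
      (\<forall>s\<in>{0..1}. H (\<mu> s) \<le> ereal (1 - s) * H \<mu>0 + ereal s * H \<mu>1))"

(* The minimizer is unique for the functionals considered, so that the choice made by arg_min
   is immaterial. *)
definition J :: "real \<Rightarrow> ('a::euclidean_space measure \<Rightarrow> ereal) \<Rightarrow> 'a measure \<Rightarrow> 'a measure" where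
  "J \<tau> H \<mu> =
    arg_min (\<lambda>\<nu>. H \<nu> + ereal (1 / (2 * \<tau>) * (wasserstein 2 \<nu> \<mu>)\<^sup>2)) (\<lambda>\<nu>. \<nu> \<in> P2)"

definition forward_backward ::
  "('a::euclidean_space \<Rightarrow> 'a) \<Rightarrow> ('a measure \<Rightarrow> ereal) \<Rightarrow> real \<Rightarrow> 'a measure \<Rightarrow> 'a measure" where
  "forward_backward gradF H \<tau> \<mu> = J \<tau> H (distr \<mu> borel (\<lambda>x. x - \<tau> *\<^sub>R gradF x))"

definition total_energy ::
  "('a::euclidean_space \<Rightarrow> real) \<Rightarrow> ('a measure \<Rightarrow> ereal) \<Rightarrow> 'a measure \<Rightarrow> ereal" where
  "total_energy F H \<mu> = ereal (\<integral>x. F x \<partial>\<mu>) + H \<mu>"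

definition strongly_convex :: "real \<Rightarrow> ('a::real_normed_vector \<Rightarrow> real) \<Rightarrow> bool" where
  "strongly_convex lam F \<longleftrightarrow>
    (\<forall>x y. \<forall>t\<in>{0..1}. F ((1 - t) *\<^sub>R x + t *\<^sub>R y)
      \<le> (1 - t) * F x + t * F y - lam / 2 * t * (1 - t) * (norm (x - y))\<^sup>2)"

(* The first conjunct is needed because real_of_ereal maps infinite values to 0. *)
definition ereal_bigo :: "(nat \<Rightarrow> ereal) \<Rightarrow> (nat \<Rightarrow> real) \<Rightarrow> bool" where
  "ereal_bigo f g \<longleftrightarrow>
    (\<forall>\<^sub>F n in sequentially. \<bar>f n\<bar> \<noteq> \<infinity>) \<and> (\<lambda>n. real_of_ereal (f n)) \<in> O(g)"

definition C2w :: "('a::euclidean_space \<Rightarrow> real) set" where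
  "C2w = {f. continuous_on UNIV f \<and> ((\<lambda>x. f x / (1 + (norm x)\<^sup>2)) \<longlongrightarrow> 0) at_infinity}"

definition tau_w2 :: "'a::euclidean_space measure topology" where
  "tau_w2 = topology_generated_by
    {{\<mu> \<in> P2. (\<integral>x. f x \<partial>\<mu>) \<in> U} | f U. f \<in> C2w \<and> open U}"

lemma topspace_tau_w2: "topspace tau_w2 = P2"
proof -
  have z: "(\<lambda>x. 0) \<in> C2w"
    by (simp add: C2w_def)
  have "P2 \<in> {{\<mu> \<in> P2. (\<integral>x. f x \<partial>\<mu>) \<in> U} | f U. f \<in> C2w \<and> open U}"
    using z by (intro CollectI exI[of _ "\<lambda>x. 0"] exI[of _ UNIV]) auto
  then show ?thesis
    unfolding tau_w2_def topology_generated_by_topspace by blast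
qed

lemma limitin_tau_w2_iff:
  assumes "\<And>n. \<mu> n \<in> P2" "\<nu> \<in> P2"
  shows "limitin tau_w2 \<mu> \<nu> sequentially \<longleftrightarrow>
    (\<forall>f\<in>C2w. (\<lambda>n. \<integral>x. f x \<partial>\<mu> n) \<longlonglongrightarrow> (\<integral>x. f x \<partial>\<nu>))"
proof
  assume lim: "limitin tau_w2 \<mu> \<nu> sequentially"
  show "\<forall>f\<in>C2w. (\<lambda>n. \<integral>x. f x \<partial>\<mu> n) \<longlonglongrightarrow> (\<integral>x. f x \<partial>\<nu>)"
  proof (intro ballI topological_tendstoI)
    fix f :: "'a \<Rightarrow> real" and U :: "real set"
    assume f: "f \<in> C2w" and U: "open U" "(\<integral>x. f x \<partial>\<nu>) \<in> U"
    have "openin tau_w2 {\<mu> \<in> P2. (\<integral>x. f x \<partial>\<mu>) \<in> U}"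
      unfolding tau_w2_def by (rule topology_generated_by_Basis) (use f U in blast)
    then have "\<forall>\<^sub>F n in sequentially. \<mu> n \<in> {\<mu> \<in> P2. (\<integral>x. f x \<partial>\<mu>) \<in> U}"
      using lim U assms unfolding limitin_def by blast
    then show "\<forall>\<^sub>F n in sequentially. (\<integral>x. f x \<partial>\<mu> n) \<in> U"
      by (rule eventually_mono) simp
  qed
next
  assume R: "\<forall>f\<in>C2w. (\<lambda>n. \<integral>x. f x \<partial>\<mu> n) \<longlonglongrightarrow> (\<integral>x. f x \<partial>\<nu>)"
  have "\<nu> \<in> V \<longrightarrow> (\<forall>\<^sub>F n in sequentially. \<mu> n \<in> V)"
    if "generate_topology_on {{\<mu> \<in> P2. (\<integral>x. f x \<partial>\<mu>) \<in> U} | f U. f \<in> C2w \<and> open U} V" for V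
    using that
  proof (induction rule: generate_topology_on.induct)
    case Empty
    then show ?case by simp
  next
    case (Int a b)
    then show ?case by (auto intro: eventually_conj)
  next
    case (UN K)
    then show ?case by (blast intro: eventually_mono)
  next
    case (Basis s)
    then obtain f U where s: "s = {\<mu> \<in> P2. (\<integral>x. f x \<partial>\<mu>) \<in> U}" "f \<in> C2w" "open U"
      by blast
    show ?case
    proof
      assume "\<nu> \<in> s"
      then have "\<forall>\<^sub>F n in sequentially. (\<integral>x. f x \<partial>\<mu> n) \<in> U"
        using R s by (auto intro: topological_tendstoD)
      then show "\<forall>\<^sub>F n in sequentially. \<mu> n \<in> s"
        by (rule eventually_mono) (use assms s in simp)
    qed
  qed
  then show "limitin tau_w2 \<mu> \<nu> sequentially"
    unfolding limitin_def topspace_tau_w2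
    unfolding tau_w2_def openin_topology_generated_by_iff
    using assms by blast
qed

end

theory Submission
  imports Defs
begin

text \<open>
  Write \<open>\<beta>\<^sub>n = S \<tau>\<^sub>n \<mu>\<^sub>n\<close>. Convexity of \<open>H\<close> along the generalized geodesic based at
  \<open>(I - \<tau> \<nabla>F)\<^sub># \<mu>\<close>, together with the tangent and descent inequalities for \<open>F\<close>, gives for every \<open>\<rho>\<close>
  \<open>2 \<tau> (G (S \<tau> \<mu>) - G \<rho>) \<le> W\<^sub>2\<^sup>2(\<mu>, \<rho>) - W\<^sub>2\<^sup>2(S \<tau> \<mu>, \<rho>) - (1 - \<tau> L) W\<^sub>2\<^sup>2(\<mu>, S \<tau> \<mu>)\<close>.
  Taking a minimizer as \<open>\<rho>\<close> yields quasi-Fejer monotonicity and, by summation, the rate of the best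
  iterate; taking the previous \<open>\<beta>\<close> as \<open>\<rho>\<close> yields the rate of the last one. Weak convergence follows as in a
  Hilbert space from Opial's property \<open>W\<^sub>2\<^sup>2(\<mu>\<^sub>n, \<nu>) - W\<^sub>2\<^sup>2(\<mu>\<^sub>n, \<mu>) \<rightarrow> W\<^sub>2\<^sup>2(\<mu>, \<nu>)\<close> for \<open>\<mu>\<^sub>n \<rightarrow> \<mu>\<close> weakly, which
  makes weak cluster points minimizers and unique. Weak compactness is used in Skorokhod's form, as
  almost sure convergence of random variables, reduced to the real line by a space-filling curve.\<close>

section \<open>Couplings as random variables\<close>

lemma P2D:
  assumes "\<mu> \<in> P2"
  shows "sets \<mu> = sets borel" "prob_space \<mu>" "integrable \<mu> (\<lambda>x. (norm x)\<^sup>2)" "space \<mu> = UNIV"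
  using assms by (auto simp: P2_def dest: sets_eq_imp_space_eq)

definition second_moment :: "'a::euclidean_space measure \<Rightarrow> real" where
  "second_moment \<mu> = (\<integral>x. (norm x)\<^sup>2 \<partial>\<mu>)"

lemma second_moment_nonneg: "0 \<le> second_moment \<mu>"
  unfolding second_moment_def by simp

lemma norm_add_sq_le: "(norm (x + y))\<^sup>2 \<le> 2 * (norm x)\<^sup>2 + 2 * (norm y)\<^sup>2"
  for x y :: "'a::real_inner"
proof -
  have "0 \<le> (norm (x - y))\<^sup>2" by simp
  then show ?thesis by (simp add: power2_norm_eq_inner algebra_simps inner_commute)
qed

lemma norm_diff_sq_le: "(norm (x - y))\<^sup>2 \<le> 2 * (norm x)\<^sup>2 + 2 * (norm y)\<^sup>2"
  for x y :: "'a::real_inner"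
  using norm_add_sq_le[of x "- y"] by simp

lemma distr_in_P2_iff:
  fixes X :: "'b \<Rightarrow> 'a::euclidean_space"
  assumes "prob_space M" and [measurable]: "X \<in> borel_measurable M"
  shows "distr M borel X \<in> P2 \<longleftrightarrow> integrable M (\<lambda>\<omega>. (norm (X \<omega>))\<^sup>2)"
  using assms by (simp add: P2_def prob_space.prob_space_distr integrable_distr_eq)

lemma second_moment_distr:
  assumes [measurable]: "X \<in> borel_measurable M"
  shows "second_moment (distr M borel X) = (\<integral>\<omega>. (norm (X \<omega>))\<^sup>2 \<partial>M)"
  unfolding second_moment_def by (subst integral_distr) auto

lemma integrable_sq_of_law:
  assumes [measurable]: "X \<in> borel_measurable M" and "distr M borel X \<in> P2"
  shows "integrable M (\<lambda>\<omega>. (norm (X \<omega>))\<^sup>2)"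
  using P2D(3)[OF assms(2)] by (simp add: integrable_distr_eq)

lemma integrable_dist_sq_of_laws:
  assumes [measurable]: "X \<in> borel_measurable M" "Y \<in> borel_measurable M"
    and "distr M borel X \<in> P2" "distr M borel Y \<in> P2"
  shows "integrable M (\<lambda>\<omega>. (norm (X \<omega> - Y \<omega>))\<^sup>2)"
proof (rule Bochner_Integration.integrable_bound)
  show "integrable M (\<lambda>\<omega>. 2 * (norm (X \<omega>))\<^sup>2 + 2 * (norm (Y \<omega>))\<^sup>2)"
    using integrable_sq_of_law[OF assms(1,3)] integrable_sq_of_law[OF assms(2,4)] by simp
qed (use norm_diff_sq_le in auto)

lemma INF_couplings_le:
  fixes X Y :: "'c \<Rightarrow> 'b::euclidean_space"
  assumes "prob_space M" and [measurable]: "X \<in> borel_measurable M" "Y \<in> borel_measurable M"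
  shows "(INF \<gamma>\<in>couplings (distr M borel X) (distr M borel Y). transport_cost p \<gamma>)
    \<le> (\<integral>\<^sup>+ \<omega>. ennreal (dist (X \<omega>) (Y \<omega>) powr p) \<partial>M)"
proof -
  let ?\<gamma> = "distr M borel (\<lambda>\<omega>. (X \<omega>, Y \<omega>))"
  have m[measurable]: "(\<lambda>\<omega>. (X \<omega>, Y \<omega>)) \<in> borel_measurable M"
    by (rule borel_measurable_Pair) auto
  have f[measurable]: "(fst :: 'b \<times> 'b \<Rightarrow> 'b) \<in> borel_measurable borel"
    "(snd :: 'b \<times> 'b \<Rightarrow> 'b) \<in> borel_measurable borel"
    by (auto intro!: borel_measurable_continuous_onI continuous_intros)
  have d: "(\<lambda>z::'b\<times>'b. dist (fst z) (snd z) powr p) \<in> borel_measurable borel"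
    by measurable
  have "?\<gamma> \<in> couplings (distr M borel X) (distr M borel Y)"
    using assms by (auto simp: couplings_def prob_space.prob_space_distr distr_distr comp_def)
  moreover have "transport_cost p ?\<gamma> = (\<integral>\<^sup>+ \<omega>. ennreal (dist (X \<omega>) (Y \<omega>) powr p) \<partial>M)"
    unfolding transport_cost_def using d by (subst nn_integral_distr) auto
  ultimately show ?thesis by (metis INF_lower)
qed

lemma wasserstein_nonneg [simp]: "0 \<le> wasserstein p \<mu> \<nu>"
  by (simp add: wasserstein_def)

lemma wasserstein_powr_le:
  assumes "prob_space M" and [measurable]: "X \<in> borel_measurable M" "Y \<in> borel_measurable M"
    and int: "integrable M (\<lambda>\<omega>. dist (X \<omega>) (Y \<omega>) powr p)" and "p > 0"
  shows "wasserstein p (distr M borel X) (distr M borel Y) powr p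
    \<le> (\<integral>\<omega>. dist (X \<omega>) (Y \<omega>) powr p \<partial>M)"
proof -
  let ?I = "INF \<gamma>\<in>couplings (distr M borel X) (distr M borel Y). transport_cost p \<gamma>"
  have "?I \<le> (\<integral>\<^sup>+ \<omega>. ennreal (dist (X \<omega>) (Y \<omega>) powr p) \<partial>M)"
    by (rule INF_couplings_le) (use assms in auto)
  also have "\<dots> = ennreal (\<integral>\<omega>. dist (X \<omega>) (Y \<omega>) powr p \<partial>M)"
    by (rule nn_integral_eq_integral[OF int]) auto
  finally have "enn2real ?I \<le> (\<integral>\<omega>. dist (X \<omega>) (Y \<omega>) powr p \<partial>M)"
    by (intro enn2real_leI) auto
  moreover have "wasserstein p (distr M borel X) (distr M borel Y) powr p = enn2real ?I"
    unfolding wasserstein_def using \<open>p > 0\<close> by (simp add: powr_powr)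
  ultimately show ?thesis by simp
qed

lemma wasserstein2_sq: "(wasserstein 2 \<mu> \<nu>)\<^sup>2 = enn2real (INF \<gamma>\<in>couplings \<mu> \<nu>. transport_cost 2 \<gamma>)"
  unfolding wasserstein_def by (simp add: powr_half_sqrt)

lemma wasserstein2_sq_le:
  fixes X Y :: "'b \<Rightarrow> 'a::euclidean_space"
  assumes "prob_space M" and [measurable]: "X \<in> borel_measurable M" "Y \<in> borel_measurable M"
    and "distr M borel X = \<mu>" "distr M borel Y = \<nu>" "\<mu> \<in> P2" "\<nu> \<in> P2"
  shows "(wasserstein 2 \<mu> \<nu>)\<^sup>2 \<le> (\<integral>\<omega>. (norm (X \<omega> - Y \<omega>))\<^sup>2 \<partial>M)"
proof -
  have "wasserstein 2 (distr M borel X) (distr M borel Y) powr 2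
    \<le> (\<integral>\<omega>. dist (X \<omega>) (Y \<omega>) powr 2 \<partial>M)"
    using integrable_dist_sq_of_laws[of X M Y] assms
    by (intro wasserstein_powr_le) (auto simp: dist_norm)
  then show ?thesis
    using assms by (simp add: dist_norm)
qed

lemma wasserstein_commute: "wasserstein p \<mu> \<nu> = wasserstein p \<nu> \<mu>"
proof -
  have le: "(INF \<gamma>\<in>couplings \<nu> \<mu>. transport_cost p \<gamma>) \<le> (INF \<gamma>\<in>couplings \<mu> \<nu>. transport_cost p \<gamma>)"
    for \<mu> \<nu> :: "'b::euclidean_space measure"
  proof (rule INF_greatest)
    fix \<gamma> assume g: "\<gamma> \<in> couplings \<mu> \<nu>"
    then interpret prob_space \<gamma> by (auto simp: couplings_def)
    have s: "sets \<gamma> = sets borel" using g by (auto simp: couplings_def)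
    have m: "(fst :: 'b \<times> 'b \<Rightarrow> 'b) \<in> borel_measurable \<gamma>"
      "(snd :: 'b \<times> 'b \<Rightarrow> 'b) \<in> borel_measurable \<gamma>"
      using s by (auto simp: measurable_cong_sets[OF s refl]
          intro!: borel_measurable_continuous_onI continuous_intros)
    have "(INF \<gamma>\<in>couplings (distr \<gamma> borel snd) (distr \<gamma> borel fst). transport_cost p \<gamma>)
      \<le> (\<integral>\<^sup>+ \<omega>. ennreal (dist (snd \<omega>) (fst \<omega>) powr p) \<partial>\<gamma>)"
      by (rule INF_couplings_le) (use m prob_space_axioms in auto)
    then show "(INF \<gamma>\<in>couplings \<nu> \<mu>. transport_cost p \<gamma>) \<le> transport_cost p \<gamma>"
      using g by (simp add: couplings_def transport_cost_def dist_commute)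
  qed
  show ?thesis unfolding wasserstein_def using antisym[OF le[of \<mu> \<nu>] le[of \<nu> \<mu>]] by simp
qed

lemma opt_couplings_cost:
  fixes X Y :: "'c \<Rightarrow> 'b::euclidean_space"
  assumes g: "distr M borel (\<lambda>\<omega>. (X \<omega>, Y \<omega>)) \<in> opt_couplings \<mu> \<nu>"
    and [measurable]: "X \<in> borel_measurable M" "Y \<in> borel_measurable M"
    and "distr M borel X = \<mu>" "distr M borel Y = \<nu>" "\<mu> \<in> P2" "\<nu> \<in> P2"
  shows "(\<integral>\<omega>. (norm (X \<omega> - Y \<omega>))\<^sup>2 \<partial>M) = (wasserstein 2 \<mu> \<nu>)\<^sup>2"
proof -
  have m[measurable]: "(\<lambda>\<omega>. (X \<omega>, Y \<omega>)) \<in> borel_measurable M"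
    by (rule borel_measurable_Pair) auto
  have f[measurable]: "(fst :: 'b \<times> 'b \<Rightarrow> 'b) \<in> borel_measurable borel"
    "(snd :: 'b \<times> 'b \<Rightarrow> 'b) \<in> borel_measurable borel"
    by (auto intro!: borel_measurable_continuous_onI continuous_intros)
  have d: "(\<lambda>z::'b\<times>'b. dist (fst z) (snd z) powr 2) \<in> borel_measurable borel"
    by measurable
  have "transport_cost 2 (distr M borel (\<lambda>\<omega>. (X \<omega>, Y \<omega>)))
     = (\<integral>\<^sup>+ \<omega>. ennreal (dist (X \<omega>) (Y \<omega>) powr 2) \<partial>M)"
    unfolding transport_cost_def using d by (subst nn_integral_distr) auto
  also have "\<dots> = ennreal (\<integral>\<omega>. dist (X \<omega>) (Y \<omega>) powr 2 \<partial>M)"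
    using integrable_dist_sq_of_laws[of X M Y] assms
    by (intro nn_integral_eq_integral) (auto simp: dist_norm)
  finally have "(INF \<gamma>\<in>couplings \<mu> \<nu>. transport_cost 2 \<gamma>) = ennreal (\<integral>\<omega>. dist (X \<omega>) (Y \<omega>) powr 2 \<partial>M)"
    using g by (simp add: opt_couplings_def)
  then show ?thesis by (simp add: wasserstein2_sq dist_norm)
qed

lemma generalized_geodesic_random_variables:
  fixes \<mu> :: "real \<Rightarrow> 'a::euclidean_space measure"
  assumes gg: "generalized_geodesic \<nu> \<mu>0 \<mu>1 \<mu>" and P: "\<nu> \<in> P2" "\<mu>0 \<in> P2" "\<mu>1 \<in> P2"
  obtains M :: "('a \<times> 'a \<times> 'a) measure" and X Y Z where
    "prob_space M"
    "X \<in> borel_measurable M" "Y \<in> borel_measurable M" "Z \<in> borel_measurable M"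
    "distr M borel X = \<nu>" "distr M borel Y = \<mu>0" "distr M borel Z = \<mu>1"
    "(\<integral>\<omega>. (norm (X \<omega> - Y \<omega>))\<^sup>2 \<partial>M) = (wasserstein 2 \<nu> \<mu>0)\<^sup>2"
    "(\<integral>\<omega>. (norm (X \<omega> - Z \<omega>))\<^sup>2 \<partial>M) = (wasserstein 2 \<nu> \<mu>1)\<^sup>2"
    "\<And>t. t \<in> {0..1} \<Longrightarrow> \<mu> t = distr M borel (\<lambda>\<omega>. (1 - t) *\<^sub>R Y \<omega> + t *\<^sub>R Z \<omega>)"
proof -
  obtain \<gamma> :: "('a \<times> 'a \<times> 'a) measure" where g: "sets \<gamma> = sets borel" "prob_space \<gamma>"
      "distr \<gamma> borel (\<lambda>(x, y, z). x) = \<nu>"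
      "distr \<gamma> borel (\<lambda>(x, y, z). y) = \<mu>0"
      "distr \<gamma> borel (\<lambda>(x, y, z). z) = \<mu>1"
      "distr \<gamma> borel (\<lambda>(x, y, z). (x, y)) \<in> opt_couplings \<nu> \<mu>0"
      "distr \<gamma> borel (\<lambda>(x, y, z). (x, z)) \<in> opt_couplings \<nu> \<mu>1"
      "\<forall>t\<in>{0..1}. \<mu> t = distr \<gamma> borel (\<lambda>(x, y, z). (1 - t) *\<^sub>R y + t *\<^sub>R z)"
    using gg unfolding generalized_geodesic_def by blast
  define X Y Z :: "'a \<times> 'a \<times> 'a \<Rightarrow> 'a" where "X = (\<lambda>(x, y, z). x)" "Y = (\<lambda>(x, y, z). y)" "Z = (\<lambda>(x, y, z). z)"
  note XYZ = this
  have m: "X \<in> borel_measurable \<gamma>" "Y \<in> borel_measurable \<gamma>" "Z \<in> borel_measurable \<gamma>"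
    unfolding XYZ split_beta measurable_cong_sets[OF g(1) refl]
    by (auto intro!: borel_measurable_continuous_onI continuous_intros)
  have XY: "(\<lambda>\<omega>. (X \<omega>, Y \<omega>)) = (\<lambda>(x, y, z). (x, y))" "(\<lambda>\<omega>. (X \<omega>, Z \<omega>)) = (\<lambda>(x, y, z). (x, z))"
    and YZ: "(\<lambda>\<omega>. (1 - t) *\<^sub>R Y \<omega> + t *\<^sub>R Z \<omega>) = (\<lambda>(x, y, z). (1 - t) *\<^sub>R y + t *\<^sub>R z)" for t
    unfolding XYZ by auto
  have l: "distr \<gamma> borel X = \<nu>" "distr \<gamma> borel Y = \<mu>0" "distr \<gamma> borel Z = \<mu>1"
    using g XYZ by auto
  show thesis
  proof (rule that[of \<gamma> X Y Z])
    show "(\<integral>\<omega>. (norm (X \<omega> - Y \<omega>))\<^sup>2 \<partial>\<gamma>) = (wasserstein 2 \<nu> \<mu>0)\<^sup>2"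
      by (rule opt_couplings_cost) (use m l P g(6) XY in auto)
    show "(\<integral>\<omega>. (norm (X \<omega> - Z \<omega>))\<^sup>2 \<partial>\<gamma>) = (wasserstein 2 \<nu> \<mu>1)\<^sup>2"
      by (rule opt_couplings_cost) (use m l P g(7) XY in auto)
  qed (use m l g YZ in auto)
qed

section \<open>Skorokhod compactness\<close>

definition fold_wave :: "real \<Rightarrow> real" where
  "fold_wave u = max 0 (min 1 (1 / 2 - cos (pi * u)))"

lemma fold_wave_bounds: "0 \<le> fold_wave u" "fold_wave u \<le> 1"
  by (auto simp: fold_wave_def)

lemma continuous_on_fold_wave [continuous_intros]:
  "continuous_on A f \<Longrightarrow> continuous_on A (\<lambda>x. fold_wave (f x))" for A :: "'b::t2_space set"
  unfolding fold_wave_def by (intro continuous_intros)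

lemma fold_wave_shift: "fold_wave (2 * of_int k + u) = fold_wave u"
proof -
  have "cos (pi * (2 * of_int k + u)) = cos (2 * of_int k * pi + pi * u)" by (simp add: algebra_simps)
  also have "\<dots> = cos (pi * u)"
    using cos_int_2pin[of k] sin_int_2pin[of k] by (simp add: cos_add mult_ac)
  finally show ?thesis by (simp add: fold_wave_def)
qed

lemma fold_wave_low: "0 \<le> u \<Longrightarrow> u \<le> 1 / 3 \<Longrightarrow> fold_wave u = 0"
  using cos_monotone_0_pi_le[of "pi * u" "pi / 3"] by (simp add: fold_wave_def cos_60)

lemma fold_wave_high: "2 / 3 \<le> u \<Longrightarrow> u \<le> 1 \<Longrightarrow> fold_wave u = 1"
  using cos_monotone_0_pi_le[of "2 * pi / 3" "pi * u"]
  by (simp add: fold_wave_def cos_120)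

lemma summable_ternary:
  assumes "\<And>j. a j \<in> {0, 1::real}"
  shows "summable (\<lambda>j. 2 * a j / 3 ^ Suc j)"
proof (rule summable_comparison_test')
  show "summable (\<lambda>j. 2 * (1 / 3 :: real) ^ j)" by (intro summable_mult summable_geometric) auto
  fix n show "norm (2 * a n / 3 ^ Suc n) \<le> 2 * (1 / 3) ^ n"
    using assms[of n] by (auto simp: field_simps)
qed

lemma ternary_tail_bounds:
  assumes "\<And>j. a j \<in> {0, 1::real}"
  shows "0 \<le> (\<Sum>j. 2 * a j / 3 ^ Suc j)" "(\<Sum>j. 2 * a j / 3 ^ Suc j) \<le> 1"
proof -
  have p: "0 \<le> a j" "a j \<le> 1" for j using assms[of j] by auto
  show "0 \<le> (\<Sum>j. 2 * a j / 3 ^ Suc j)"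
    by (intro suminf_nonneg summable_ternary assms) (use p in auto)
  have g: "(\<lambda>j. 2 / 3 * (1 / 3 :: real) ^ j) sums 1"
    using sums_mult[OF geometric_sums[of "1/3::real"], of "2/3"] by simp
  have "(\<Sum>j. 2 * a j / 3 ^ Suc j) \<le> (\<Sum>j. 2 / 3 * (1 / 3) ^ j)"
  proof (intro suminf_le summable_ternary assms)
    fix j show "2 * a j / 3 ^ Suc j \<le> 2 / 3 * (1 / 3) ^ j"
      using p(2)[of j] by (simp add: field_simps)
  qed (use g in \<open>auto simp: sums_iff\<close>)
  then show "(\<Sum>j. 2 * a j / 3 ^ Suc j) \<le> 1" using g by (simp add: sums_iff)
qed

lemma fold_wave_ternary_digit:
  assumes a: "\<And>j. a j \<in> {0, 1::real}"
  shows "fold_wave (3 ^ m * (\<Sum>j. 2 * a j / 3 ^ Suc j)) = a m"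
proof -
  let ?f = "\<lambda>j. 2 * a j / 3 ^ Suc j"
  let ?R = "\<Sum>j. 2 * a (j + Suc m) / 3 ^ Suc j"
  have R: "0 \<le> ?R" "?R \<le> 1"
    using ternary_tail_bounds[of "\<lambda>j. a (j + Suc m)"] a by auto
  have "(\<Sum>j. ?f j) = (\<Sum>j. ?f (j + Suc m)) + sum ?f {..<Suc m}"
    by (rule suminf_split_initial_segment[OF summable_ternary[OF a]])
  also have "(\<Sum>j. ?f (j + Suc m)) = (\<Sum>j. (1 / 3 ^ Suc m) * (2 * a (j + Suc m) / 3 ^ Suc j))"
    by (intro suminf_cong) (simp add: power_add field_simps)
  also have "\<dots> = (1 / 3 ^ Suc m) * ?R"
    by (rule suminf_mult) (use summable_ternary[of "\<lambda>j. a (j + Suc m)"] a in auto)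
  finally have split: "3 ^ m * (\<Sum>j. ?f j) = 3 ^ m * sum ?f {..<m} + (2 * a m / 3 + ?R / 3)"
    by (simp add: field_simps)
  have "\<exists>k::int. 3 ^ m * sum ?f {..<m} = 2 * of_int k"
  proof -
    have "\<forall>j. \<exists>b::int. a j = of_int b"
      using a by (metis insert_iff singletonD of_int_0 of_int_1)
    then obtain b :: "nat \<Rightarrow> int" where b: "\<And>j. a j = of_int (b j)" by metis
    have "3 ^ m * sum ?f {..<m} = (\<Sum>j<m. 2 * of_int (b j * 3 ^ (m - Suc j)))"
      unfolding sum_distrib_left
    proof (intro sum.cong refl)
      fix j assume "j \<in> {..<m}"
      then have "m = Suc j + (m - Suc j)" by simp
      then have "(3::real) ^ m = 3 ^ Suc j * 3 ^ (m - Suc j)" by (metis power_add)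
      then show "3 ^ m * ?f j = 2 * of_int (b j * 3 ^ (m - Suc j))" by (simp add: b)
    qed
    also have "\<dots> = 2 * of_int (\<Sum>j<m. b j * 3 ^ (m - Suc j))"
      by (simp add: sum_distrib_left)
    finally show ?thesis by blast
  qed
  then obtain k :: int where k: "3 ^ m * sum ?f {..<m} = 2 * of_int k" by blast
  have "fold_wave (2 * a m / 3 + ?R / 3) = a m"
    using a[of m] R fold_wave_low[of "2 * a m / 3 + ?R / 3"] fold_wave_high[of "2 * a m / 3 + ?R / 3"]
    by auto
  then show ?thesis unfolding split k fold_wave_shift .
qed

definition binary_digit :: "nat \<Rightarrow> real \<Rightarrow> real" where
  "binary_digit k x = of_int (\<lfloor>2 ^ Suc k * x\<rfloor> mod 2)"

lemma binary_digit_range: "binary_digit k x \<in> {0, 1}"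
proof -
  have "\<lfloor>2 ^ Suc k * x\<rfloor> mod 2 \<in> {0, 1}" by auto
  then show ?thesis unfolding binary_digit_def by auto
qed

lemma binary_digit_measurable [measurable]: "binary_digit k \<in> borel_measurable borel"
  unfolding binary_digit_def by measurable

lemma binary_expansion:
  assumes "0 \<le> x" "x < 1"
  shows "(\<lambda>k. (1 / 2) ^ Suc k * binary_digit k x) sums x"
proof -
  have part: "(\<Sum>k<n. (1 / 2) ^ Suc k * binary_digit k x) = of_int \<lfloor>2 ^ n * x\<rfloor> / 2 ^ n" for n
  proof (induction n)
    case 0
    then show ?case using assms by (simp add: floor_eq_iff)
  next
    case (Suc n)
    have "\<lfloor>2 ^ Suc n * x\<rfloor> div 2 = \<lfloor>2 ^ n * x\<rfloor>"
    proof -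
      have "\<lfloor>(2 ^ Suc n * x) / of_int 2\<rfloor> = \<lfloor>2 ^ Suc n * x\<rfloor> div 2" by (rule floor_divide_real_eq_div) auto
      then show ?thesis by simp
    qed
    then have "\<lfloor>2 ^ Suc n * x\<rfloor> = 2 * \<lfloor>2 ^ n * x\<rfloor> + \<lfloor>2 ^ Suc n * x\<rfloor> mod 2"
      by (metis mult_div_mod_eq)
    then have "real_of_int \<lfloor>2 ^ Suc n * x\<rfloor> = 2 * of_int \<lfloor>2 ^ n * x\<rfloor> + binary_digit n x"
      unfolding binary_digit_def by (metis of_int_add of_int_mult of_int_numeral)
    then show ?case using Suc by (simp add: field_simps power_divide)
  qed
  have "(\<lambda>n. of_int \<lfloor>2 ^ n * x\<rfloor> / 2 ^ n) \<longlonglongrightarrow> x"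
  proof (rule tendsto_sandwich)
    show "\<forall>\<^sub>F n in sequentially. x - (1 / 2) ^ n \<le> of_int \<lfloor>2 ^ n * x\<rfloor> / 2 ^ n"
    proof (intro always_eventually allI)
      fix n
      have "2 ^ n * x - 1 \<le> of_int \<lfloor>2 ^ n * x\<rfloor>" by linarith
      then have "(2 ^ n * x - 1) / 2 ^ n \<le> of_int \<lfloor>2 ^ n * x\<rfloor> / 2 ^ n" by (intro divide_right_mono) auto
      then show "x - (1 / 2) ^ n \<le> of_int \<lfloor>2 ^ n * x\<rfloor> / 2 ^ n" by (simp add: diff_divide_distrib power_divide)
    qed
    show "\<forall>\<^sub>F n in sequentially. of_int \<lfloor>2 ^ n * x\<rfloor> / 2 ^ n \<le> x"
    proof (intro always_eventually allI)
      fix n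
      have "of_int \<lfloor>2 ^ n * x\<rfloor> \<le> 2 ^ n * x" by linarith
      then show "of_int \<lfloor>2 ^ n * x\<rfloor> / 2 ^ n \<le> x" by (simp add: field_simps)
    qed
    show "(\<lambda>n. x - (1 / 2) ^ n) \<longlonglongrightarrow> x"
      using tendsto_diff[OF tendsto_const LIMSEQ_power_zero[of "1/2::real"], of x] by simp
  qed auto
  then show ?thesis unfolding sums_def part .
qed

text \<open>Schoenberg's curve: \<open>fold_wave (3 ^ m * t)\<close> reads off the \<open>m\<close>-th ternary digit (0 or 2) of \<open>t\<close>, and
  the section \<open>s\<close> interleaves the binary digits of the coordinates as such ternary digits.\<close>

lemma space_filling_curve:
  obtains \<phi> :: "real \<Rightarrow> 'a::euclidean_space" and s :: "'a \<Rightarrow> real"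
  where "continuous_on UNIV \<phi>" "s \<in> borel_measurable borel" "\<And>x. s x \<in> {0..1}"
    "\<And>x. (\<And>i. i \<in> Basis \<Longrightarrow> 0 \<le> x \<bullet> i \<and> x \<bullet> i < 1) \<Longrightarrow> \<phi> (s x) = x"
proof -
  let ?d = "DIM('a)"
  obtain b where b: "bij_betw b {..<?d} (Basis :: 'a set)"
    using ex_bij_betw_nat_finite[OF finite_Basis] by (auto simp: atLeast0LessThan)
  define idx where "idx = the_inv_into {..<?d} b"
  have idx: "idx i < ?d" "b (idx i) = i" if "i \<in> Basis" for i
    using that b unfolding idx_def
    by (auto simp: bij_betw_def f_the_inv_into_f the_inv_into_into[of b "{..<?d}" i "{..<?d}", simplified])
  define coord where "coord i t = (\<Sum>k. (1 / 2) ^ Suc k * fold_wave (3 ^ (?d * k + idx i) * t))" for i t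
  define \<phi> where "\<phi> t = (\<Sum>i\<in>Basis. coord i t *\<^sub>R i)" for t
  define dig where "dig x j = binary_digit (j div ?d) (x \<bullet> b (j mod ?d))" for x j
  define s where "s x = (\<Sum>j. 2 * dig x j / 3 ^ Suc j)" for x
  have dr: "dig x j \<in> {0, 1}" for x j unfolding dig_def by (rule binary_digit_range)
  have "continuous_on UNIV (coord i)" for i
  proof -
    have "uniform_limit UNIV (\<lambda>n t. \<Sum>k<n. (1 / 2) ^ Suc k * fold_wave (3 ^ (?d * k + idx i) * t)) (coord i) sequentially"
      unfolding coord_def
    proof (rule Weierstrass_m_test)
      show "summable (\<lambda>k. (1 / 2 :: real) ^ Suc k)" by (simp add: summable_geometric)
    qed (use fold_wave_bounds in auto)
    then show ?thesis
      by (rule uniform_limit_theorem[rotated]) (auto intro!: always_eventually continuous_intros)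
  qed
  then have "continuous_on UNIV \<phi>" unfolding \<phi>_def by (intro continuous_intros)
  moreover have "s \<in> borel_measurable borel"
  proof -
    have [measurable]: "(\<lambda>x. dig x j) \<in> borel_measurable borel" for j
      unfolding dig_def by measurable
    show ?thesis unfolding s_def by measurable
  qed
  moreover have "s x \<in> {0..1}" for x
    unfolding s_def using ternary_tail_bounds[of "dig x"] dr by auto
  moreover have "\<phi> (s x) = x" if x: "\<And>i. i \<in> Basis \<Longrightarrow> 0 \<le> x \<bullet> i \<and> x \<bullet> i < 1" for x
  proof -
    have "coord i (s x) = x \<bullet> i" if i: "i \<in> Basis" for i
    proof -
      have "fold_wave (3 ^ (?d * k + idx i) * s x) = binary_digit k (x \<bullet> i)" for k
        unfolding s_def using fold_wave_ternary_digit[of "dig x" "?d * k + idx i"] dr idx[OF i]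
        by (simp add: dig_def)
      then show ?thesis unfolding coord_def
        using binary_expansion[of "x \<bullet> i"] x[OF i] by (simp add: sums_iff)
    qed
    then show ?thesis unfolding \<phi>_def by (simp add: euclidean_representation)
  qed
  ultimately show thesis by (rule that)
qed

lemma skorokhod_compactness_cube:
  fixes \<nu> :: "nat \<Rightarrow> 'a::euclidean_space measure"
  assumes "\<And>n. sets (\<nu> n) = sets borel" "\<And>n. prob_space (\<nu> n)"
    and cube: "\<And>n. AE x in \<nu> n. \<forall>i\<in>Basis. 0 \<le> x \<bullet> i \<and> x \<bullet> i < 1"
  obtains r :: "nat \<Rightarrow> nat" and \<Omega> :: "real measure" and Y Y' where
    "strict_mono r" "prob_space \<Omega>" "\<And>n. Y n \<in> borel_measurable \<Omega>" "Y' \<in> borel_measurable \<Omega>"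
    "\<And>n. distr \<Omega> borel (Y n) = \<nu> (r n)" "\<And>\<omega>. \<omega> \<in> space \<Omega> \<Longrightarrow> (\<lambda>n. Y n \<omega>) \<longlonglongrightarrow> Y' \<omega>"
proof -
  obtain \<phi> :: "real \<Rightarrow> 'a" and s :: "'a \<Rightarrow> real" where c: "continuous_on UNIV \<phi>"
    and s[measurable]: "s \<in> borel_measurable borel" and s01: "\<And>x. s x \<in> {0..1}"
    and sec: "\<And>x. (\<And>i. i \<in> Basis \<Longrightarrow> 0 \<le> x \<bullet> i \<and> x \<bullet> i < 1) \<Longrightarrow> \<phi> (s x) = x"
    using space_filling_curve[where 'a='a] by blast
  have [measurable]: "\<phi> \<in> borel_measurable borel" using c by (rule borel_measurable_continuous_onI)
  have sm[measurable]: "s \<in> borel_measurable (\<nu> n)" for n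
    by (simp add: measurable_cong_sets[OF assms(1) refl])
  define \<rho> where "\<rho> n = distr (\<nu> n) borel s" for n
  have rd: "real_distribution (\<rho> n)" for n
    unfolding \<rho>_def real_distribution_def real_distribution_axioms_def
    using assms(2) by (auto intro!: prob_space.prob_space_distr)
  have mass: "measure (\<rho> n) {-1<..1} = 1" for n
  proof -
    interpret prob_space "\<nu> n" by fact
    have "s -` {-1<..1} = UNIV" using s01 by (fastforce simp: less_le_trans[of "-1" 0])
    then have "measure (\<rho> n) {-1<..1} = measure (\<nu> n) (space (\<nu> n))"
      unfolding \<rho>_def by (subst measure_distr) auto
    then show ?thesis by (simp add: prob_space)
  qed
  have "\<exists>a b. a < b \<and> (\<forall>n. 1 - e < measure (\<rho> n) {a<..b})" if "e > 0" for e :: real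
  proof -
    have "(-1::real) < 1 \<and> (\<forall>n. 1 - e < measure (\<rho> n) {-1<..1})" using that by (simp add: mass)
    then show ?thesis by blast
  qed
  then have "tight \<rho>"
    unfolding tight_def using rd by simp
  then obtain r M where r: "strict_mono r" "real_distribution M" "weak_conv_m (\<rho> \<circ> id \<circ> r) M"
    using tight_imp_convergent_subsubsequence[of \<rho> id] by (auto simp: strict_mono_def)
  obtain \<Omega> :: "real measure" and T :: "nat \<Rightarrow> real \<Rightarrow> real" and T' where
    T: "prob_space \<Omega>" "\<And>n. T n \<in> borel_measurable \<Omega>" "\<And>n. distr \<Omega> borel (T n) = \<rho> (r n)"
      "T' \<in> borel_measurable \<Omega>" "\<And>x. x \<in> space \<Omega> \<Longrightarrow> (\<lambda>n. T n x) \<longlonglongrightarrow> T' x"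
    using Skorohod[of "\<lambda>n. \<rho> (r n)" M] rd r by (simp add: comp_def) metis
  note [measurable] = T(2,4)
  show thesis
  proof (rule that[of r \<Omega> "\<lambda>n \<omega>. \<phi> (T n \<omega>)" "\<lambda>\<omega>. \<phi> (T' \<omega>)"])
    fix n
    have "distr \<Omega> borel (\<lambda>\<omega>. \<phi> (T n \<omega>)) = distr (\<rho> (r n)) borel \<phi>"
      unfolding T(3)[symmetric] by (subst distr_distr) (auto simp: comp_def)
    also have "\<dots> = distr (\<nu> (r n)) borel (\<lambda>x. \<phi> (s x))"
      unfolding \<rho>_def by (subst distr_distr) (auto simp: comp_def)
    also have "\<dots> = distr (\<nu> (r n)) borel (\<lambda>x. x)"
      using cube[of "r n"] sec
      by (intro distr_cong_AE) (auto simp: measurable_ident_sets[OF assms(1)] elim!: eventually_mono)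
    also have "\<dots> = \<nu> (r n)" by (rule distr_id2) (use assms(1) in auto)
    finally show "distr \<Omega> borel (\<lambda>\<omega>. \<phi> (T n \<omega>)) = \<nu> (r n)" .
  next
    fix \<omega> assume "\<omega> \<in> space \<Omega>"
    then show "(\<lambda>n. \<phi> (T n \<omega>)) \<longlonglongrightarrow> \<phi> (T' \<omega>)"
      using T(5) c by (auto intro: continuous_on_tendsto_compose)
  qed (use T r in auto)
qed

lemma fatou_integral_le:
  fixes f :: "nat \<Rightarrow> 'b \<Rightarrow> real"
  assumes [measurable]: "\<And>n. f n \<in> borel_measurable M" "f' \<in> borel_measurable M"
    and lim: "AE \<omega> in M. (\<lambda>n. f n \<omega>) \<longlonglongrightarrow> f' \<omega>"
    and nn: "\<And>n. AE \<omega> in M. 0 \<le> f n \<omega>"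
    and int: "\<And>n. integrable M (f n)" and le: "\<And>n. (\<integral>\<omega>. f n \<omega> \<partial>M) \<le> B"
  shows "integrable M f'" "(\<integral>\<omega>. f' \<omega> \<partial>M) \<le> B"
proof -
  have "AE \<omega> in M. \<forall>n. 0 \<le> f n \<omega>" using nn by (simp add: AE_all_countable)
  then have nn': "AE \<omega> in M. 0 \<le> f' \<omega>"
    using lim by eventually_elim (auto intro: tendsto_lowerbound[OF _ always_eventually])
  have "0 \<le> (\<integral>\<omega>. f 0 \<omega> \<partial>M)" using nn by (intro integral_nonneg_AE)
  then have B: "0 \<le> B" using le[of 0] by simp
  have "(\<integral>\<^sup>+\<omega>. ennreal (f' \<omega>) \<partial>M) = (\<integral>\<^sup>+\<omega>. liminf (\<lambda>n. ennreal (f n \<omega>)) \<partial>M)"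
    using lim by (intro nn_integral_cong_AE)
      (auto elim!: eventually_mono intro!: lim_imp_Liminf[symmetric] tendsto_ennrealI)
  also have "\<dots> \<le> liminf (\<lambda>n. \<integral>\<^sup>+\<omega>. ennreal (f n \<omega>) \<partial>M)"
    by (rule nn_integral_liminf) auto
  also have "\<dots> \<le> ennreal B"
  proof (rule Liminf_le)
    show "\<forall>\<^sub>F n in sequentially. (\<integral>\<^sup>+\<omega>. ennreal (f n \<omega>) \<partial>M) \<le> ennreal B"
      using nn int le by (intro always_eventually allI) (subst nn_integral_eq_integral, auto intro: ennreal_leI)
  qed auto
  finally have *: "(\<integral>\<^sup>+\<omega>. ennreal (f' \<omega>) \<partial>M) \<le> ennreal B" .
  show i: "integrable M f'"
    by (rule integrableI_nonneg) (use nn' * in \<open>auto intro: order.strict_trans1\<close>)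
  show "(\<integral>\<omega>. f' \<omega> \<partial>M) \<le> B"
    using * nn_integral_eq_integral[OF i nn'] B by simp
qed

definition squash :: "'a::euclidean_space \<Rightarrow> 'a" where
  "squash x = (1 / 2) *\<^sub>R (One + (1 / (1 + norm x)) *\<^sub>R x)"

definition unsquash :: "'a::euclidean_space \<Rightarrow> 'a" where
  "unsquash y = (1 / (1 - norm (2 *\<^sub>R y - One))) *\<^sub>R (2 *\<^sub>R y - One)"

lemma squash_center: "2 *\<^sub>R squash x - One = (1 / (1 + norm x)) *\<^sub>R x"
  unfolding squash_def by simp

lemma norm_squash_center: "1 - norm (2 *\<^sub>R squash x - One) = 1 / (1 + norm x)"
proof -
  have "1 + norm x > 0" using norm_ge_zero[of x] by linarith
  then show ?thesis unfolding squash_center by (simp add: divide_simps)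
qed

lemma unsquash_squash: "unsquash (squash x) = x"
proof -
  have "1 + norm x \<noteq> 0" using norm_ge_zero[of x] by linarith
  then show ?thesis unfolding unsquash_def norm_squash_center unfolding squash_center by simp
qed

lemma squash_in_cube:
  assumes "i \<in> Basis"
  shows "0 \<le> squash x \<bullet> i" "squash x \<bullet> i < 1"
proof -
  define c where "c = (x \<bullet> i) / (1 + norm x)"
  have "1 + norm x > 0" "\<bar>x \<bullet> i\<bar> < 1 + norm x"
    using Basis_le_norm[OF assms, of x] norm_ge_zero[of x] by linarith+
  then have "\<bar>c\<bar> < 1" unfolding c_def abs_divide by (simp add: divide_simps)
  moreover have "squash x \<bullet> i = (1 + c) / 2"
    using assms by (simp add: squash_def inner_add_left c_def)
  ultimately show "0 \<le> squash x \<bullet> i" "squash x \<bullet> i < 1" by auto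
qed

lemma squash_measurable [measurable]: "squash \<in> borel_measurable borel"
  unfolding squash_def by measurable

lemma unsquash_measurable [measurable]: "unsquash \<in> borel_measurable borel"
  unfolding unsquash_def by measurable

lemma isCont_unsquash: "norm (2 *\<^sub>R y - One) \<noteq> 1 \<Longrightarrow> isCont unsquash y"
  unfolding unsquash_def by (intro continuous_intros) auto

text \<open>Squashing \<open>\<real>\<^sup>d\<close> onto an open ball inside the unit cube replaces tightness: the second moment
  bound forbids the limit to charge the boundary of the ball.\<close>

lemma skorokhod_compactness:
  fixes \<mu> :: "nat \<Rightarrow> 'a::euclidean_space measure"
  assumes P: "\<And>n. \<mu> n \<in> P2" and B: "\<And>n. second_moment (\<mu> n) \<le> B"
  obtains r :: "nat \<Rightarrow> nat" and \<Omega> :: "real measure" and X X' where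
    "strict_mono r" "prob_space \<Omega>" "\<And>n. X n \<in> borel_measurable \<Omega>" "X' \<in> borel_measurable \<Omega>"
    "\<And>n. distr \<Omega> borel (X n) = \<mu> (r n)" "AE \<omega> in \<Omega>. (\<lambda>n. X n \<omega>) \<longlonglongrightarrow> X' \<omega>"
    "distr \<Omega> borel X' \<in> P2" "second_moment (distr \<Omega> borel X') \<le> B"
proof -
  note mu = P2D[OF P]
  have [measurable]: "squash \<in> borel_measurable (\<mu> n)" for n
    by (simp add: measurable_cong_sets[OF mu(1) refl])
  define \<nu> where "\<nu> n = distr (\<mu> n) borel squash" for n
  have c: "AE x in \<nu> n. \<forall>i\<in>Basis. 0 \<le> x \<bullet> i \<and> x \<bullet> i < 1" for n
    unfolding \<nu>_def by (subst AE_distr_iff) (auto simp: squash_in_cube)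
  have s: "sets (\<nu> n) = sets borel" "prob_space (\<nu> n)" for n
    unfolding \<nu>_def using mu(2) by (auto intro!: prob_space.prob_space_distr)
  obtain r :: "nat \<Rightarrow> nat" and \<Omega> :: "real measure" and Y Y' where
    r: "strict_mono r" and "prob_space \<Omega>"
    and Ym[measurable]: "\<And>n. Y n \<in> borel_measurable \<Omega>" "Y' \<in> borel_measurable \<Omega>"
    and Yl: "\<And>n. distr \<Omega> borel (Y n) = \<nu> (r n)"
    and lim: "\<And>\<omega>. \<omega> \<in> space \<Omega> \<Longrightarrow> (\<lambda>n. Y n \<omega>) \<longlonglongrightarrow> Y' \<omega>"
    using skorokhod_compactness_cube[of \<nu>, OF s c] by metis
  interpret prob_space \<Omega> by fact
  define X where "X n \<omega> = unsquash (Y n \<omega>)" for n \<omega>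
  define X' where "X' \<omega> = unsquash (Y' \<omega>)" for \<omega>
  have Xm[measurable]: "\<And>n. X n \<in> borel_measurable \<Omega>" "X' \<in> borel_measurable \<Omega>"
    unfolding X_def X'_def by measurable
  have Xl: "distr \<Omega> borel (X n) = \<mu> (r n)" for n
  proof -
    have "distr \<Omega> borel (X n) = distr (distr \<Omega> borel (Y n)) borel unsquash"
      unfolding X_def by (subst distr_distr) (auto simp: comp_def)
    also have "\<dots> = distr (\<mu> (r n)) borel (\<lambda>x. x)"
      unfolding Yl \<nu>_def by (subst distr_distr) (auto simp: comp_def unsquash_squash)
    also have "\<dots> = \<mu> (r n)" by (rule distr_id2) (use mu in auto)
    finally show ?thesis .
  qed
  have int: "integrable \<Omega> (\<lambda>\<omega>. (norm (X n \<omega>))\<^sup>2)" and le: "(\<integral>\<omega>. (norm (X n \<omega>))\<^sup>2 \<partial>\<Omega>) \<le> B" for n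
    using integrable_sq_of_law[of "X n" \<Omega>] P Xl second_moment_distr[of "X n" \<Omega>] B[of "r n"] by auto
  have img: "AE \<omega> in \<Omega>. \<forall>n. 1 - norm (2 *\<^sub>R Y n \<omega> - One) = 1 / (1 + norm (X n \<omega>))"
  proof -
    have "AE \<omega> in \<Omega>. 1 - norm (2 *\<^sub>R Y n \<omega> - One) = 1 / (1 + norm (unsquash (Y n \<omega>)))" for n
    proof -
      have "AE y in distr \<Omega> borel (Y n). 1 - norm (2 *\<^sub>R y - One) = 1 / (1 + norm (unsquash y))"
        unfolding Yl \<nu>_def by (subst AE_distr_iff) (auto simp: unsquash_squash norm_squash_center)
      then show ?thesis by (subst (asm) AE_distr_iff) auto
    qed
    then show ?thesis unfolding X_def by (simp add: AE_all_countable)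
  qed
  have "(\<integral>\<^sup>+\<omega>. liminf (\<lambda>n. ennreal ((norm (X n \<omega>))\<^sup>2)) \<partial>\<Omega>) \<le> liminf (\<lambda>n. \<integral>\<^sup>+\<omega>. ennreal ((norm (X n \<omega>))\<^sup>2) \<partial>\<Omega>)"
    by (rule nn_integral_liminf) auto
  also have "\<dots> \<le> ennreal B"
    using int le by (intro Liminf_le always_eventually allI)
      (auto simp: nn_integral_eq_integral intro!: ennreal_leI)
  finally have "AE \<omega> in \<Omega>. liminf (\<lambda>n. ennreal ((norm (X n \<omega>))\<^sup>2)) \<noteq> \<infinity>"
    by (intro nn_integral_PInf_AE) (auto simp: top_unique)
  then have nb: "AE \<omega> in \<Omega>. norm (2 *\<^sub>R Y' \<omega> - One) \<noteq> 1"
    using img AE_space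
  proof eventually_elim
    fix \<omega> assume fin: "liminf (\<lambda>n. ennreal ((norm (X n \<omega>))\<^sup>2)) \<noteq> \<infinity>"
      and im: "\<forall>n. 1 - norm (2 *\<^sub>R Y n \<omega> - One) = 1 / (1 + norm (X n \<omega>))" and om: "\<omega> \<in> space \<Omega>"
    show "norm (2 *\<^sub>R Y' \<omega> - One) \<noteq> 1"
    proof
      assume "norm (2 *\<^sub>R Y' \<omega> - One) = 1"
      moreover have "(\<lambda>n. 1 - norm (2 *\<^sub>R Y n \<omega> - One)) \<longlonglongrightarrow> 1 - norm (2 *\<^sub>R Y' \<omega> - One)"
        by (intro tendsto_intros lim om)
      ultimately have "(\<lambda>n. 1 / (1 + norm (X n \<omega>))) \<longlonglongrightarrow> 0" using im by simp
      then have "filterlim (\<lambda>n. inverse (inverse (1 + norm (X n \<omega>)))) at_top sequentially"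
        by (intro filterlim_inverse_at_top) (auto simp: field_simps add_pos_nonneg)
      then have "filterlim (\<lambda>n. 1 + norm (X n \<omega>)) at_top sequentially" by simp
      then have "filterlim (\<lambda>n. norm (X n \<omega>)) at_top sequentially"
        using filterlim_tendsto_add_at_top[OF tendsto_const[of "-1::real"]] by fastforce
      then have "filterlim (\<lambda>n. (norm (X n \<omega>))\<^sup>2) at_top sequentially"
        by (intro filterlim_pow_at_top) auto
      then have "(\<lambda>n. ennreal ((norm (X n \<omega>))\<^sup>2)) \<longlonglongrightarrow> \<infinity>"
        by (simp add: ennreal_tendsto_top_eq_at_top)
      then have "liminf (\<lambda>n. ennreal ((norm (X n \<omega>))\<^sup>2)) = \<infinity>"
        by (rule lim_imp_Liminf[OF sequentially_bot])
      then show False using fin by simp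
    qed
  qed
  have XlimAE: "AE \<omega> in \<Omega>. (\<lambda>n. X n \<omega>) \<longlonglongrightarrow> X' \<omega>"
    using nb AE_space
  proof eventually_elim
    case (elim \<omega>)
    then show ?case unfolding X_def X'_def
      by (intro isCont_tendsto_compose[OF isCont_unsquash] lim) auto
  qed
  have limsq: "AE \<omega> in \<Omega>. (\<lambda>n. (norm (X n \<omega>))\<^sup>2) \<longlonglongrightarrow> (norm (X' \<omega>))\<^sup>2"
    using XlimAE by eventually_elim (intro tendsto_intros)
  have i': "integrable \<Omega> (\<lambda>\<omega>. (norm (X' \<omega>))\<^sup>2)" "(\<integral>\<omega>. (norm (X' \<omega>))\<^sup>2 \<partial>\<Omega>) \<le> B"
    by (rule fatou_integral_le[OF _ _ limsq]; use int le in auto)+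
  show thesis
    by (rule that[of r \<Omega> X X'])
      (use r XlimAE Xl i' prob_space_axioms in \<open>auto simp: distr_in_P2_iff second_moment_distr\<close>)
qed

text \<open>Vitali's convergence theorem, with uniform integrability in the form in which it is verified below.\<close>

lemma integral_tendsto_0_almost_dominated:
  fixes Z Y :: "nat \<Rightarrow> 'b \<Rightarrow> real"
  assumes [measurable]: "\<And>n. Z n \<in> borel_measurable M"
    and lim: "AE \<omega> in M. (\<lambda>n. Z n \<omega>) \<longlonglongrightarrow> 0"
    and Y: "\<And>n. integrable M (Y n)" "\<And>n. (\<integral>\<omega>. Y n \<omega> \<partial>M) \<le> B" "\<And>n \<omega>. 0 \<le> Y n \<omega>"
    and dom: "\<And>e. e > 0 \<Longrightarrow> \<exists>g. integrable M g \<and> (\<forall>n \<omega>. \<bar>Z n \<omega>\<bar> \<le> g \<omega> + e * Y n \<omega>)"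
  shows "\<And>n. integrable M (Z n)" "(\<lambda>n. \<integral>\<omega>. \<bar>Z n \<omega>\<bar> \<partial>M) \<longlonglongrightarrow> 0" "(\<lambda>n. \<integral>\<omega>. Z n \<omega> \<partial>M) \<longlonglongrightarrow> 0"
proof -
  obtain g1 where "integrable M g1" "\<And>n \<omega>. \<bar>Z n \<omega>\<bar> \<le> g1 \<omega> + 1 * Y n \<omega>"
    using dom[of 1] by auto
  then have Zint: "integrable M (Z n)" for n
  proof -
    have "integrable M (\<lambda>\<omega>. g1 \<omega> + 1 * Y n \<omega>)" using Y \<open>integrable M g1\<close> by auto
    then show ?thesis
      by (rule Bochner_Integration.integrable_bound)
        (use \<open>\<And>n \<omega>. \<bar>Z n \<omega>\<bar> \<le> g1 \<omega> + 1 * Y n \<omega>\<close> in \<open>auto intro: order_trans[OF _ abs_ge_self]\<close>)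
  qed
  then show "\<And>n. integrable M (Z n)" .
  have "0 \<le> (\<integral>\<omega>. Y 0 \<omega> \<partial>M)" using Y(3) by (intro integral_nonneg_AE) simp
  then have B: "0 \<le> B" using Y(2)[of 0] by linarith
  show abs0: "(\<lambda>n. \<integral>\<omega>. \<bar>Z n \<omega>\<bar> \<partial>M) \<longlonglongrightarrow> 0"
  proof (rule LIMSEQ_I)
    fix \<epsilon> :: real assume "\<epsilon> > 0"
    define e where "e = \<epsilon> / (2 * (B + 1))"
    have e: "e > 0" "e * B < \<epsilon> / 2" using \<open>\<epsilon> > 0\<close> B by (auto simp: e_def field_simps)
    obtain g where g: "integrable M g" "\<And>n \<omega>. \<bar>Z n \<omega>\<bar> \<le> g \<omega> + e * Y n \<omega>"
      using dom[OF e(1)] by auto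
    have [measurable]: "g \<in> borel_measurable M" using g(1) by auto
    define G where "G n \<omega> = min \<bar>Z n \<omega>\<bar> \<bar>g \<omega>\<bar>" for n \<omega>
    have Gm[measurable]: "G n \<in> borel_measurable M" for n unfolding G_def by measurable
    have Gint: "integrable M (G n)" for n
      by (rule Bochner_Integration.integrable_bound[OF integrable_abs[OF g(1)]]) (auto simp: G_def)
    have "(\<lambda>n. \<integral>\<omega>. G n \<omega> \<partial>M) \<longlonglongrightarrow> (\<integral>\<omega>. 0 \<partial>M)"
    proof (rule integral_dominated_convergence[where w="\<lambda>\<omega>. \<bar>g \<omega>\<bar>"])
      show "AE \<omega> in M. (\<lambda>n. G n \<omega>) \<longlonglongrightarrow> 0"
        using lim
      proof eventually_elim
        case (elim \<omega>)
        have "(\<lambda>n. min \<bar>Z n \<omega>\<bar> \<bar>g \<omega>\<bar>) \<longlonglongrightarrow> min \<bar>0\<bar> \<bar>g \<omega>\<bar>" by (intro tendsto_intros elim)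
        then show ?case by (simp add: G_def)
      qed
    qed (use g(1) in \<open>auto simp: G_def\<close>)
    from LIMSEQ_D[OF this, of "\<epsilon> / 2"] \<open>\<epsilon> > 0\<close>
    obtain N where N: "\<And>n. n \<ge> N \<Longrightarrow> \<bar>\<integral>\<omega>. G n \<omega> \<partial>M\<bar> < \<epsilon> / 2" by fastforce
    have "norm ((\<integral>\<omega>. \<bar>Z n \<omega>\<bar> \<partial>M) - 0) < \<epsilon>" if "n \<ge> N" for n
    proof -
      have "(\<integral>\<omega>. \<bar>Z n \<omega>\<bar> \<partial>M) \<le> (\<integral>\<omega>. G n \<omega> + e * Y n \<omega> \<partial>M)"
      proof (rule integral_mono)
        fix \<omega>
        have "0 \<le> e * Y n \<omega>" using e(1) Y(3) by simp
        then show "\<bar>Z n \<omega>\<bar> \<le> G n \<omega> + e * Y n \<omega>" using g(2)[of n \<omega>] unfolding G_def by linarith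
      qed (use Zint Gint Y in auto)
      also have "\<dots> = (\<integral>\<omega>. G n \<omega> \<partial>M) + e * (\<integral>\<omega>. Y n \<omega> \<partial>M)"
        using Gint Y by simp
      also have "\<dots> \<le> (\<integral>\<omega>. G n \<omega> \<partial>M) + e * B"
        using Y(2)[of n] e(1) by (simp add: mult_left_mono)
      finally show ?thesis using N[OF that] e(2) by simp
    qed
    then show "\<exists>N. \<forall>n\<ge>N. norm ((\<integral>\<omega>. \<bar>Z n \<omega>\<bar> \<partial>M) - 0) < \<epsilon>" by blast
  qed
  show "(\<lambda>n. \<integral>\<omega>. Z n \<omega> \<partial>M) \<longlonglongrightarrow> 0"
    by (rule Lim_null_comparison[OF always_eventually abs0]) (auto intro: integral_abs_bound)
qed

lemma closed_indicator_limit: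
  fixes A :: "'a::euclidean_space set"
  assumes "closed A" "A \<noteq> {}"
  shows "(\<lambda>k. max 0 (1 - real k * infdist x A)) \<longlonglongrightarrow> indicator A x"
proof (cases "x \<in> A")
  case False
  then have "infdist x A > 0" using assms by (simp add: in_closed_iff_infdist_zero infdist_pos_not_in_closed)
  then obtain K :: nat where K: "1 < real K * infdist x A" by (meson reals_Archimedean3)
  have "\<forall>\<^sub>F k in sequentially. max 0 (1 - real k * infdist x A) = 0"
  proof (rule eventually_sequentiallyI[of K])
    fix k assume "K \<le> k"
    then have "real K * infdist x A \<le> real k * infdist x A" by (intro mult_right_mono) (auto simp: infdist_nonneg)
    then show "max 0 (1 - real k * infdist x A) = 0" using K by simp
  qed
  then show ?thesis using False by (simp add: tendsto_eventually)
qed simp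

lemma measure_eqI_bounded_continuous:
  fixes \<mu> \<nu> :: "'a::euclidean_space measure"
  assumes s: "sets \<mu> = sets borel" "sets \<nu> = sets borel" and p: "prob_space \<mu>" "prob_space \<nu>"
    and eq: "\<And>f :: 'a \<Rightarrow> real. continuous_on UNIV f \<Longrightarrow> (\<And>x. \<bar>f x\<bar> \<le> 1) \<Longrightarrow> (\<integral>x. f x \<partial>\<mu>) = (\<integral>x. f x \<partial>\<nu>)"
  shows "\<mu> = \<nu>"
proof -
  have m: "measure \<mu> A = measure \<nu> A" if A: "closed A" for A
  proof (cases "A = {}")
    case False
    define f where "f k x = max 0 (1 - real k * infdist x A)" for k x
    have c: "continuous_on UNIV (f k)" for k
      unfolding f_def by (intro continuous_on_max continuous_on_const continuous_on_diff
          continuous_on_mult continuous_on_infdist continuous_on_id)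
    have b: "\<bar>f k x\<bar> \<le> 1" for k x
      unfolding f_def by (auto simp: infdist_nonneg)
    have conv: "(\<lambda>k. \<integral>x. f k x \<partial>\<rho>) \<longlonglongrightarrow> measure \<rho> A"
      if r: "sets \<rho> = sets borel" "prob_space \<rho>" for \<rho> :: "'a measure"
    proof -
      interpret prob_space \<rho> by fact
      have [measurable]: "f k \<in> borel_measurable \<rho>" for k
        using c by (simp add: measurable_cong_sets[OF r(1) refl] borel_measurable_continuous_onI)
      have [measurable]: "A \<in> sets \<rho>" using A r by auto
      have "(\<lambda>k. \<integral>x. f k x \<partial>\<rho>) \<longlonglongrightarrow> (\<integral>x. indicator A x \<partial>\<rho>)"
        using closed_indicator_limit[OF A False, folded f_def] b
        by (intro integral_dominated_convergence[where w="\<lambda>_. 1"]) auto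
      then show ?thesis by simp
    qed
    show ?thesis
      using conv[OF s(1) p(1)] conv[OF s(2) p(2)] eq[OF c b] by (auto intro: LIMSEQ_unique)
  qed simp
  interpret M: prob_space \<mu> by fact
  interpret N: prob_space \<nu> by fact
  show ?thesis
  proof (rule measure_eqI_generator_eq[where E="Collect closed" and \<Omega>=UNIV and A="\<lambda>_. UNIV"])
    show "Int_stable (Collect (closed :: 'a set \<Rightarrow> bool))" by (auto simp: Int_stable_def)
  qed (use m s in \<open>auto simp: borel_eq_closed M.emeasure_eq_measure N.emeasure_eq_measure\<close>)
qed

lemma integral_bounded_continuous_tendsto:
  fixes X :: "nat \<Rightarrow> 'b \<Rightarrow> 'a::euclidean_space" and f :: "'a \<Rightarrow> real"
  assumes "prob_space M" and [measurable]: "\<And>n. X n \<in> borel_measurable M" "X' \<in> borel_measurable M"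
    and lim: "AE \<omega> in M. (\<lambda>n. X n \<omega>) \<longlonglongrightarrow> X' \<omega>"
    and f: "continuous_on UNIV f" "\<And>x. \<bar>f x\<bar> \<le> 1"
  shows "(\<lambda>n. \<integral>x. f x \<partial>distr M borel (X n)) \<longlonglongrightarrow> (\<integral>x. f x \<partial>distr M borel X')"
proof -
  interpret prob_space M by fact
  have [measurable]: "f \<in> borel_measurable borel" using f(1) by (rule borel_measurable_continuous_onI)
  have "(\<lambda>n. \<integral>\<omega>. f (X n \<omega>) \<partial>M) \<longlonglongrightarrow> (\<integral>\<omega>. f (X' \<omega>) \<partial>M)"
  proof (rule integral_dominated_convergence[where w="\<lambda>_. 1"])
    show "AE \<omega> in M. (\<lambda>n. f (X n \<omega>)) \<longlonglongrightarrow> f (X' \<omega>)"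
      using lim by eventually_elim (auto intro: continuous_on_tendsto_compose[OF f(1)])
  qed (use f(2) in auto)
  then show ?thesis by (simp add: integral_distr)
qed

lemma limit_law_unique:
  fixes X :: "nat \<Rightarrow> 'b \<Rightarrow> 'a::euclidean_space" and Y :: "nat \<Rightarrow> 'c \<Rightarrow> 'a"
  assumes "prob_space M" "\<And>n. X n \<in> borel_measurable M" "X' \<in> borel_measurable M"
    "AE \<omega> in M. (\<lambda>n. X n \<omega>) \<longlonglongrightarrow> X' \<omega>"
    and "prob_space N" "\<And>n. Y n \<in> borel_measurable N" "Y' \<in> borel_measurable N"
    "AE \<omega> in N. (\<lambda>n. Y n \<omega>) \<longlonglongrightarrow> Y' \<omega>"
    and eq: "\<And>n. distr M borel (X n) = distr N borel (Y n)"
  shows "distr M borel X' = distr N borel Y'"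
proof (rule measure_eqI_bounded_continuous)
  fix f :: "'a \<Rightarrow> real" assume f: "continuous_on UNIV f" "\<And>x. \<bar>f x\<bar> \<le> 1"
  show "(\<integral>x. f x \<partial>distr M borel X') = (\<integral>x. f x \<partial>distr N borel Y')"
    using integral_bounded_continuous_tendsto[OF assms(1-4) f]
      integral_bounded_continuous_tendsto[OF assms(5-8) f] unfolding eq by (rule LIMSEQ_unique)
qed (use assms in \<open>auto intro!: prob_space.prob_space_distr\<close>)

section \<open>The Wasserstein metric and optimal plans\<close>

lemma P2_law:
  assumes "distr M borel X \<in> P2" "distr M borel Y \<in> P2" "prob_space M"
    and [measurable]: "X \<in> borel_measurable M" "Y \<in> borel_measurable M"
  shows "distr M borel (\<lambda>\<omega>. a *\<^sub>R X \<omega> + b *\<^sub>R Y \<omega>) \<in> P2"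
proof -
  have i: "integrable M (\<lambda>\<omega>. (norm (X \<omega>))\<^sup>2)" "integrable M (\<lambda>\<omega>. (norm (Y \<omega>))\<^sup>2)"
    using integrable_sq_of_law[of X M] integrable_sq_of_law[of Y M] assms by auto
  have "integrable M (\<lambda>\<omega>. (norm (a *\<^sub>R X \<omega> + b *\<^sub>R Y \<omega>))\<^sup>2)"
  proof (rule Bochner_Integration.integrable_bound)
    show "integrable M (\<lambda>\<omega>. 2 * a\<^sup>2 * (norm (X \<omega>))\<^sup>2 + 2 * b\<^sup>2 * (norm (Y \<omega>))\<^sup>2)"
      using i by simp
    show "AE \<omega> in M. norm ((norm (a *\<^sub>R X \<omega> + b *\<^sub>R Y \<omega>))\<^sup>2)
        \<le> norm (2 * a\<^sup>2 * (norm (X \<omega>))\<^sup>2 + 2 * b\<^sup>2 * (norm (Y \<omega>))\<^sup>2)"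
    proof (intro AE_I2)
      fix \<omega> show "norm ((norm (a *\<^sub>R X \<omega> + b *\<^sub>R Y \<omega>))\<^sup>2)
        \<le> norm (2 * a\<^sup>2 * (norm (X \<omega>))\<^sup>2 + 2 * b\<^sup>2 * (norm (Y \<omega>))\<^sup>2)"
        using norm_add_sq_le[of "a *\<^sub>R X \<omega>" "b *\<^sub>R Y \<omega>"] by (simp add: power_mult_distrib)
    qed
  qed auto
  then show ?thesis using assms by (subst distr_in_P2_iff) auto
qed

lemma L2_triangle:
  fixes U V :: "'b \<Rightarrow> 'a::euclidean_space"
  assumes [measurable]: "U \<in> borel_measurable M" "V \<in> borel_measurable M"
    and iU: "integrable M (\<lambda>\<omega>. (norm (U \<omega>))\<^sup>2)" and iV: "integrable M (\<lambda>\<omega>. (norm (V \<omega>))\<^sup>2)"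
    and A: "(\<integral>\<omega>. (norm (U \<omega>))\<^sup>2 \<partial>M) \<le> a\<^sup>2" "a \<ge> 0" and B: "(\<integral>\<omega>. (norm (V \<omega>))\<^sup>2 \<partial>M) \<le> b\<^sup>2" "b \<ge> 0"
  shows "(\<integral>\<omega>. (norm (U \<omega> + V \<omega>))\<^sup>2 \<partial>M) \<le> (a + b)\<^sup>2"
proof -
  have le: "(\<integral>\<omega>. (norm (U \<omega> + V \<omega>))\<^sup>2 \<partial>M) \<le> (a' + b')\<^sup>2" if "a < a'" "b < b'" for a' b'
  proof -
    have ab: "a' > 0" "b' > 0" using that A B by auto
    have "(norm (U \<omega> + V \<omega>))\<^sup>2 \<le> (1 + b' / a') * (norm (U \<omega>))\<^sup>2 + (1 + a' / b') * (norm (V \<omega>))\<^sup>2" for \<omega>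
    proof -
      have "(norm (U \<omega> + V \<omega>))\<^sup>2 \<le> (norm (U \<omega>) + norm (V \<omega>))\<^sup>2"
        by (intro power_mono norm_triangle_ineq norm_ge_zero)
      also have "\<dots> \<le> (1 + b' / a') * (norm (U \<omega>))\<^sup>2 + (1 + a' / b') * (norm (V \<omega>))\<^sup>2"
      proof -
        let ?u = "norm (U \<omega>)" and ?v = "norm (V \<omega>)"
        have "0 \<le> (b' * ?u - a' * ?v)\<^sup>2 / (a' * b')" using ab by simp
        also have "\<dots> = b' / a' * ?u\<^sup>2 + a' / b' * ?v\<^sup>2 - 2 * ?u * ?v"
          using ab by (simp add: field_simps power2_eq_square)
        finally show ?thesis by (simp add: power2_sum algebra_simps)
      qed
      finally show ?thesis .
    qed
    moreover have i: "integrable M (\<lambda>\<omega>. (1 + b' / a') * (norm (U \<omega>))\<^sup>2 + (1 + a' / b') * (norm (V \<omega>))\<^sup>2)"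
      using iU iV by simp
    ultimately have "(\<integral>\<omega>. (norm (U \<omega> + V \<omega>))\<^sup>2 \<partial>M)
        \<le> (\<integral>\<omega>. (1 + b' / a') * (norm (U \<omega>))\<^sup>2 + (1 + a' / b') * (norm (V \<omega>))\<^sup>2 \<partial>M)"
      using ab by (intro integral_mono' i) auto
    also have "\<dots> = (1 + b' / a') * (\<integral>\<omega>. (norm (U \<omega>))\<^sup>2 \<partial>M) + (1 + a' / b') * (\<integral>\<omega>. (norm (V \<omega>))\<^sup>2 \<partial>M)"
      using iU iV by simp
    also have "\<dots> \<le> (1 + b' / a') * a'\<^sup>2 + (1 + a' / b') * b'\<^sup>2"
    proof (intro add_mono mult_left_mono)
      show "(\<integral>\<omega>. (norm (U \<omega>))\<^sup>2 \<partial>M) \<le> a'\<^sup>2" "(\<integral>\<omega>. (norm (V \<omega>))\<^sup>2 \<partial>M) \<le> b'\<^sup>2"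
        using A B that by (auto intro: order_trans[OF _ power_mono])
    qed (use ab in auto)
    also have "\<dots> = (a' + b')\<^sup>2" using ab by (simp add: field_simps power2_eq_square)
    finally show ?thesis .
  qed
  show ?thesis
  proof (rule tendsto_lowerbound)
    show "((\<lambda>h. ((a + h) + (b + h))\<^sup>2) \<longlongrightarrow> (a + b)\<^sup>2) (at_right 0)"
      by (rule tendsto_eq_intros refl | simp)+
    show "\<forall>\<^sub>F h in at_right 0. (\<integral>\<omega>. (norm (U \<omega> + V \<omega>))\<^sup>2 \<partial>M) \<le> ((a + h) + (b + h))\<^sup>2"
      using eventually_at_right_less[of "0::real"] by eventually_elim (rule le; simp)
  qed simp
qed

text \<open>In the following lemmas \<open>H\<close> is a mere witness: its convexity supplies the three-plans replacing the
  existence of optimal plans and the gluing lemma.\<close>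

context
  fixes H :: "'a::euclidean_space measure \<Rightarrow> ereal"
  assumes convex: "convex_gen_geodesics H"
begin

lemma gg_random_variables:
  assumes "\<nu> \<in> P2" "\<mu>0 \<in> P2" "\<mu>1 \<in> P2"
  obtains M :: "('a \<times> 'a \<times> 'a) measure" and X Y Z where
    "prob_space M"
    "X \<in> borel_measurable M" "Y \<in> borel_measurable M" "Z \<in> borel_measurable M"
    "distr M borel X = \<nu>" "distr M borel Y = \<mu>0" "distr M borel Z = \<mu>1"
    "(\<integral>\<omega>. (norm (X \<omega> - Y \<omega>))\<^sup>2 \<partial>M) = (wasserstein 2 \<nu> \<mu>0)\<^sup>2"
    "(\<integral>\<omega>. (norm (X \<omega> - Z \<omega>))\<^sup>2 \<partial>M) = (wasserstein 2 \<nu> \<mu>1)\<^sup>2"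
    "\<And>t. t \<in> {0..1} \<Longrightarrow> H (distr M borel (\<lambda>\<omega>. (1 - t) *\<^sub>R Y \<omega> + t *\<^sub>R Z \<omega>))
        \<le> ereal (1 - t) * H \<mu>0 + ereal t * H \<mu>1"
proof -
  obtain \<mu> where gg: "generalized_geodesic \<nu> \<mu>0 \<mu>1 \<mu>"
    and c: "\<And>s. s \<in> {0..1} \<Longrightarrow> H (\<mu> s) \<le> ereal (1 - s) * H \<mu>0 + ereal s * H \<mu>1"
    using convex assms unfolding convex_gen_geodesics_def by blast
  from gg assms show thesis
  proof (rule generalized_geodesic_random_variables)
    fix M :: "('a \<times> 'a \<times> 'a) measure" and X Y Z
    assume *: "prob_space M"
      "X \<in> borel_measurable M" "Y \<in> borel_measurable M" "Z \<in> borel_measurable M"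
      "distr M borel X = \<nu>" "distr M borel Y = \<mu>0" "distr M borel Z = \<mu>1"
      "(\<integral>\<omega>. (norm (X \<omega> - Y \<omega>))\<^sup>2 \<partial>M) = (wasserstein 2 \<nu> \<mu>0)\<^sup>2"
      "(\<integral>\<omega>. (norm (X \<omega> - Z \<omega>))\<^sup>2 \<partial>M) = (wasserstein 2 \<nu> \<mu>1)\<^sup>2"
      "\<And>t. t \<in> {0..1} \<Longrightarrow> \<mu> t = distr M borel (\<lambda>\<omega>. (1 - t) *\<^sub>R Y \<omega> + t *\<^sub>R Z \<omega>)"
    show thesis
    proof (rule that[OF *(1-9)])
      fix t :: real assume "t \<in> {0..1}"
      then show "H (distr M borel (\<lambda>\<omega>. (1 - t) *\<^sub>R Y \<omega> + t *\<^sub>R Z \<omega>))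
        \<le> ereal (1 - t) * H \<mu>0 + ereal t * H \<mu>1"
        using c[of t] *(10)[of t] by simp
    qed
  qed
qed

lemma optimal_random_variables:
  fixes \<mu> \<nu> :: "'a measure"
  assumes "\<nu> \<in> P2" "\<mu> \<in> P2"
  obtains M :: "('a \<times> 'a \<times> 'a) measure" and X Y where
    "prob_space M" "X \<in> borel_measurable M" "Y \<in> borel_measurable M"
    "distr M borel X = \<nu>" "distr M borel Y = \<mu>"
    "(\<integral>\<omega>. (norm (X \<omega> - Y \<omega>))\<^sup>2 \<partial>M) = (wasserstein 2 \<nu> \<mu>)\<^sup>2"
proof -
  obtain M :: "('a \<times> 'a \<times> 'a) measure" and X Y Z where
    M: "prob_space M"
    "X \<in> borel_measurable M" "Y \<in> borel_measurable M" "Z \<in> borel_measurable M"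
    "distr M borel X = \<nu>" "distr M borel Y = \<mu>" "distr M borel Z = \<nu>"
    "(\<integral>\<omega>. (norm (X \<omega> - Y \<omega>))\<^sup>2 \<partial>M) = (wasserstein 2 \<nu> \<mu>)\<^sup>2"
    by (rule gg_random_variables[OF assms assms(1)]) (rule that)
  show thesis by (rule that[OF M(1-3,5-6,8)])
qed

lemma wasserstein2_triangle:
  fixes \<mu> \<nu> \<rho> :: "'a measure"
  assumes P: "\<mu> \<in> P2" "\<nu> \<in> P2" "\<rho> \<in> P2"
  shows "wasserstein 2 \<mu> \<rho> \<le> wasserstein 2 \<mu> \<nu> + wasserstein 2 \<nu> \<rho>"
proof -
  obtain M :: "('a \<times> 'a \<times> 'a) measure" and X Y Z where
    M: "prob_space M"
    "X \<in> borel_measurable M" "Y \<in> borel_measurable M" "Z \<in> borel_measurable M"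
    "distr M borel X = \<nu>" "distr M borel Y = \<mu>" "distr M borel Z = \<rho>"
    "(\<integral>\<omega>. (norm (X \<omega> - Y \<omega>))\<^sup>2 \<partial>M) = (wasserstein 2 \<nu> \<mu>)\<^sup>2"
    "(\<integral>\<omega>. (norm (X \<omega> - Z \<omega>))\<^sup>2 \<partial>M) = (wasserstein 2 \<nu> \<rho>)\<^sup>2"
    by (rule gg_random_variables[OF P(2,1,3)]) (rule that)
  note [measurable] = M(2-4)
  have "(wasserstein 2 \<mu> \<rho>)\<^sup>2 \<le> (\<integral>\<omega>. (norm (Y \<omega> - Z \<omega>))\<^sup>2 \<partial>M)"
    by (rule wasserstein2_sq_le) (use M P in auto)
  also have "\<dots> = (\<integral>\<omega>. (norm ((Y \<omega> - X \<omega>) + (X \<omega> - Z \<omega>)))\<^sup>2 \<partial>M)" by simp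
  also have "\<dots> \<le> (wasserstein 2 \<nu> \<mu> + wasserstein 2 \<nu> \<rho>)\<^sup>2"
    by (rule L2_triangle)
      (use M P integrable_dist_sq_of_laws[of X M Y] integrable_dist_sq_of_laws[of X M Z]
        in \<open>auto simp: norm_minus_commute[of "Y _"]\<close>)
  finally show ?thesis
    using power2_le_imp_le by (fastforce simp: wasserstein_commute[of 2 \<nu> \<mu>])
qed

lemma wasserstein2_eq_0_imp:
  fixes \<mu> \<nu> :: "'a measure"
  assumes "\<mu> \<in> P2" "\<nu> \<in> P2" "wasserstein 2 \<mu> \<nu> = 0"
  shows "\<mu> = \<nu>"
proof -
  obtain M :: "('a \<times> 'a \<times> 'a) measure" and X Y where
    M: "prob_space M" "X \<in> borel_measurable M" "Y \<in> borel_measurable M"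
    "distr M borel X = \<mu>" "distr M borel Y = \<nu>"
    "(\<integral>\<omega>. (norm (X \<omega> - Y \<omega>))\<^sup>2 \<partial>M) = (wasserstein 2 \<mu> \<nu>)\<^sup>2"
    by (rule optimal_random_variables[OF assms(1,2)]) (rule that)
  have i: "integrable M (\<lambda>\<omega>. (norm (X \<omega> - Y \<omega>))\<^sup>2)"
    by (rule integrable_dist_sq_of_laws) (use M assms in auto)
  have "AE \<omega> in M. (norm (X \<omega> - Y \<omega>))\<^sup>2 = 0"
    using M(6) assms(3) integral_nonneg_eq_0_iff_AE[OF i] by simp
  then have "AE \<omega> in M. X \<omega> = Y \<omega>" by simp
  then have "distr M borel X = distr M borel Y" by (intro distr_cong_AE M) auto
  then show ?thesis using M by simp
qed

lemma wasserstein2_bounded: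
  fixes \<mu> \<nu> :: "'a measure"
  assumes "\<mu> \<in> P2" "\<nu> \<in> P2" "wasserstein 2 \<mu> \<nu> \<le> R"
  shows "second_moment \<nu> \<le> 2 * second_moment \<mu> + 2 * R\<^sup>2"
proof -
  obtain M :: "('a \<times> 'a \<times> 'a) measure" and X Y where
    M: "prob_space M" "X \<in> borel_measurable M" "Y \<in> borel_measurable M"
    "distr M borel X = \<mu>" "distr M borel Y = \<nu>"
    "(\<integral>\<omega>. (norm (X \<omega> - Y \<omega>))\<^sup>2 \<partial>M) = (wasserstein 2 \<mu> \<nu>)\<^sup>2"
    by (rule optimal_random_variables[OF assms(1,2)]) (rule that)
  note [measurable] = M(2,3)
  have i: "integrable M (\<lambda>\<omega>. (norm (X \<omega> - Y \<omega>))\<^sup>2)" "integrable M (\<lambda>\<omega>. (norm (X \<omega>))\<^sup>2)" "integrable M (\<lambda>\<omega>. (norm (Y \<omega>))\<^sup>2)"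
    using integrable_dist_sq_of_laws[of X M Y] integrable_sq_of_law[of X M] integrable_sq_of_law[of Y M] M assms by auto
  have "second_moment \<nu> = (\<integral>\<omega>. (norm (Y \<omega>))\<^sup>2 \<partial>M)"
    using second_moment_distr[of Y M] M by simp
  also have "\<dots> \<le> (\<integral>\<omega>. 2 * (norm (X \<omega>))\<^sup>2 + 2 * (norm (X \<omega> - Y \<omega>))\<^sup>2 \<partial>M)"
  proof (rule integral_mono)
    fix \<omega> show "(norm (Y \<omega>))\<^sup>2 \<le> 2 * (norm (X \<omega>))\<^sup>2 + 2 * (norm (X \<omega> - Y \<omega>))\<^sup>2"
      using norm_diff_sq_le[of "X \<omega>" "X \<omega> - Y \<omega>"] by simp
  qed (use i in auto)
  also have "\<dots> = 2 * second_moment \<mu> + 2 * (wasserstein 2 \<mu> \<nu>)\<^sup>2"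
    using i M second_moment_distr[of X M] by simp
  also have "\<dots> \<le> 2 * second_moment \<mu> + 2 * R\<^sup>2"
    using assms(3) by (simp add: power_mono)
  finally show ?thesis .
qed

lemma optimal_plans_compactness:
  fixes \<mu> :: "nat \<Rightarrow> 'a measure" and \<nu> :: "'a measure"
  assumes P: "\<And>n. \<mu> n \<in> P2" "\<nu> \<in> P2" and B: "\<And>n. second_moment (\<mu> n) \<le> B"
  obtains r :: "nat \<Rightarrow> nat" and \<Omega> :: "real measure" and U V U' V' where
    "strict_mono r" "prob_space \<Omega>"
    "\<And>n. U n \<in> borel_measurable \<Omega>" "\<And>n. V n \<in> borel_measurable \<Omega>"
    "U' \<in> borel_measurable \<Omega>" "V' \<in> borel_measurable \<Omega>"
    "\<And>n. distr \<Omega> borel (U n) = \<mu> (r n)" "\<And>n. distr \<Omega> borel (V n) = \<nu>"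
    "distr \<Omega> borel V' = \<nu>"
    "\<And>n. (\<integral>\<omega>. (norm (U n \<omega> - V n \<omega>))\<^sup>2 \<partial>\<Omega>) = (wasserstein 2 (\<mu> (r n)) \<nu>)\<^sup>2"
    "AE \<omega> in \<Omega>. (\<lambda>n. U n \<omega>) \<longlonglongrightarrow> U' \<omega>" "AE \<omega> in \<Omega>. (\<lambda>n. V n \<omega>) \<longlonglongrightarrow> V' \<omega>"
    "distr \<Omega> borel U' \<in> P2"
proof -
  define Q where "Q n \<gamma> \<longleftrightarrow> \<gamma> \<in> P2 \<and> distr \<gamma> borel fst = \<mu> n \<and> distr \<gamma> borel snd = \<nu>
      \<and> (\<integral>z. (norm (fst z - snd z))\<^sup>2 \<partial>\<gamma>) = (wasserstein 2 (\<mu> n) \<nu>)\<^sup>2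
      \<and> second_moment \<gamma> \<le> B + second_moment \<nu>" for n and \<gamma> :: "('a \<times> 'a) measure"
  have ex: "\<exists>\<gamma>. Q n \<gamma>" for n
  proof -
    obtain M :: "('a \<times> 'a \<times> 'a) measure" and X Y where
      M: "prob_space M" "X \<in> borel_measurable M" "Y \<in> borel_measurable M"
      "distr M borel X = \<mu> n" "distr M borel Y = \<nu>"
      "(\<integral>\<omega>. (norm (X \<omega> - Y \<omega>))\<^sup>2 \<partial>M) = (wasserstein 2 (\<mu> n) \<nu>)\<^sup>2"
      by (rule optimal_random_variables[OF P(1)[of n] P(2)]) (rule that)
    note [measurable] = M(2,3)
    have XY[measurable]: "(\<lambda>\<omega>. (X \<omega>, Y \<omega>)) \<in> borel_measurable M"
      by (rule borel_measurable_Pair) auto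
    have f[measurable]: "(fst :: 'a \<times> 'a \<Rightarrow> 'a) \<in> borel_measurable borel"
      "(snd :: 'a \<times> 'a \<Rightarrow> 'a) \<in> borel_measurable borel"
      by (auto intro!: borel_measurable_continuous_onI continuous_intros)
    have i: "integrable M (\<lambda>\<omega>. (norm (X \<omega>))\<^sup>2)" "integrable M (\<lambda>\<omega>. (norm (Y \<omega>))\<^sup>2)"
      using integrable_sq_of_law[of X M] integrable_sq_of_law[of Y M] M P by auto
    have n: "(norm (X \<omega>, Y \<omega>))\<^sup>2 = (norm (X \<omega>))\<^sup>2 + (norm (Y \<omega>))\<^sup>2" for \<omega>
      by (simp add: norm_Pair)
    let ?\<gamma> = "distr M borel (\<lambda>\<omega>. (X \<omega>, Y \<omega>))"
    have "?\<gamma> \<in> P2" using i M(1) by (subst distr_in_P2_iff) (auto simp: n)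
    moreover have "second_moment ?\<gamma> \<le> B + second_moment \<nu>"
      using i B[of n] second_moment_distr[of X M] second_moment_distr[of Y M] M
      by (simp add: second_moment_distr n)
    moreover have "(\<integral>z. (norm (fst z - snd z))\<^sup>2 \<partial>?\<gamma>) = (wasserstein 2 (\<mu> n) \<nu>)\<^sup>2"
      using M(6) by (subst integral_distr) auto
    ultimately have "Q n ?\<gamma>" unfolding Q_def using M by (auto simp: distr_distr comp_def)
    then show ?thesis by blast
  qed
  define \<gamma> where "\<gamma> n = (SOME \<gamma>. Q n \<gamma>)" for n
  have "Q n (\<gamma> n)" for n unfolding \<gamma>_def by (rule someI_ex[OF ex])
  then have g: "\<And>n. \<gamma> n \<in> P2"
    "\<And>n. distr (\<gamma> n) borel fst = \<mu> n" "\<And>n. distr (\<gamma> n) borel snd = \<nu>"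
    "\<And>n. (\<integral>z. (norm (fst z - snd z))\<^sup>2 \<partial>\<gamma> n) = (wasserstein 2 (\<mu> n) \<nu>)\<^sup>2"
    "\<And>n. second_moment (\<gamma> n) \<le> B + second_moment \<nu>"
    unfolding Q_def by blast+
  obtain r :: "nat \<Rightarrow> nat" and \<Omega> :: "real measure" and X X' where
    r: "strict_mono r" "prob_space \<Omega>" "\<And>n. X n \<in> borel_measurable \<Omega>" "X' \<in> borel_measurable \<Omega>"
    "\<And>n. distr \<Omega> borel (X n) = \<gamma> (r n)" "AE \<omega> in \<Omega>. (\<lambda>n. X n \<omega>) \<longlonglongrightarrow> X' \<omega>"
    "distr \<Omega> borel X' \<in> P2"
    by (rule skorokhod_compactness[of \<gamma>, OF g(1,5)]) (rule that)
  interpret prob_space \<Omega> by fact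
  note [measurable] = r(3,4)
  have f[measurable]: "(fst :: 'a \<times> 'a \<Rightarrow> 'a) \<in> borel_measurable borel"
      "(snd :: 'a \<times> 'a \<Rightarrow> 'a) \<in> borel_measurable borel"
      by (auto intro!: borel_measurable_continuous_onI continuous_intros)
  define U where "U n \<omega> = fst (X n \<omega>)" for n \<omega>
  define V where "V n \<omega> = snd (X n \<omega>)" for n \<omega>
  define U' where "U' \<omega> = fst (X' \<omega>)" for \<omega>
  define V' where "V' \<omega> = snd (X' \<omega>)" for \<omega>
  have m[measurable]: "U n \<in> borel_measurable \<Omega>" "V n \<in> borel_measurable \<Omega>"
      "U' \<in> borel_measurable \<Omega>" "V' \<in> borel_measurable \<Omega>" for n
    unfolding U_def V_def U'_def V'_def by measurable
  have lU: "distr \<Omega> borel (U n) = \<mu> (r n)" and lV: "distr \<Omega> borel (V n) = \<nu>" for n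
    using g(2)[of "r n"] g(3)[of "r n"] unfolding r(5)[symmetric] U_def V_def
    by (simp_all add: distr_distr comp_def)
  have lim: "AE \<omega> in \<Omega>. (\<lambda>n. U n \<omega>) \<longlonglongrightarrow> U' \<omega>" "AE \<omega> in \<Omega>. (\<lambda>n. V n \<omega>) \<longlonglongrightarrow> V' \<omega>"
    using r(6) unfolding U_def V_def U'_def V'_def
    by (auto elim!: eventually_mono intro: tendsto_fst tendsto_snd)
  have iX': "integrable \<Omega> (\<lambda>\<omega>. (norm (X' \<omega>))\<^sup>2)" using r by (intro integrable_sq_of_law) auto
  have "integrable \<Omega> (\<lambda>\<omega>. (norm (U' \<omega>))\<^sup>2)"
  proof (rule Bochner_Integration.integrable_bound[OF iX'])
    have "norm (fst z) \<le> norm z" for z :: "'a \<times> 'a"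
      using norm_fst_le[of "fst z" "snd z"] by simp
    then show "AE \<omega> in \<Omega>. norm ((norm (U' \<omega>))\<^sup>2) \<le> norm ((norm (X' \<omega>))\<^sup>2)"
      by (auto simp: U'_def intro!: power_mono)
  qed auto
  then have PU': "distr \<Omega> borel U' \<in> P2" by (simp add: distr_in_P2_iff prob_space_axioms)
  have lV': "distr \<Omega> borel V' = \<nu>"
    using limit_law_unique[OF prob_space_axioms m(2,4) lim(2) prob_space_axioms, of "\<lambda>_. V 0" "V 0"]
    by (auto simp: lV)
  show thesis
  proof (rule that[OF r(1,2) m(1,2,3,4) lU lV lV' _ lim PU'])
    fix n
    have "(\<integral>\<omega>. (norm (U n \<omega> - V n \<omega>))\<^sup>2 \<partial>\<Omega>) = (\<integral>z. (norm (fst z - snd z))\<^sup>2 \<partial>\<gamma> (r n))"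
      unfolding r(5)[symmetric] U_def V_def by (subst integral_distr) auto
    then show "(\<integral>\<omega>. (norm (U n \<omega> - V n \<omega>))\<^sup>2 \<partial>\<Omega>) = (wasserstein 2 (\<mu> (r n)) \<nu>)\<^sup>2"
      using g(4) by simp
  qed
qed

end

section \<open>Opial's property and completeness\<close>

definition skorokhod_limit :: "(nat \<Rightarrow> 'a::euclidean_space measure) \<Rightarrow> 'a measure \<Rightarrow> bool" where
  "skorokhod_limit \<mu> \<mu>' \<longleftrightarrow> (\<exists>(\<Omega> :: real measure) X X'. prob_space \<Omega> \<and>
    (\<forall>n. X n \<in> borel_measurable \<Omega>) \<and> X' \<in> borel_measurable \<Omega> \<and>
    (\<forall>n. distr \<Omega> borel (X n) = \<mu> n) \<and> distr \<Omega> borel X' = \<mu>' \<and>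
    (AE \<omega> in \<Omega>. (\<lambda>n. X n \<omega>) \<longlonglongrightarrow> X' \<omega>))"

lemma skorokhod_limitE:
  assumes "skorokhod_limit \<mu> \<mu>'"
  obtains \<Omega> :: "real measure" and X X' where "prob_space \<Omega>"
    "\<And>n. X n \<in> borel_measurable \<Omega>" "X' \<in> borel_measurable \<Omega>"
    "\<And>n. distr \<Omega> borel (X n) = \<mu> n" "distr \<Omega> borel X' = \<mu>'"
    "AE \<omega> in \<Omega>. (\<lambda>n. X n \<omega>) \<longlonglongrightarrow> X' \<omega>"
  using assms unfolding skorokhod_limit_def by blast

lemma skorokhod_limit_subseq:
  assumes "skorokhod_limit \<mu> \<mu>'" "strict_mono r"
  shows "skorokhod_limit (\<lambda>n. \<mu> (r n)) \<mu>'"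
  using assms(1)
proof (rule skorokhod_limitE)
  fix \<Omega> :: "real measure" and X X'
  assume *: "prob_space \<Omega>" "\<And>n. X n \<in> borel_measurable \<Omega>" "X' \<in> borel_measurable \<Omega>"
    "\<And>n. distr \<Omega> borel (X n) = \<mu> n" "distr \<Omega> borel X' = \<mu>'"
    and lim: "AE \<omega> in \<Omega>. (\<lambda>n. X n \<omega>) \<longlonglongrightarrow> X' \<omega>"
  from lim have "AE \<omega> in \<Omega>. (\<lambda>n. X (r n) \<omega>) \<longlonglongrightarrow> X' \<omega>"
    by eventually_elim (use LIMSEQ_subseq_LIMSEQ[OF _ assms(2)] in \<open>auto simp: comp_def\<close>)
  then show ?thesis
    unfolding skorokhod_limit_def
    by (intro exI[of _ \<Omega>] exI[of _ "\<lambda>n. X (r n)"] exI[of _ X']) (use * in auto)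
qed

lemma skorokhod_limit_compactness:
  fixes \<mu> :: "nat \<Rightarrow> 'a::euclidean_space measure"
  assumes P: "\<And>n. \<mu> n \<in> P2" and B: "\<And>n. second_moment (\<mu> n) \<le> B"
  obtains r :: "nat \<Rightarrow> nat" and \<mu>' where "strict_mono r" "skorokhod_limit (\<lambda>n. \<mu> (r n)) \<mu>'" "\<mu>' \<in> P2"
  using assms
proof (rule skorokhod_compactness)
  fix r :: "nat \<Rightarrow> nat" and \<Omega> :: "real measure" and X X'
  assume *: "strict_mono r" "prob_space \<Omega>" "\<And>n. X n \<in> borel_measurable \<Omega>" "X' \<in> borel_measurable \<Omega>"
    "\<And>n. distr \<Omega> borel (X n) = \<mu> (r n)" "AE \<omega> in \<Omega>. (\<lambda>n. X n \<omega>) \<longlonglongrightarrow> X' \<omega>"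
    "distr \<Omega> borel X' \<in> P2"
  then have "skorokhod_limit (\<lambda>n. \<mu> (r n)) (distr \<Omega> borel X')"
    unfolding skorokhod_limit_def by blast
  then show thesis using * that by blast
qed

lemma not_eventually_subseq:
  assumes "\<not> (\<forall>\<^sub>F n in sequentially. P n)"
  obtains s :: "nat \<Rightarrow> nat" where "strict_mono s" "\<And>n. \<not> P (s n)"
proof -
  have "infinite {n. \<not> P n}"
    using assms unfolding cofinite_eq_sequentially[symmetric] eventually_cofinite .
  from infinite_enumerate[OF this] show thesis using that by auto
qed

lemma second_moment_limit_bound:
  assumes "skorokhod_limit \<mu> \<mu>'" "\<And>n. \<mu> n \<in> P2" "\<And>n. second_moment (\<mu> n) \<le> B"
  shows "\<mu>' \<in> P2" "second_moment \<mu>' \<le> B"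
proof -
  obtain \<Omega> :: "real measure" and X X' where *: "prob_space \<Omega>"
    "\<And>n. X n \<in> borel_measurable \<Omega>" "X' \<in> borel_measurable \<Omega>"
    "\<And>n. distr \<Omega> borel (X n) = \<mu> n" "distr \<Omega> borel X' = \<mu>'"
    "AE \<omega> in \<Omega>. (\<lambda>n. X n \<omega>) \<longlonglongrightarrow> X' \<omega>"
    by (rule skorokhod_limitE[OF assms(1)]) (rule that)
  note [measurable] = *(2,3)
  have lim: "AE \<omega> in \<Omega>. (\<lambda>n. (norm (X n \<omega>))\<^sup>2) \<longlonglongrightarrow> (norm (X' \<omega>))\<^sup>2"
    using *(6) by eventually_elim (intro tendsto_intros)
  have i: "integrable \<Omega> (\<lambda>\<omega>. (norm (X n \<omega>))\<^sup>2)" "(\<integral>\<omega>. (norm (X n \<omega>))\<^sup>2 \<partial>\<Omega>) \<le> B" for n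
    using integrable_sq_of_law[of "X n" \<Omega>] second_moment_distr[of "X n" \<Omega>] * assms(2,3)[of n] by auto
  have "integrable \<Omega> (\<lambda>\<omega>. (norm (X' \<omega>))\<^sup>2)" "(\<integral>\<omega>. (norm (X' \<omega>))\<^sup>2 \<partial>\<Omega>) \<le> B"
    by (rule fatou_integral_le[OF _ _ lim]; use i in auto)+
  then show "\<mu>' \<in> P2" "second_moment \<mu>' \<le> B"
    using * distr_in_P2_iff[of \<Omega> X'] second_moment_distr[of X' \<Omega>] by auto
qed

text \<open>Expanding the square, the distance to the limit differs from the difference of second moments
  only by a correlation with \<open>X'\<close>, which vanishes by Vitali convergence.\<close>

lemma wasserstein2_limit_upper:
  fixes \<mu> :: "nat \<Rightarrow> 'a::euclidean_space measure"
  assumes lim: "skorokhod_limit \<mu> \<mu>'" and P: "\<And>n. \<mu> n \<in> P2" and B: "\<And>n. second_moment (\<mu> n) \<le> B"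
    and "e > 0"
  shows "\<forall>\<^sub>F n in sequentially. (wasserstein 2 (\<mu> n) \<mu>')\<^sup>2 \<le> second_moment (\<mu> n) - second_moment \<mu>' + e"
proof -
  note P' = second_moment_limit_bound[OF lim P B]
  obtain \<Omega> :: "real measure" and X X' where *: "prob_space \<Omega>"
    "\<And>n. X n \<in> borel_measurable \<Omega>" "X' \<in> borel_measurable \<Omega>"
    "\<And>n. distr \<Omega> borel (X n) = \<mu> n" "distr \<Omega> borel X' = \<mu>'"
    "AE \<omega> in \<Omega>. (\<lambda>n. X n \<omega>) \<longlonglongrightarrow> X' \<omega>"
    by (rule skorokhod_limitE[OF lim]) (rule that)
  note [measurable] = *(2,3)
  interpret prob_space \<Omega> by fact
  define Z where "Z n \<omega> = (X n \<omega> - X' \<omega>) \<bullet> X' \<omega>" for n \<omega>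
  have i: "integrable \<Omega> (\<lambda>\<omega>. (norm (X n \<omega>))\<^sup>2)" "integrable \<Omega> (\<lambda>\<omega>. (norm (X' \<omega>))\<^sup>2)"
    "(\<integral>\<omega>. (norm (X n \<omega>))\<^sup>2 \<partial>\<Omega>) = second_moment (\<mu> n)" "(\<integral>\<omega>. (norm (X' \<omega>))\<^sup>2 \<partial>\<Omega>) = second_moment \<mu>'" for n
    using integrable_sq_of_law[of "X n" \<Omega>] integrable_sq_of_law[of X' \<Omega>]
      second_moment_distr[of "X n" \<Omega>] second_moment_distr[of X' \<Omega>] * P[of n] P' by auto
  have Zm: "Z n \<in> borel_measurable \<Omega>" for n unfolding Z_def by measurable
  have Z0: "AE \<omega> in \<Omega>. (\<lambda>n. Z n \<omega>) \<longlonglongrightarrow> 0"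
    using *(6)
  proof eventually_elim
    case (elim \<omega>)
    have "(\<lambda>n. (X n \<omega> - X' \<omega>) \<bullet> X' \<omega>) \<longlonglongrightarrow> (X' \<omega> - X' \<omega>) \<bullet> X' \<omega>" by (intro tendsto_intros elim)
    then show ?case by (simp add: Z_def)
  qed
  have YB: "(\<integral>\<omega>. 2 * (norm (X n \<omega>))\<^sup>2 + 2 * (norm (X' \<omega>))\<^sup>2 \<partial>\<Omega>) \<le> 4 * B" for n
      using i B[of n] P'(2) by simp
  have Zdom: "\<exists>g. integrable \<Omega> g \<and> (\<forall>n \<omega>. \<bar>Z n \<omega>\<bar> \<le> g \<omega> + d * (2 * (norm (X n \<omega>))\<^sup>2 + 2 * (norm (X' \<omega>))\<^sup>2))"
    if d: "d > 0" for d :: real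
  proof -
    have "\<bar>Z n \<omega>\<bar> \<le> 1 / d * (norm (X' \<omega>))\<^sup>2 + d * (2 * (norm (X n \<omega>))\<^sup>2 + 2 * (norm (X' \<omega>))\<^sup>2)" for n \<omega>
    proof -
      let ?a = "norm (X n \<omega> - X' \<omega>)" and ?b = "norm (X' \<omega>)"
      have "\<bar>Z n \<omega>\<bar> \<le> ?a * ?b" unfolding Z_def by (rule Cauchy_Schwarz_ineq2)
      also have "\<dots> \<le> 1 / d * ?b\<^sup>2 + d * ?a\<^sup>2"
      proof -
        have "0 \<le> (?b - d * ?a)\<^sup>2 / d" using d by simp
        also have "\<dots> = 1 / d * ?b\<^sup>2 + d * ?a\<^sup>2 - 2 * (?a * ?b)"
          using d by (simp add: field_simps power2_eq_square)
        finally have "2 * (?a * ?b) \<le> 1 / d * ?b\<^sup>2 + d * ?a\<^sup>2" by simp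
        moreover have "0 \<le> ?a * ?b" by simp
        ultimately show ?thesis by linarith
      qed
      also have "d * ?a\<^sup>2 \<le> d * (2 * (norm (X n \<omega>))\<^sup>2 + 2 * (norm (X' \<omega>))\<^sup>2)"
        using d norm_diff_sq_le[of "X n \<omega>" "X' \<omega>"] by (intro mult_left_mono) auto
      finally show ?thesis by simp
    qed
    then show ?thesis
      using i(2) by (intro exI[of _ "\<lambda>\<omega>. 1 / d * (norm (X' \<omega>))\<^sup>2"]) auto
  qed
  have Yint: "integrable \<Omega> (\<lambda>\<omega>. 2 * (norm (X n \<omega>))\<^sup>2 + 2 * (norm (X' \<omega>))\<^sup>2)" for n using i(1,2) by simp
  have Ynn: "0 \<le> 2 * (norm (X n \<omega>))\<^sup>2 + 2 * (norm (X' \<omega>))\<^sup>2" for n \<omega> by simp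
  note Z = integral_tendsto_0_almost_dominated(1,3)[of Z, OF Zm Z0 Yint YB Ynn Zdom]
  have le: "(wasserstein 2 (\<mu> n) \<mu>')\<^sup>2 \<le> second_moment (\<mu> n) - second_moment \<mu>' - 2 * (\<integral>\<omega>. Z n \<omega> \<partial>\<Omega>)" for n
  proof -
    have "(wasserstein 2 (\<mu> n) \<mu>')\<^sup>2 \<le> (\<integral>\<omega>. (norm (X n \<omega> - X' \<omega>))\<^sup>2 \<partial>\<Omega>)"
      by (rule wasserstein2_sq_le) (use * P P' in auto)
    also have "\<dots> = (\<integral>\<omega>. (norm (X n \<omega>))\<^sup>2 - (norm (X' \<omega>))\<^sup>2 - 2 * Z n \<omega> \<partial>\<Omega>)"
      by (intro Bochner_Integration.integral_cong)
        (auto simp: Z_def power2_norm_eq_inner inner_diff inner_commute algebra_simps)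
    also have "\<dots> = second_moment (\<mu> n) - second_moment \<mu>' - 2 * (\<integral>\<omega>. Z n \<omega> \<partial>\<Omega>)"
      using i Z(1) by simp
    finally show ?thesis .
  qed
  have "(\<lambda>n. - 2 * (\<integral>\<omega>. Z n \<omega> \<partial>\<Omega>)) \<longlonglongrightarrow> - 2 * 0" by (intro tendsto_intros Z(2))
  then have "\<forall>\<^sub>F n in sequentially. - 2 * (\<integral>\<omega>. Z n \<omega> \<partial>\<Omega>) < e"
    using \<open>e > 0\<close> by (intro order_tendstoD(2)[of _ 0]) auto
  then show ?thesis
  proof eventually_elim
    case (elim n)
    then show ?case using le[of n] by linarith
  qed
qed

context
  fixes H :: "'a::euclidean_space measure \<Rightarrow> ereal"
  assumes convex: "convex_gen_geodesics H"
begin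

text \<open>Opial's property. The lower bound is Fatou's lemma for
  \<open>|U - V|\<^sup>2 - (1 - \<delta>) |U|\<^sup>2 + K |V|\<^sup>2 \<ge> 0\<close> along optimal plans; the \<open>V\<close>-term cancels because the
  second marginal is fixed.\<close>

lemma wasserstein2_opial:
  fixes \<mu> :: "nat \<Rightarrow> 'a measure"
  assumes lim: "skorokhod_limit \<mu> \<mu>'" and P: "\<And>n. \<mu> n \<in> P2" and B: "\<And>n. second_moment (\<mu> n) \<le> B"
    and \<nu>: "\<nu> \<in> P2" and e: "e > 0"
  shows "\<forall>\<^sub>F n in sequentially.
    (wasserstein 2 (\<mu> n) \<mu>')\<^sup>2 + (wasserstein 2 \<mu>' \<nu>)\<^sup>2 - e \<le> (wasserstein 2 (\<mu> n) \<nu>)\<^sup>2"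
proof (rule ccontr)
  assume "\<not> ?thesis"
  then obtain s :: "nat \<Rightarrow> nat" where s: "strict_mono s"
    and bad: "\<And>n. (wasserstein 2 (\<mu> (s n)) \<nu>)\<^sup>2 < (wasserstein 2 (\<mu> (s n)) \<mu>')\<^sup>2 + (wasserstein 2 \<mu>' \<nu>)\<^sup>2 - e"
    by (rule not_eventually_subseq) (auto simp: not_le)
  note P' = second_moment_limit_bound[OF lim P B]
  have "0 \<le> B" using second_moment_nonneg[of "\<mu> 0"] B[of 0] by linarith
  obtain r :: "nat \<Rightarrow> nat" and \<Omega> :: "real measure" and U V U' V' where
    r: "strict_mono r" "prob_space \<Omega>"
    and m[measurable]: "\<And>n. U n \<in> borel_measurable \<Omega>" "\<And>n. V n \<in> borel_measurable \<Omega>"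
    "U' \<in> borel_measurable \<Omega>" "V' \<in> borel_measurable \<Omega>"
    and law: "\<And>n. distr \<Omega> borel (U n) = \<mu> (s (r n))" "\<And>n. distr \<Omega> borel (V n) = \<nu>"
    "distr \<Omega> borel V' = \<nu>"
    and opt: "\<And>n. (\<integral>\<omega>. (norm (U n \<omega> - V n \<omega>))\<^sup>2 \<partial>\<Omega>) = (wasserstein 2 (\<mu> (s (r n))) \<nu>)\<^sup>2"
    and l: "AE \<omega> in \<Omega>. (\<lambda>n. U n \<omega>) \<longlonglongrightarrow> U' \<omega>" "AE \<omega> in \<Omega>. (\<lambda>n. V n \<omega>) \<longlonglongrightarrow> V' \<omega>"
    and "distr \<Omega> borel U' \<in> P2"
    by (rule optimal_plans_compactness[OF convex, of "\<lambda>n. \<mu> (s n)", OF P \<nu> B]) (rule that)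
  have lim': "skorokhod_limit (\<lambda>n. \<mu> (s (r n))) \<mu>'"
    using skorokhod_limit_subseq[OF skorokhod_limit_subseq[OF lim s] r(1)] .
  have lU': "distr \<Omega> borel U' = \<mu>'"
    using lim'
  proof (rule skorokhod_limitE)
    fix \<Omega>' :: "real measure" and X X'
    assume "prob_space \<Omega>'" "\<And>n. X n \<in> borel_measurable \<Omega>'" "X' \<in> borel_measurable \<Omega>'"
      "\<And>n. distr \<Omega>' borel (X n) = \<mu> (s (r n))" "distr \<Omega>' borel X' = \<mu>'"
      "AE \<omega> in \<Omega>'. (\<lambda>n. X n \<omega>) \<longlonglongrightarrow> X' \<omega>"
    then show ?thesis
      using limit_law_unique[OF r(2) m(1,3) l(1), of \<Omega>' X X'] law(1) by simp
  qed
  define \<delta> where "\<delta> = min (1 / 2) (e / (4 * (B + 1)))"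
  have \<delta>: "0 < \<delta>" "\<delta> < 1" using e \<open>0 \<le> B\<close> by (auto simp: \<delta>_def)
  have "\<delta> * B \<le> e / (4 * (B + 1)) * B" using \<open>0 \<le> B\<close> by (intro mult_right_mono) (auto simp: \<delta>_def)
  also have "\<dots> \<le> e / 4" using \<open>0 \<le> B\<close> e by (simp add: field_simps)
  finally have \<delta>B: "\<delta> * B \<le> e / 4" .
  define K where "K = 1 / \<delta>"
  have K: "K \<ge> 0" using \<delta> by (simp add: K_def)
  define f where "f u v = (norm (u - v))\<^sup>2 - (1 - \<delta>) * (norm u)\<^sup>2 + K * (norm v)\<^sup>2" for u v :: 'a
  have f_nonneg: "0 \<le> f u v" for u v
  proof -
    have n: "(norm (u - v))\<^sup>2 = (norm u)\<^sup>2 - 2 * (u \<bullet> v) + (norm v)\<^sup>2"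
      "(norm (\<delta> *\<^sub>R u - v))\<^sup>2 = \<delta>\<^sup>2 * (norm u)\<^sup>2 - 2 * \<delta> * (u \<bullet> v) + (norm v)\<^sup>2"
      by (simp_all add: power2_norm_eq_inner inner_diff inner_commute algebra_simps power2_eq_square[of \<delta>])
    have "0 \<le> (norm (\<delta> *\<^sub>R u - v))\<^sup>2 / \<delta> + (norm v)\<^sup>2" using \<delta> by simp
    also have "\<dots> = f u v"
      using \<delta> unfolding f_def K_def n by (simp add: field_simps power2_eq_square[of \<delta>])
    finally show ?thesis .
  qed
  have [measurable]: "(\<lambda>\<omega>. f (U n \<omega>) (V n \<omega>)) \<in> borel_measurable \<Omega>"
    "(\<lambda>\<omega>. f (U' \<omega>) (V' \<omega>)) \<in> borel_measurable \<Omega>" for n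
    unfolding f_def by measurable
  have int: "integrable \<Omega> (\<lambda>\<omega>. f (X \<omega>) (Y \<omega>)) \<and> (\<integral>\<omega>. f (X \<omega>) (Y \<omega>) \<partial>\<Omega>)
      = (\<integral>\<omega>. (norm (X \<omega> - Y \<omega>))\<^sup>2 \<partial>\<Omega>) - (1 - \<delta>) * second_moment (distr \<Omega> borel X) + K * second_moment \<nu>"
    if XY: "X \<in> borel_measurable \<Omega>" "Y \<in> borel_measurable \<Omega>" "distr \<Omega> borel X \<in> P2" "distr \<Omega> borel Y = \<nu>" for X Y
  proof -
    have i: "integrable \<Omega> (\<lambda>\<omega>. (norm (X \<omega> - Y \<omega>))\<^sup>2)" "integrable \<Omega> (\<lambda>\<omega>. (norm (X \<omega>))\<^sup>2)" "integrable \<Omega> (\<lambda>\<omega>. (norm (Y \<omega>))\<^sup>2)"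
      using integrable_dist_sq_of_laws[of X \<Omega> Y] integrable_sq_of_law[of X \<Omega>] integrable_sq_of_law[of Y \<Omega>] XY \<nu> by auto
    then show ?thesis
      using second_moment_distr[of X \<Omega>] second_moment_distr[of Y \<Omega>] XY unfolding f_def by simp
  qed
  have PU: "distr \<Omega> borel (U n) \<in> P2" for n using law(1) P by simp
  have "\<forall>\<^sub>F n in sequentially. (wasserstein 2 (\<mu> (s (r n))) \<mu>')\<^sup>2 \<le> second_moment (\<mu> (s (r n))) - second_moment \<mu>' + e / 4"
    using wasserstein2_limit_upper[OF lim' P B, of "e / 4"] e by simp
  then obtain N where N: "\<And>n. n \<ge> N \<Longrightarrow>
      (wasserstein 2 (\<mu> (s (r n))) \<mu>')\<^sup>2 \<le> second_moment (\<mu> (s (r n))) - second_moment \<mu>' + e / 4"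
    unfolding eventually_sequentially by blast
  let ?C = "(wasserstein 2 \<mu>' \<nu>)\<^sup>2 - second_moment \<mu>' - e / 2 + K * second_moment \<nu>"
  have upper: "(\<integral>\<omega>. f (U (n + N) \<omega>) (V (n + N) \<omega>) \<partial>\<Omega>) \<le> ?C" for n
  proof -
    let ?m = "second_moment (\<mu> (s (r (n + N))))"
    have "\<delta> * ?m \<le> \<delta> * B" using B \<delta> by (intro mult_left_mono) auto
    then have "\<delta> * ?m \<le> e / 4" using \<delta>B by linarith
    moreover have "(\<integral>\<omega>. f (U (n + N) \<omega>) (V (n + N) \<omega>) \<partial>\<Omega>)
        = (wasserstein 2 (\<mu> (s (r (n + N)))) \<nu>)\<^sup>2 - (1 - \<delta>) * ?m + K * second_moment \<nu>"
      using int[OF m(1,2) PU law(2), of "n + N" "n + N"] opt law(1) by simp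
    ultimately show ?thesis using bad[of "r (n + N)"] N[of "n + N"] by (simp add: algebra_simps)
  qed
  have "AE \<omega> in \<Omega>. (\<lambda>n. f (U (n + N) \<omega>) (V (n + N) \<omega>)) \<longlonglongrightarrow> f (U' \<omega>) (V' \<omega>)"
    using l
  proof eventually_elim
    case (elim \<omega>)
    show ?case unfolding f_def
      by (intro tendsto_intros LIMSEQ_ignore_initial_segment[OF elim(1)] LIMSEQ_ignore_initial_segment[OF elim(2)])
  qed
  from fatou_integral_le(2)[OF _ _ this _ _ upper]
  have "(\<integral>\<omega>. f (U' \<omega>) (V' \<omega>) \<partial>\<Omega>) \<le> ?C"
    using int[OF m(1,2) PU law(2)] f_nonneg by simp
  moreover have "(\<integral>\<omega>. f (U' \<omega>) (V' \<omega>) \<partial>\<Omega>)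
      = (\<integral>\<omega>. (norm (U' \<omega> - V' \<omega>))\<^sup>2 \<partial>\<Omega>) - (1 - \<delta>) * second_moment \<mu>' + K * second_moment \<nu>"
    using int[OF m(3,4) _ law(3)] lU' P' by simp
  moreover have "(wasserstein 2 \<mu>' \<nu>)\<^sup>2 \<le> (\<integral>\<omega>. (norm (U' \<omega> - V' \<omega>))\<^sup>2 \<partial>\<Omega>)"
    by (rule wasserstein2_sq_le) (use r m lU' law P' \<nu> in auto)
  moreover have "0 \<le> \<delta> * second_moment \<mu>'" using \<delta> second_moment_nonneg[of \<mu>'] by simp
  ultimately show False using e by (simp add: algebra_simps)
qed

lemma wasserstein2_complete:
  fixes \<rho> :: "nat \<Rightarrow> 'a measure"
  assumes P: "\<And>n. \<rho> n \<in> P2"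
    and cauchy: "\<And>e. e > 0 \<Longrightarrow> \<exists>N. \<forall>m\<ge>N. \<forall>n\<ge>N. wasserstein 2 (\<rho> m) (\<rho> n) \<le> e"
  obtains \<rho>' where "\<rho>' \<in> P2" "(\<lambda>n. wasserstein 2 (\<rho> n) \<rho>') \<longlonglongrightarrow> 0"
proof -
  obtain N where N: "\<And>m n. m \<ge> N \<Longrightarrow> n \<ge> N \<Longrightarrow> wasserstein 2 (\<rho> m) (\<rho> n) \<le> 1"
    using cauchy[of 1] by auto
  define \<mu> where "\<mu> n = \<rho> (N + n)" for n
  define B where "B = 2 * second_moment (\<rho> N) + 2 * 1\<^sup>2"
  have \<mu>: "\<mu> n \<in> P2" "second_moment (\<mu> n) \<le> B" for n
    unfolding \<mu>_def B_def
    using P wasserstein2_bounded[OF convex P[of N] P[of "N + n"] N[of N "N + n"]] by auto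
  obtain r \<mu>' where r: "strict_mono r" and lim: "skorokhod_limit (\<lambda>n. \<mu> (r n)) \<mu>'" and P': "\<mu>' \<in> P2"
    by (rule skorokhod_limit_compactness[of \<mu>, OF \<mu>]) (rule that)
  have "(\<lambda>n. wasserstein 2 (\<rho> n) \<mu>') \<longlonglongrightarrow> 0"
  proof (rule LIMSEQ_I)
    fix e :: real assume e: "e > 0"
    obtain M where M: "\<And>m n. m \<ge> M \<Longrightarrow> n \<ge> M \<Longrightarrow> wasserstein 2 (\<rho> m) (\<rho> n) \<le> e / 2"
      using cauchy[of "e / 2"] e by auto
    have "norm (wasserstein 2 (\<rho> m) \<mu>' - 0) < e" if m: "m \<ge> M" for m
    proof -
      have "\<forall>\<^sub>F n in sequentially. (wasserstein 2 (\<mu> (r n)) \<mu>')\<^sup>2 + (wasserstein 2 \<mu>' (\<rho> m))\<^sup>2 - e\<^sup>2 / 2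
          \<le> (wasserstein 2 (\<mu> (r n)) (\<rho> m))\<^sup>2"
        using wasserstein2_opial[OF lim \<mu> P[of m], of "e\<^sup>2 / 2"] e by simp
      then obtain n where n: "n \<ge> M" "(wasserstein 2 (\<mu> (r n)) \<mu>')\<^sup>2 + (wasserstein 2 \<mu>' (\<rho> m))\<^sup>2 - e\<^sup>2 / 2
          \<le> (wasserstein 2 (\<mu> (r n)) (\<rho> m))\<^sup>2"
        unfolding eventually_sequentially by (meson nat_le_linear)
      have "N + r n \<ge> M" using n(1) seq_suble[OF r, of n] by simp
      then have "(wasserstein 2 (\<mu> (r n)) (\<rho> m))\<^sup>2 \<le> (e / 2)\<^sup>2"
        unfolding \<mu>_def using M m by (intro power_mono) auto
      then have "(wasserstein 2 \<mu>' (\<rho> m))\<^sup>2 \<le> (e / 2)\<^sup>2 + e\<^sup>2 / 2"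
        using n(2) zero_le_power2[of "wasserstein 2 (\<mu> (r n)) \<mu>'"] by linarith
      also have "\<dots> < e\<^sup>2" using e by (simp add: power2_eq_square field_simps)
      finally have "wasserstein 2 \<mu>' (\<rho> m) < e" using e by (simp add: power2_less_imp_less)
      then show ?thesis unfolding wasserstein_commute[of 2 "\<rho> m" \<mu>'] by simp
    qed
    then show "\<exists>M. \<forall>m\<ge>M. norm (wasserstein 2 (\<rho> m) \<mu>' - 0) < e" by blast
  qed
  then show thesis by (rule that[OF P'])
qed

end

section \<open>The proximal step\<close>

definition functional_value :: "('a::euclidean_space measure \<Rightarrow> ereal) \<Rightarrow> 'a measure \<Rightarrow> real" where
  "functional_value H \<rho> = real_of_ereal (H \<rho>)"

lemma functional_value_eq:
  assumes "proper_P2 H" "\<rho> \<in> dom_P2 H"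
  shows "H \<rho> = ereal (functional_value H \<rho>)"
  using assms by (auto simp: functional_value_def proper_P2_def dom_P2_def ereal_real)

lemma norm_sq_convex_combination:
  fixes x y z :: "'a::real_inner"
  shows "(norm ((1 - t) *\<^sub>R y + t *\<^sub>R z - x))\<^sup>2
    = (1 - t) * (norm (x - y))\<^sup>2 + t * (norm (x - z))\<^sup>2 - t * (1 - t) * (norm (y - z))\<^sup>2"
  by (simp add: power2_norm_eq_inner inner_diff inner_add inner_commute algebra_simps)

context
  fixes H :: "'a::euclidean_space measure \<Rightarrow> ereal"
  assumes convex: "convex_gen_geodesics H" and proper: "proper_P2 H"
begin

lemma proximal_convexity:
  assumes \<nu>: "\<nu> \<in> P2" and \<rho>: "\<rho>0 \<in> dom_P2 H" "\<rho>1 \<in> dom_P2 H" and t: "t \<in> {0..1}" and "\<tau> > 0"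
  obtains \<rho> where "\<rho> \<in> dom_P2 H"
    "functional_value H \<rho> + (wasserstein 2 \<rho> \<nu>)\<^sup>2 / (2 * \<tau>)
      \<le> (1 - t) * (functional_value H \<rho>0 + (wasserstein 2 \<rho>0 \<nu>)\<^sup>2 / (2 * \<tau>))
        + t * (functional_value H \<rho>1 + (wasserstein 2 \<rho>1 \<nu>)\<^sup>2 / (2 * \<tau>))
        - t * (1 - t) * (wasserstein 2 \<rho>0 \<rho>1)\<^sup>2 / (2 * \<tau>)"
proof -
  have P: "\<rho>0 \<in> P2" "\<rho>1 \<in> P2" using \<rho> by (auto simp: dom_P2_def)
  obtain M :: "('a \<times> 'a \<times> 'a) measure" and X Y Z where
    M: "prob_space M"
    "X \<in> borel_measurable M" "Y \<in> borel_measurable M" "Z \<in> borel_measurable M"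
    and law: "distr M borel X = \<nu>" "distr M borel Y = \<rho>0" "distr M borel Z = \<rho>1"
    and opt: "(\<integral>\<omega>. (norm (X \<omega> - Y \<omega>))\<^sup>2 \<partial>M) = (wasserstein 2 \<nu> \<rho>0)\<^sup>2"
    "(\<integral>\<omega>. (norm (X \<omega> - Z \<omega>))\<^sup>2 \<partial>M) = (wasserstein 2 \<nu> \<rho>1)\<^sup>2"
    and cv: "\<And>t. t \<in> {0..1} \<Longrightarrow> H (distr M borel (\<lambda>\<omega>. (1 - t) *\<^sub>R Y \<omega> + t *\<^sub>R Z \<omega>))
        \<le> ereal (1 - t) * H \<rho>0 + ereal t * H \<rho>1"
    by (rule gg_random_variables[OF convex \<nu> P]) (rule that)
  note [measurable] = M(2-4)
  define V where "V \<omega> = (1 - t) *\<^sub>R Y \<omega> + t *\<^sub>R Z \<omega>" for \<omega>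
  have V[measurable]: "V \<in> borel_measurable M" unfolding V_def by measurable
  define \<rho> where "\<rho> = distr M borel V"
  have P\<rho>: "\<rho> \<in> P2" unfolding \<rho>_def V_def
    by (rule P2_law) (use law P M in auto)
  have "H \<rho> \<le> ereal (1 - t) * H \<rho>0 + ereal t * H \<rho>1"
    unfolding \<rho>_def V_def by (rule cv[OF t])
  also have "\<dots> = ereal ((1 - t) * functional_value H \<rho>0 + t * functional_value H \<rho>1)"
    by (simp add: functional_value_eq[OF proper \<rho>(1)] functional_value_eq[OF proper \<rho>(2)])
  finally have le: "H \<rho> \<le> ereal ((1 - t) * functional_value H \<rho>0 + t * functional_value H \<rho>1)" .
  then have dom: "\<rho> \<in> dom_P2 H" using P\<rho> by (auto simp: dom_P2_def less_top[symmetric])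
  have h: "functional_value H \<rho> \<le> (1 - t) * functional_value H \<rho>0 + t * functional_value H \<rho>1"
    using le by (simp add: functional_value_eq[OF proper dom])
  have i: "integrable M (\<lambda>\<omega>. (norm (X \<omega> - Y \<omega>))\<^sup>2)" "integrable M (\<lambda>\<omega>. (norm (X \<omega> - Z \<omega>))\<^sup>2)"
    "integrable M (\<lambda>\<omega>. (norm (Y \<omega> - Z \<omega>))\<^sup>2)"
    using integrable_dist_sq_of_laws[of X M Y] integrable_dist_sq_of_laws[of X M Z]
      integrable_dist_sq_of_laws[of Y M Z] M law P \<nu> by auto
  have "(wasserstein 2 \<rho> \<nu>)\<^sup>2 \<le> (\<integral>\<omega>. (norm (V \<omega> - X \<omega>))\<^sup>2 \<partial>M)"
    by (rule wasserstein2_sq_le[OF M(1) V M(2) \<rho>_def[symmetric] law(1) P\<rho> \<nu>])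
  also have "\<dots> = (1 - t) * (wasserstein 2 \<nu> \<rho>0)\<^sup>2 + t * (wasserstein 2 \<nu> \<rho>1)\<^sup>2
      - t * (1 - t) * (\<integral>\<omega>. (norm (Y \<omega> - Z \<omega>))\<^sup>2 \<partial>M)"
    unfolding V_def norm_sq_convex_combination opt[symmetric] using i by simp
  finally have "(wasserstein 2 \<rho> \<nu>)\<^sup>2 \<le> (1 - t) * (wasserstein 2 \<nu> \<rho>0)\<^sup>2 + t * (wasserstein 2 \<nu> \<rho>1)\<^sup>2
      - t * (1 - t) * (\<integral>\<omega>. (norm (Y \<omega> - Z \<omega>))\<^sup>2 \<partial>M)" .
  moreover have "t * (1 - t) * (wasserstein 2 \<rho>0 \<rho>1)\<^sup>2 \<le> t * (1 - t) * (\<integral>\<omega>. (norm (Y \<omega> - Z \<omega>))\<^sup>2 \<partial>M)"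
    using t by (intro mult_left_mono wasserstein2_sq_le[OF M(1,3,4) law(2,3) P]) auto
  ultimately have w: "(wasserstein 2 \<rho> \<nu>)\<^sup>2 \<le> (1 - t) * (wasserstein 2 \<nu> \<rho>0)\<^sup>2 + t * (wasserstein 2 \<nu> \<rho>1)\<^sup>2
      - t * (1 - t) * (wasserstein 2 \<rho>0 \<rho>1)\<^sup>2" by linarith
  then have "(wasserstein 2 \<rho> \<nu>)\<^sup>2 / (2 * \<tau>) \<le> ((1 - t) * (wasserstein 2 \<nu> \<rho>0)\<^sup>2
      + t * (wasserstein 2 \<nu> \<rho>1)\<^sup>2 - t * (1 - t) * (wasserstein 2 \<rho>0 \<rho>1)\<^sup>2) / (2 * \<tau>)"
    using \<open>\<tau> > 0\<close> by (intro divide_right_mono) auto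
  then show thesis
    using h by (intro that[OF dom])
      (simp add: wasserstein_commute[of 2 _ \<nu>] algebra_simps add_divide_distrib diff_divide_distrib)
qed

lemma wasserstein2_tendsto:
  fixes \<rho> :: "nat \<Rightarrow> 'a measure"
  assumes "\<And>n. \<rho> n \<in> P2" "\<rho>' \<in> P2" "\<nu> \<in> P2" "(\<lambda>n. wasserstein 2 (\<rho> n) \<rho>') \<longlonglongrightarrow> 0"
  shows "(\<lambda>n. wasserstein 2 (\<rho> n) \<nu>) \<longlonglongrightarrow> wasserstein 2 \<rho>' \<nu>"
proof -
  have "\<bar>wasserstein 2 (\<rho> n) \<nu> - wasserstein 2 \<rho>' \<nu>\<bar> \<le> wasserstein 2 (\<rho> n) \<rho>'" for n
    using wasserstein2_triangle[OF convex assms(1)[of n] assms(2,3)]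
      wasserstein2_triangle[OF convex assms(2) assms(1)[of n] assms(3)]
      wasserstein_commute[of 2 \<rho>' "\<rho> n"] by linarith
  then have "(\<lambda>n. wasserstein 2 (\<rho> n) \<nu> - wasserstein 2 \<rho>' \<nu>) \<longlonglongrightarrow> 0"
    by (intro Lim_null_comparison[OF _ assms(4)] always_eventually) auto
  then show ?thesis by (simp add: LIM_zero_iff)
qed

text \<open>Minimizing sequences are Cauchy because the proximal functional is strongly convex along
  generalized geodesics based at \<open>\<nu>\<close>.\<close>

lemma proximal_minimizer_exists:
  assumes lsc: "lsc_W2 H" and \<nu>: "\<nu> \<in> P2" and \<tau>: "\<tau> > 0"
    and bdd: "\<And>\<rho>. \<rho> \<in> dom_P2 H \<Longrightarrow> m \<le> functional_value H \<rho> + (wasserstein 2 \<rho> \<nu>)\<^sup>2 / (2 * \<tau>)"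
  obtains \<beta> where "\<beta> \<in> dom_P2 H" "\<And>\<rho>. \<rho> \<in> dom_P2 H \<Longrightarrow>
    functional_value H \<beta> + (wasserstein 2 \<beta> \<nu>)\<^sup>2 / (2 * \<tau>)
      \<le> functional_value H \<rho> + (wasserstein 2 \<rho> \<nu>)\<^sup>2 / (2 * \<tau>)"
proof -
  define \<phi> where "\<phi> \<rho> = functional_value H \<rho> + (wasserstein 2 \<rho> \<nu>)\<^sup>2 / (2 * \<tau>)" for \<rho>
  define I where "I = Inf (\<phi> ` dom_P2 H)"
  have ne: "dom_P2 H \<noteq> {}" using proper by (simp add: proper_P2_def)
  have bb: "bdd_below (\<phi> ` dom_P2 H)" using bdd by (intro bdd_belowI2[of _ m]) (simp add: \<phi>_def)
  have I: "I \<le> \<phi> \<rho>" if "\<rho> \<in> dom_P2 H" for \<rho>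
    unfolding I_def using bb that by (intro cInf_lower) auto
  have "\<exists>\<rho>\<in>dom_P2 H. \<phi> \<rho> < I + 1 / real (Suc n)" for n
    using cInf_lessD[of "\<phi> ` dom_P2 H" "I + 1 / real (Suc n)"] ne unfolding I_def by auto
  then obtain \<rho> where \<rho>: "\<And>n. \<rho> n \<in> dom_P2 H" "\<And>n. \<phi> (\<rho> n) < I + 1 / real (Suc n)" by metis
  have P: "\<rho> n \<in> P2" for n using \<rho>(1)[of n] by (simp add: dom_P2_def)
  have mid: "(wasserstein 2 (\<rho> i) (\<rho> j))\<^sup>2 \<le> 4 * \<tau> * (1 / real (Suc i) + 1 / real (Suc j))" for i j
  proof -
    have "(1::real) / 2 \<in> {0..1}" by simp
    then obtain \<sigma> where s: "\<sigma> \<in> dom_P2 H"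
      "\<phi> \<sigma> \<le> (1 - 1 / 2) * \<phi> (\<rho> i) + 1 / 2 * \<phi> (\<rho> j) - 1 / 2 * (1 - 1 / 2) * (wasserstein 2 (\<rho> i) (\<rho> j))\<^sup>2 / (2 * \<tau>)"
      unfolding \<phi>_def by (rule proximal_convexity[OF \<nu> \<rho>(1)[of i] \<rho>(1)[of j] _ \<tau>])
    have "(wasserstein 2 (\<rho> i) (\<rho> j))\<^sup>2 / (8 * \<tau>) \<le> (1 / real (Suc i) + 1 / real (Suc j)) / 2"
      using s(2) I[OF s(1)] \<rho>(2)[of i] \<rho>(2)[of j] by simp
    then show ?thesis using \<tau> by (simp add: divide_simps mult_ac del: of_nat_Suc)
  qed
  have cauchy: "\<exists>N. \<forall>m\<ge>N. \<forall>n\<ge>N. wasserstein 2 (\<rho> m) (\<rho> n) \<le> e" if e: "e > 0" for e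
  proof -
    obtain N where N: "inverse (real (Suc N)) < e\<^sup>2 / (8 * \<tau>)"
      using reals_Archimedean[of "e\<^sup>2 / (8 * \<tau>)"] e \<tau> by auto
    have "wasserstein 2 (\<rho> i) (\<rho> j) \<le> e" if "i \<ge> N" "j \<ge> N" for i j
    proof -
      have "1 / real (Suc i) \<le> e\<^sup>2 / (8 * \<tau>)" "1 / real (Suc j) \<le> e\<^sup>2 / (8 * \<tau>)"
        using that N by (auto simp: inverse_eq_divide intro!: order_trans[OF frac_le[of 1 1 "real (Suc N)"] less_imp_le])
      then have "4 * \<tau> * (1 / real (Suc i) + 1 / real (Suc j)) \<le> 4 * \<tau> * (e\<^sup>2 / (8 * \<tau>) + e\<^sup>2 / (8 * \<tau>))"
        using \<tau> by (intro mult_left_mono add_mono) auto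
      also have "\<dots> = e\<^sup>2" using \<tau> by (simp add: field_simps)
      finally have "(wasserstein 2 (\<rho> i) (\<rho> j))\<^sup>2 \<le> e\<^sup>2" using mid[of i j] by linarith
      then show ?thesis by (rule power2_le_imp_le) (use e in simp)
    qed
    then show ?thesis by blast
  qed
  obtain \<rho>' where \<rho>': "\<rho>' \<in> P2" and lim: "(\<lambda>n. wasserstein 2 (\<rho> n) \<rho>') \<longlonglongrightarrow> 0"
    by (rule wasserstein2_complete[OF convex P cauchy], assumption) (rule that)
  define c0 where "c0 = I - (wasserstein 2 \<rho>' \<nu>)\<^sup>2 / (2 * \<tau>)"
  have "H \<rho>' \<le> ereal c0"
  proof (rule ccontr)
    assume "\<not> H \<rho>' \<le> ereal c0"
    then have "ereal c0 < H \<rho>'" by simp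
    then obtain c where c: "ereal c0 < ereal c" "ereal c < H \<rho>'"
      using ereal_dense2 by blast
    obtain \<delta> where \<delta>: "\<delta> > 0" "\<And>\<nu>. \<nu> \<in> P2 \<Longrightarrow> wasserstein 2 \<nu> \<rho>' < \<delta> \<Longrightarrow> ereal c < H \<nu>"
      using lsc \<rho>' c(2) unfolding lsc_W2_def by blast
    have "\<forall>\<^sub>F n in sequentially. wasserstein 2 (\<rho> n) \<rho>' < \<delta>"
      using lim \<delta>(1) by (rule order_tendstoD)
    then have ev: "\<forall>\<^sub>F n in sequentially. c \<le> I + 1 / real (Suc n) - (wasserstein 2 (\<rho> n) \<nu>)\<^sup>2 / (2 * \<tau>)"
    proof eventually_elim
      case (elim n)
      then have "ereal c < H (\<rho> n)" using \<delta>(2) P by blast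
      then have "c < functional_value H (\<rho> n)" by (simp add: functional_value_eq[OF proper \<rho>(1)])
      then show ?case using \<rho>(2)[of n] unfolding \<phi>_def by linarith
    qed
    have "(\<lambda>n. I + 1 / real (Suc n) - (wasserstein 2 (\<rho> n) \<nu>)\<^sup>2 / (2 * \<tau>)) \<longlonglongrightarrow> I + 0 - (wasserstein 2 \<rho>' \<nu>)\<^sup>2 / (2 * \<tau>)"
      using LIMSEQ_inverse_real_of_nat wasserstein2_tendsto[OF P \<rho>' \<nu> lim] \<tau>
      by (intro tendsto_intros) (auto simp: inverse_eq_divide)
    from tendsto_lowerbound[OF this ev] have "c \<le> c0" by (simp add: c0_def)
    then show False using c(1) by simp
  qed
  then have dom: "\<rho>' \<in> dom_P2 H" using \<rho>' by (auto simp: dom_P2_def less_top[symmetric])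
  have "functional_value H \<rho>' \<le> c0"
    using \<open>H \<rho>' \<le> ereal c0\<close> by (simp add: functional_value_eq[OF proper dom])
  then have "\<phi> \<rho>' \<le> I" by (simp add: \<phi>_def c0_def)
  then show thesis using I by (intro that[OF dom]) (force simp: \<phi>_def)
qed

lemma J_evi:
  assumes lsc: "lsc_W2 H" and \<nu>: "\<nu> \<in> P2" and \<tau>: "\<tau> > 0"
    and bdd: "\<And>\<rho>. \<rho> \<in> dom_P2 H \<Longrightarrow> m \<le> functional_value H \<rho> + (wasserstein 2 \<rho> \<nu>)\<^sup>2 / (2 * \<tau>)"
  shows "J \<tau> H \<nu> \<in> dom_P2 H"
    and "\<rho> \<in> dom_P2 H \<Longrightarrow> functional_value H (J \<tau> H \<nu>) + (wasserstein 2 (J \<tau> H \<nu>) \<nu>)\<^sup>2 / (2 * \<tau>)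
      + (wasserstein 2 (J \<tau> H \<nu>) \<rho>)\<^sup>2 / (2 * \<tau>) \<le> functional_value H \<rho> + (wasserstein 2 \<rho> \<nu>)\<^sup>2 / (2 * \<tau>)"
proof -
  define \<phi> where "\<phi> \<rho> = functional_value H \<rho> + (wasserstein 2 \<rho> \<nu>)\<^sup>2 / (2 * \<tau>)" for \<rho>
  let ?\<Phi> = "\<lambda>\<rho>. H \<rho> + ereal (1 / (2 * \<tau>) * (wasserstein 2 \<rho> \<nu>)\<^sup>2)"
  have \<Phi>: "?\<Phi> \<rho> = ereal (\<phi> \<rho>)" if "\<rho> \<in> dom_P2 H" for \<rho>
    by (simp add: functional_value_eq[OF proper that] \<phi>_def)
  obtain \<beta> where \<beta>: "\<beta> \<in> dom_P2 H" "\<And>\<rho>. \<rho> \<in> dom_P2 H \<Longrightarrow> \<phi> \<beta> \<le> \<phi> \<rho>"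
    by (rule proximal_minimizer_exists[OF lsc \<nu> \<tau> bdd, folded \<phi>_def], assumption) (rule that)
  have "is_arg_min ?\<Phi> (\<lambda>\<rho>. \<rho> \<in> P2) \<beta>"
    unfolding is_arg_min_linorder
  proof (intro conjI allI impI)
    fix \<rho> :: "'a measure" assume "\<rho> \<in> P2"
    then show "?\<Phi> \<beta> \<le> ?\<Phi> \<rho>"
      using \<Phi>[OF \<beta>(1)] \<Phi>[of \<rho>] \<beta>(2)[of \<rho>] by (cases "\<rho> \<in> dom_P2 H") (auto simp: dom_P2_def)
  qed (use \<beta> in \<open>auto simp: dom_P2_def\<close>)
  then have J: "is_arg_min ?\<Phi> (\<lambda>\<rho>. \<rho> \<in> P2) (J \<tau> H \<nu>)"
    unfolding J_def arg_min_def by (rule someI)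
  then have JP: "J \<tau> H \<nu> \<in> P2" and Jle: "\<And>\<rho>. \<rho> \<in> P2 \<Longrightarrow> ?\<Phi> (J \<tau> H \<nu>) \<le> ?\<Phi> \<rho>"
    unfolding is_arg_min_linorder by auto
  have "\<beta> \<in> P2" using \<beta>(1) by (simp add: dom_P2_def)
  from Jle[OF this] have "?\<Phi> (J \<tau> H \<nu>) < \<infinity>" unfolding \<Phi>[OF \<beta>(1)] by (auto simp: less_top[symmetric])
  then show dom: "J \<tau> H \<nu> \<in> dom_P2 H" using JP by (auto simp: dom_P2_def)
  show "functional_value H (J \<tau> H \<nu>) + (wasserstein 2 (J \<tau> H \<nu>) \<nu>)\<^sup>2 / (2 * \<tau>)
      + (wasserstein 2 (J \<tau> H \<nu>) \<rho>)\<^sup>2 / (2 * \<tau>) \<le> functional_value H \<rho> + (wasserstein 2 \<rho> \<nu>)\<^sup>2 / (2 * \<tau>)"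
    if \<rho>: "\<rho> \<in> dom_P2 H"
  proof -
    let ?w = "(wasserstein 2 (J \<tau> H \<nu>) \<rho>)\<^sup>2 / (2 * \<tau>)"
    have le: "(1 - t) * ?w \<le> \<phi> \<rho> - \<phi> (J \<tau> H \<nu>)" if t: "0 < t" "t < 1" for t
    proof -
      have "t \<in> {0..1}" using t by simp
      then obtain \<sigma> where s: "\<sigma> \<in> dom_P2 H"
        "\<phi> \<sigma> \<le> (1 - t) * \<phi> (J \<tau> H \<nu>) + t * \<phi> \<rho> - t * (1 - t) * (wasserstein 2 (J \<tau> H \<nu>) \<rho>)\<^sup>2 / (2 * \<tau>)"
        unfolding \<phi>_def by (rule proximal_convexity[OF \<nu> dom \<rho> _ \<tau>])
      have "\<phi> (J \<tau> H \<nu>) \<le> \<phi> \<sigma>"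
        using Jle[of \<sigma>] s(1) unfolding \<Phi>[OF s(1)] \<Phi>[OF dom] by (simp add: dom_P2_def)
      then have "t * ((1 - t) * ?w) \<le> t * (\<phi> \<rho> - \<phi> (J \<tau> H \<nu>))"
        using s(2) by (simp add: algebra_simps)
      then show ?thesis by (rule mult_left_le_imp_le[OF _ t(1)])
    qed
    have "?w \<le> \<phi> \<rho> - \<phi> (J \<tau> H \<nu>)"
    proof (rule tendsto_upperbound)
      show "((\<lambda>t. (1 - t) * ?w) \<longlongrightarrow> ?w) (at_right 0)" by (rule tendsto_eq_intros refl | simp)+
      show "\<forall>\<^sub>F t in at_right 0. (1 - t) * ?w \<le> \<phi> \<rho> - \<phi> (J \<tau> H \<nu>)"
        unfolding eventually_at_right_field using le by (intro exI[of _ 1]) simp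
    qed simp
    then show ?thesis by (simp add: \<phi>_def)
  qed
qed

end

section \<open>The forward step\<close>

locale smooth_convex =
  fixes F :: "'a::euclidean_space \<Rightarrow> real" and gradF :: "'a \<Rightarrow> 'a" and L :: real
  assumes convex_F: "convex_on UNIV F"
    and gderiv: "\<And>x. GDERIV F x :> gradF x"
    and L_pos: "L > 0" and lipschitz: "L-lipschitz_on UNIV gradF"
begin

lemma line_derivative:
  "((\<lambda>t. F (x + t *\<^sub>R v)) has_real_derivative (gradF (x + t *\<^sub>R v) \<bullet> v)) (at t)"
proof -
  have "((\<lambda>t. x + t *\<^sub>R v) has_derivative (\<lambda>h. h *\<^sub>R v)) (at t)"
    by (auto intro!: derivative_eq_intros)
  moreover have "(F has_derivative (\<lambda>h. h \<bullet> gradF (x + t *\<^sub>R v))) (at (x + t *\<^sub>R v))"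
    using gderiv unfolding gderiv_def by blast
  ultimately have "((\<lambda>t. F (x + t *\<^sub>R v)) has_derivative (\<lambda>h. (h *\<^sub>R v) \<bullet> gradF (x + t *\<^sub>R v))) (at t)"
    by (rule has_derivative_compose)
  moreover have "(\<lambda>h. (h *\<^sub>R v) \<bullet> gradF (x + t *\<^sub>R v)) = (*) (gradF (x + t *\<^sub>R v) \<bullet> v)"
    by (simp add: fun_eq_iff inner_commute)
  ultimately show ?thesis by (simp add: has_field_derivative_def)
qed

lemma tangent_below: "F x + gradF x \<bullet> (y - x) \<le> F y"
proof -
  have cv: "convex_on UNIV (\<lambda>t. F (x + t *\<^sub>R (y - x)))"
  proof (rule convex_onI)
    fix t a b :: real assume t: "0 < t" "t < 1"
    have "x + ((1 - t) *\<^sub>R a + t *\<^sub>R b) *\<^sub>R (y - x)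
        = (1 - t) *\<^sub>R (x + a *\<^sub>R (y - x)) + t *\<^sub>R (x + b *\<^sub>R (y - x))"
      by (simp add: algebra_simps)
    then show "F (x + ((1 - t) *\<^sub>R a + t *\<^sub>R b) *\<^sub>R (y - x))
        \<le> (1 - t) * F (x + a *\<^sub>R (y - x)) + t * F (x + b *\<^sub>R (y - x))"
      using convex_onD[OF convex_F, of t "x + a *\<^sub>R (y - x)" "x + b *\<^sub>R (y - x)"] t by simp
  qed simp
  have d: "((\<lambda>t. F (x + t *\<^sub>R (y - x))) has_real_derivative (gradF x \<bullet> (y - x))) (at 0 within UNIV)"
    using line_derivative[of x "y - x" 0] by simp
  show ?thesis
    using convex_on_imp_above_tangent[OF cv _ _ _ d, of 1] by simp
qed

lemma descent: "F y \<le> F x + gradF x \<bullet> (y - x) + L / 2 * (norm (y - x))\<^sup>2"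
proof -
  let ?v = "y - x"
  let ?h = "\<lambda>t. F (x + t *\<^sub>R ?v) - t * (gradF x \<bullet> ?v) - L / 2 * t\<^sup>2 * (norm ?v)\<^sup>2"
  have "?h 1 \<le> ?h 0"
  proof (rule DERIV_nonpos_imp_nonincreasing[of 0 1 ?h])
    fix t :: real assume t: "0 \<le> t" "t \<le> 1"
    have d: "(?h has_real_derivative (gradF (x + t *\<^sub>R ?v) \<bullet> ?v - gradF x \<bullet> ?v - L * t * (norm ?v)\<^sup>2)) (at t)"
      by (rule derivative_eq_intros line_derivative refl | simp)+
    have "gradF (x + t *\<^sub>R ?v) \<bullet> ?v - gradF x \<bullet> ?v = (gradF (x + t *\<^sub>R ?v) - gradF x) \<bullet> ?v"
      by (simp add: inner_diff_left)
    also have "\<dots> \<le> norm (gradF (x + t *\<^sub>R ?v) - gradF x) * norm ?v"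
      by (rule norm_cauchy_schwarz)
    also have "\<dots> \<le> (L * norm (t *\<^sub>R ?v)) * norm ?v"
      using lipschitz_onD[OF lipschitz, of "x + t *\<^sub>R ?v" x]
      by (intro mult_right_mono) (auto simp: dist_norm)
    also have "\<dots> = L * t * (norm ?v)\<^sup>2" using t by (simp add: power2_eq_square)
    finally show "\<exists>y. (?h has_real_derivative y) (at t) \<and> y \<le> 0"
      using d by (intro exI[of _ "gradF (x + t *\<^sub>R ?v) \<bullet> ?v - gradF x \<bullet> ?v - L * t * (norm ?v)\<^sup>2"]) simp
  qed simp
  then show ?thesis by simp
qed

lemma continuous_gradF: "continuous_on UNIV gradF"
  using lipschitz by (rule lipschitz_on_continuous_on)

lemma continuous_F: "continuous_on UNIV F"
proof -
  have "continuous (at x) F" for x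
    using gderiv[of x] unfolding gderiv_def by (rule has_derivative_continuous)
  then show ?thesis by (simp add: continuous_at_imp_continuous_on)
qed

lemma F_measurable [measurable]: "F \<in> borel_measurable borel"
  using continuous_F by (rule borel_measurable_continuous_onI)

lemma gradF_measurable [measurable]: "gradF \<in> borel_measurable borel"
  using continuous_gradF by (rule borel_measurable_continuous_onI)

lemma norm_gradF_measurable: "(\<lambda>x. (norm (gradF x))\<^sup>2) \<in> borel_measurable borel"
  by measurable

lemma gradF_growth: "(norm (gradF x))\<^sup>2 \<le> 2 * (norm (gradF 0))\<^sup>2 + 2 * L\<^sup>2 * (norm x)\<^sup>2"
proof -
  have "norm (gradF x - gradF 0) \<le> L * norm x"
    using lipschitz_onD[OF lipschitz, of x 0] by (simp add: dist_norm)
  then have "(norm (gradF x - gradF 0))\<^sup>2 \<le> L\<^sup>2 * (norm x)\<^sup>2"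
    by (metis norm_ge_zero power_mono power_mult_distrib)
  then show ?thesis
    using norm_add_sq_le[of "gradF 0" "gradF x - gradF 0"] by simp
qed

lemma F_growth: "\<bar>F x\<bar> \<le> (\<bar>F 0\<bar> + (norm (gradF 0))\<^sup>2) + (1 + L / 2) * (norm x)\<^sup>2"
proof -
  have "\<bar>gradF 0 \<bullet> x\<bar> \<le> norm (gradF 0) * norm x" by (rule Cauchy_Schwarz_ineq2)
  moreover have "norm (gradF 0) * norm x \<le> (norm (gradF 0))\<^sup>2 + (norm x)\<^sup>2"
  proof -
    have "0 \<le> (norm (gradF 0) - norm x)\<^sup>2" by simp
    then have "2 * (norm (gradF 0) * norm x) \<le> (norm (gradF 0))\<^sup>2 + (norm x)\<^sup>2"
      by (simp add: power2_diff)
    moreover have "0 \<le> norm (gradF 0) * norm x" by simp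
    ultimately show ?thesis by linarith
  qed
  moreover have "0 \<le> L / 2 * (norm x)\<^sup>2" using L_pos by simp
  moreover have "F 0 + gradF 0 \<bullet> x \<le> F x" "F x \<le> F 0 + gradF 0 \<bullet> x + L / 2 * (norm x)\<^sup>2"
    using tangent_below[of 0 x] descent[of x 0] by simp_all
  ultimately show ?thesis unfolding distrib_right mult_1_left by linarith
qed

lemma integrable_F: "\<mu> \<in> P2 \<Longrightarrow> integrable \<mu> F"
proof (rule Bochner_Integration.integrable_bound)
  assume mu: "\<mu> \<in> P2"
  interpret prob_space \<mu> using mu by (rule P2D)
  show "integrable \<mu> (\<lambda>x. (\<bar>F 0\<bar> + (norm (gradF 0))\<^sup>2) + (1 + L / 2) * (norm x)\<^sup>2)"
    using P2D(3)[OF mu] by simp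
  show "F \<in> borel_measurable \<mu>"
    by (simp add: measurable_cong_sets[OF P2D(1)[OF mu] refl])
  show "AE x in \<mu>. norm (F x) \<le> norm ((\<bar>F 0\<bar> + (norm (gradF 0))\<^sup>2) + (1 + L / 2) * (norm x)\<^sup>2)"
    using F_growth by (auto intro: order_trans[OF _ abs_ge_self])
qed

lemma integrable_gradF: "\<mu> \<in> P2 \<Longrightarrow> integrable \<mu> (\<lambda>x. (norm (gradF x))\<^sup>2)"
proof (rule Bochner_Integration.integrable_bound)
  assume mu: "\<mu> \<in> P2"
  interpret prob_space \<mu> using mu by (rule P2D)
  show "integrable \<mu> (\<lambda>x. 2 * (norm (gradF 0))\<^sup>2 + 2 * L\<^sup>2 * (norm x)\<^sup>2)"
    using P2D(3)[OF mu] by simp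
  show "(\<lambda>x. (norm (gradF x))\<^sup>2) \<in> borel_measurable \<mu>"
    by (simp add: measurable_cong_sets[OF P2D(1)[OF mu] refl])
  show "AE x in \<mu>. norm ((norm (gradF x))\<^sup>2) \<le> norm (2 * (norm (gradF 0))\<^sup>2 + 2 * L\<^sup>2 * (norm x)\<^sup>2)"
    using gradF_growth by (auto intro: order_trans[OF _ abs_ge_self])
qed

lemma gradient_step_inverse:
  assumes "0 < \<tau>" "\<tau> < 1 / L"
  obtains g where "g \<in> borel_measurable borel"
    "\<And>x. g (x - \<tau> *\<^sub>R gradF x) = x" "\<And>y. g y - \<tau> *\<^sub>R gradF (g y) = y"
proof -
  have c: "0 \<le> \<tau> * L" "\<tau> * L < 1" using assms L_pos by (auto simp: field_simps)
  have lip: "dist (\<tau> *\<^sub>R gradF x) (\<tau> *\<^sub>R gradF y) \<le> \<tau> * L * dist x y" for x y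
    using lipschitz_onD[OF lipschitz, of x y] assms(1) by (simp add: dist_norm scaleR_diff_right[symmetric])
  have ex: "\<exists>!x. y + \<tau> *\<^sub>R gradF x = x" for y
    by (rule banach_fix_type[OF c]) (use lip in simp)
  define g where "g y = (THE x. y + \<tau> *\<^sub>R gradF x = x)" for y
  have g: "y + \<tau> *\<^sub>R gradF (g y) = g y" for y unfolding g_def by (rule theI'[OF ex])
  have g2: "g y - \<tau> *\<^sub>R gradF (g y) = y" for y unfolding diff_eq_eq by (rule g[symmetric])
  have g1: "g (x - \<tau> *\<^sub>R gradF x) = x" for x
    unfolding g_def by (rule the1_equality[OF ex]) simp
  have "(1 / (1 - \<tau> * L))-lipschitz_on UNIV g"
  proof (rule lipschitz_onI)
    fix y z
    have "dist (g y) (g z) = dist (y + \<tau> *\<^sub>R gradF (g y)) (z + \<tau> *\<^sub>R gradF (g z))" unfolding g ..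
    also have "\<dots> \<le> dist y z + dist (\<tau> *\<^sub>R gradF (g y)) (\<tau> *\<^sub>R gradF (g z))" by (rule dist_triangle_add)
    also have "\<dots> \<le> dist y z + \<tau> * L * dist (g y) (g z)" using lip by simp
    finally have "(1 - \<tau> * L) * dist (g y) (g z) \<le> dist y z" by (simp add: algebra_simps)
    then show "dist (g y) (g z) \<le> 1 / (1 - \<tau> * L) * dist y z" using c by (simp add: field_simps)
  qed (use c in simp)
  then have "g \<in> borel_measurable borel"
    by (intro borel_measurable_continuous_onI lipschitz_on_continuous_on)
  then show thesis using g1 g2 by (rule that)
qed

lemma gradient_step_expand:
  "(norm (y - (w - \<tau> *\<^sub>R gradF w)))\<^sup>2 = (norm (y - w))\<^sup>2 + 2 * \<tau> * (gradF w \<bullet> (y - w)) + \<tau>\<^sup>2 * (norm (gradF w))\<^sup>2"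
  by (simp add: power2_norm_eq_inner inner_diff inner_commute algebra_simps power2_eq_square[of \<tau>])

lemma P2_gradient_step:
  assumes mu: "\<mu> \<in> P2"
  shows "distr \<mu> borel (\<lambda>x. x - \<tau> *\<^sub>R gradF x) \<in> P2"
proof -
  note s = measurable_cong_sets[OF P2D(1)[OF mu] refl]
  have [measurable]: "(\<lambda>x. x - \<tau> *\<^sub>R gradF x) \<in> borel_measurable \<mu>" unfolding s by measurable
  have "integrable \<mu> (\<lambda>x. (norm (x - \<tau> *\<^sub>R gradF x))\<^sup>2)"
  proof (rule Bochner_Integration.integrable_bound)
    show "integrable \<mu> (\<lambda>x. 2 * (norm x)\<^sup>2 + 2 * \<tau>\<^sup>2 * (norm (gradF x))\<^sup>2)"
      using P2D(3)[OF mu] integrable_gradF[OF mu] by simp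
    show "AE x in \<mu>. norm ((norm (x - \<tau> *\<^sub>R gradF x))\<^sup>2) \<le> norm (2 * (norm x)\<^sup>2 + 2 * \<tau>\<^sup>2 * (norm (gradF x))\<^sup>2)"
    proof (intro AE_I2)
      fix x show "norm ((norm (x - \<tau> *\<^sub>R gradF x))\<^sup>2) \<le> norm (2 * (norm x)\<^sup>2 + 2 * \<tau>\<^sup>2 * (norm (gradF x))\<^sup>2)"
        using norm_diff_sq_le[of x "\<tau> *\<^sub>R gradF x"] by (simp add: power_mult_distrib)
    qed
  qed simp
  then show ?thesis using P2D(2)[OF mu] by (subst distr_in_P2_iff) auto
qed

lemma integral_law:
  fixes f :: "'a \<Rightarrow> real"
  assumes "distr M borel X = \<mu>" "X \<in> borel_measurable M" "f \<in> borel_measurable borel" "integrable \<mu> f"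
  shows "integrable M (\<lambda>\<omega>. f (X \<omega>))" "(\<integral>\<omega>. f (X \<omega>) \<partial>M) = (\<integral>x. f x \<partial>\<mu>)"
  using assms(4) unfolding assms(1)[symmetric]
  by (simp_all add: integrable_distr_eq[OF assms(2,3)] integral_distr[OF assms(2,3)])

lemma gradient_step_upper:
  fixes H :: "'a measure \<Rightarrow> ereal"
  assumes convex: "convex_gen_geodesics H" and P: "\<mu> \<in> P2" "\<rho> \<in> P2" and \<tau>: "\<tau> > 0"
  shows "(wasserstein 2 \<rho> (distr \<mu> borel (\<lambda>x. x - \<tau> *\<^sub>R gradF x)))\<^sup>2
    \<le> (wasserstein 2 \<mu> \<rho>)\<^sup>2 + 2 * \<tau> * ((\<integral>x. F x \<partial>\<rho>) - (\<integral>x. F x \<partial>\<mu>)) + \<tau>\<^sup>2 * (\<integral>x. (norm (gradF x))\<^sup>2 \<partial>\<mu>)"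
proof -
  obtain M :: "('a \<times> 'a \<times> 'a) measure" and W Y where
    M: "prob_space M" "W \<in> borel_measurable M" "Y \<in> borel_measurable M"
    and law: "distr M borel W = \<mu>" "distr M borel Y = \<rho>"
    and opt: "(\<integral>\<omega>. (norm (W \<omega> - Y \<omega>))\<^sup>2 \<partial>M) = (wasserstein 2 \<mu> \<rho>)\<^sup>2"
    by (rule optimal_random_variables[OF convex P]) (rule that)
  note [measurable] = M(2,3)
  note F = integral_law[OF law(1) M(2) F_measurable integrable_F[OF P(1)]]
    integral_law[OF law(2) M(3) F_measurable integrable_F[OF P(2)]]
  note G = integral_law[OF law(1) M(2) norm_gradF_measurable integrable_gradF[OF P(1)]]
  have i: "integrable M (\<lambda>\<omega>. (norm (W \<omega> - Y \<omega>))\<^sup>2)"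
    by (rule integrable_dist_sq_of_laws) (use M law P in auto)
  define X where "X \<omega> = W \<omega> - \<tau> *\<^sub>R gradF (W \<omega>)" for \<omega>
  have X[measurable]: "X \<in> borel_measurable M" unfolding X_def by measurable
  have lX: "distr M borel X = distr \<mu> borel (\<lambda>x. x - \<tau> *\<^sub>R gradF x)"
    unfolding law(1)[symmetric] X_def by (subst distr_distr) (auto simp: comp_def)
  have PX: "distr \<mu> borel (\<lambda>x. x - \<tau> *\<^sub>R gradF x) \<in> P2" by (rule P2_gradient_step[OF P(1)])
  have iX: "integrable M (\<lambda>\<omega>. (norm (Y \<omega> - X \<omega>))\<^sup>2)"
    by (rule integrable_dist_sq_of_laws) (use law lX P PX in auto)
  have "(wasserstein 2 \<rho> (distr \<mu> borel (\<lambda>x. x - \<tau> *\<^sub>R gradF x)))\<^sup>2 \<le> (\<integral>\<omega>. (norm (Y \<omega> - X \<omega>))\<^sup>2 \<partial>M)"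
    by (rule wasserstein2_sq_le[OF M(1,3) X law(2) lX P(2) PX])
  also have "\<dots> \<le> (\<integral>\<omega>. (norm (W \<omega> - Y \<omega>))\<^sup>2 + 2 * \<tau> * (F (Y \<omega>) - F (W \<omega>)) + \<tau>\<^sup>2 * (norm (gradF (W \<omega>)))\<^sup>2 \<partial>M)"
  proof (rule integral_mono)
    fix \<omega>
    have "2 * \<tau> * (gradF (W \<omega>) \<bullet> (Y \<omega> - W \<omega>)) \<le> 2 * \<tau> * (F (Y \<omega>) - F (W \<omega>))"
      using tangent_below[of "W \<omega>" "Y \<omega>"] \<tau> by (intro mult_left_mono) auto
    then show "(norm (Y \<omega> - X \<omega>))\<^sup>2
      \<le> (norm (W \<omega> - Y \<omega>))\<^sup>2 + 2 * \<tau> * (F (Y \<omega>) - F (W \<omega>)) + \<tau>\<^sup>2 * (norm (gradF (W \<omega>)))\<^sup>2"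
      unfolding X_def gradient_step_expand by (simp add: norm_minus_commute)
  qed (use i iX F G in auto)
  also have "\<dots> = (wasserstein 2 \<mu> \<rho>)\<^sup>2 + 2 * \<tau> * ((\<integral>x. F x \<partial>\<rho>) - (\<integral>x. F x \<partial>\<mu>)) + \<tau>\<^sup>2 * (\<integral>x. (norm (gradF x))\<^sup>2 \<partial>\<mu>)"
    using i F G opt by simp
  finally show ?thesis .
qed

text \<open>The gradient step is injective for \<open>\<tau> < 1 / L\<close>, so that an optimal plan issuing from its
  image lifts to a plan issuing from \<open>\<mu>\<close>.\<close>

lemma gradient_step_lower:
  fixes H :: "'a measure \<Rightarrow> ereal"
  assumes convex: "convex_gen_geodesics H" and P: "\<mu> \<in> P2" "\<rho> \<in> P2" and \<tau>: "\<tau> > 0" "\<tau> < 1 / L"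
  shows "(1 - \<tau> * L) * (wasserstein 2 \<mu> \<rho>)\<^sup>2 + 2 * \<tau> * ((\<integral>x. F x \<partial>\<rho>) - (\<integral>x. F x \<partial>\<mu>))
      + \<tau>\<^sup>2 * (\<integral>x. (norm (gradF x))\<^sup>2 \<partial>\<mu>)
    \<le> (wasserstein 2 \<rho> (distr \<mu> borel (\<lambda>x. x - \<tau> *\<^sub>R gradF x)))\<^sup>2"
proof -
  let ?\<nu> = "distr \<mu> borel (\<lambda>x. x - \<tau> *\<^sub>R gradF x)"
  note s = measurable_cong_sets[OF P2D(1)[OF P(1)] refl]
  have P\<nu>: "?\<nu> \<in> P2" by (rule P2_gradient_step[OF P(1)])
  obtain g where g[measurable]: "g \<in> borel_measurable borel"
    and g1: "\<And>x. g (x - \<tau> *\<^sub>R gradF x) = x" and g2: "\<And>y. g y - \<tau> *\<^sub>R gradF (g y) = y"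
    by (rule gradient_step_inverse[OF \<tau>]) (rule that)
  obtain M :: "('a \<times> 'a \<times> 'a) measure" and X Y where
    M: "prob_space M" "X \<in> borel_measurable M" "Y \<in> borel_measurable M"
    and law: "distr M borel X = ?\<nu>" "distr M borel Y = \<rho>"
    and opt: "(\<integral>\<omega>. (norm (X \<omega> - Y \<omega>))\<^sup>2 \<partial>M) = (wasserstein 2 ?\<nu> \<rho>)\<^sup>2"
    by (rule optimal_random_variables[OF convex P\<nu> P(2)]) (rule that)
  note [measurable] = M(2,3)
  define W where "W \<omega> = g (X \<omega>)" for \<omega>
  have W[measurable]: "W \<in> borel_measurable M" unfolding W_def by measurable
  have XW: "X \<omega> = W \<omega> - \<tau> *\<^sub>R gradF (W \<omega>)" for \<omega> unfolding W_def g2 ..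
  have [measurable]: "(\<lambda>x. x - \<tau> *\<^sub>R gradF x) \<in> borel_measurable \<mu>" unfolding s by measurable
  have lW: "distr M borel W = \<mu>"
  proof -
    have "distr M borel W = distr ?\<nu> borel g"
      unfolding law(1)[symmetric] W_def by (subst distr_distr) (auto simp: comp_def)
    also have "\<dots> = distr \<mu> borel (\<lambda>x. x)" by (subst distr_distr) (auto simp: comp_def g1)
    also have "\<dots> = \<mu>" by (rule distr_id2) (use P2D(1)[OF P(1)] in simp)
    finally show ?thesis .
  qed
  note F = integral_law[OF lW W F_measurable integrable_F[OF P(1)]]
    integral_law[OF law(2) M(3) F_measurable integrable_F[OF P(2)]]
  note G = integral_law[OF lW W norm_gradF_measurable integrable_gradF[OF P(1)]]
  have i: "integrable M (\<lambda>\<omega>. (norm (W \<omega> - Y \<omega>))\<^sup>2)"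
    by (rule integrable_dist_sq_of_laws) (use M W lW law P in auto)
  have iX: "integrable M (\<lambda>\<omega>. (norm (X \<omega> - Y \<omega>))\<^sup>2)"
    by (rule integrable_dist_sq_of_laws) (use M law P P\<nu> in auto)
  have "(1 - \<tau> * L) * (wasserstein 2 \<mu> \<rho>)\<^sup>2 \<le> (1 - \<tau> * L) * (\<integral>\<omega>. (norm (W \<omega> - Y \<omega>))\<^sup>2 \<partial>M)"
    using \<tau> L_pos by (intro mult_left_mono wasserstein2_sq_le[OF M(1) W M(3) lW law(2) P]) (auto simp: field_simps)
  then have "(1 - \<tau> * L) * (wasserstein 2 \<mu> \<rho>)\<^sup>2 + 2 * \<tau> * ((\<integral>x. F x \<partial>\<rho>) - (\<integral>x. F x \<partial>\<mu>))
      + \<tau>\<^sup>2 * (\<integral>x. (norm (gradF x))\<^sup>2 \<partial>\<mu>)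
    \<le> (\<integral>\<omega>. (1 - \<tau> * L) * (norm (W \<omega> - Y \<omega>))\<^sup>2 + 2 * \<tau> * (F (Y \<omega>) - F (W \<omega>)) + \<tau>\<^sup>2 * (norm (gradF (W \<omega>)))\<^sup>2 \<partial>M)"
    using i F G by simp
  also have "\<dots> \<le> (\<integral>\<omega>. (norm (X \<omega> - Y \<omega>))\<^sup>2 \<partial>M)"
  proof (rule integral_mono)
    fix \<omega>
    have "2 * \<tau> * (F (Y \<omega>) - F (W \<omega>) - L / 2 * (norm (Y \<omega> - W \<omega>))\<^sup>2) \<le> 2 * \<tau> * (gradF (W \<omega>) \<bullet> (Y \<omega> - W \<omega>))"
      using descent[of "Y \<omega>" "W \<omega>"] \<tau> by (intro mult_left_mono) auto
    moreover have "(norm (X \<omega> - Y \<omega>))\<^sup>2 = (norm (Y \<omega> - W \<omega>))\<^sup>2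
        + 2 * \<tau> * (gradF (W \<omega>) \<bullet> (Y \<omega> - W \<omega>)) + \<tau>\<^sup>2 * (norm (gradF (W \<omega>)))\<^sup>2"
      unfolding XW norm_minus_commute[of _ "Y \<omega>"] by (rule gradient_step_expand)
    ultimately show "(1 - \<tau> * L) * (norm (W \<omega> - Y \<omega>))\<^sup>2 + 2 * \<tau> * (F (Y \<omega>) - F (W \<omega>)) + \<tau>\<^sup>2 * (norm (gradF (W \<omega>)))\<^sup>2
        \<le> (norm (X \<omega> - Y \<omega>))\<^sup>2"
      unfolding norm_minus_commute[of "W \<omega>" "Y \<omega>"] by (simp add: algebra_simps)
  qed (use i iX F G in auto)
  finally show ?thesis unfolding opt wasserstein_commute[of 2 \<rho>] .
qed

end

locale forward_backward_problem = smooth_convex F gradF L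
  for F :: "'a::euclidean_space \<Rightarrow> real" and gradF :: "'a \<Rightarrow> 'a" and L :: real +
  fixes H :: "'a measure \<Rightarrow> ereal"
  assumes proper: "proper_P2 H" and lsc: "lsc_W2 H" and convex: "convex_gen_geodesics H"
    and argmin: "\<exists>\<nu>. is_arg_min (total_energy F H) (\<lambda>\<nu>. \<nu> \<in> P2) \<nu>"
begin

definition energy :: "'a measure \<Rightarrow> real" where
  "energy \<rho> = (\<integral>x. F x \<partial>\<rho>) + functional_value H \<rho>"

lemma total_energy_eq: "\<rho> \<in> dom_P2 H \<Longrightarrow> total_energy F H \<rho> = ereal (energy \<rho>)"
  using functional_value_eq[OF proper] by (simp add: total_energy_def energy_def)

lemma is_arg_min_energy_iff:
  "is_arg_min (total_energy F H) (\<lambda>\<nu>. \<nu> \<in> P2) \<rho>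
    \<longleftrightarrow> \<rho> \<in> dom_P2 H \<and> (\<forall>\<nu>\<in>dom_P2 H. energy \<rho> \<le> energy \<nu>)" (is "?l \<longleftrightarrow> ?r")
proof
  assume ?l
  then have P: "\<rho> \<in> P2" and le: "\<And>\<nu>. \<nu> \<in> P2 \<Longrightarrow> total_energy F H \<rho> \<le> total_energy F H \<nu>"
    unfolding is_arg_min_linorder by auto
  obtain \<nu>0 where \<nu>0: "\<nu>0 \<in> dom_P2 H" using proper by (auto simp: proper_P2_def)
  have "total_energy F H \<rho> < \<infinity>"
    using le[of \<nu>0] total_energy_eq[OF \<nu>0] \<nu>0 by (auto simp: dom_P2_def less_top[symmetric])
  then have dom: "\<rho> \<in> dom_P2 H" using P by (auto simp: total_energy_def dom_P2_def)
  then show ?r using le total_energy_eq by (force simp: dom_P2_def)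
next
  assume r: ?r
  show ?l
    unfolding is_arg_min_linorder
  proof (intro conjI allI impI)
    show "total_energy F H \<rho> \<le> total_energy F H \<nu>" if "\<nu> \<in> P2" for \<nu>
      using r that total_energy_eq[of \<rho>] total_energy_eq[of \<nu>]
      by (cases "\<nu> \<in> dom_P2 H") (auto simp: dom_P2_def total_energy_def)
  qed (use r in \<open>auto simp: dom_P2_def\<close>)
qed

lemma forward_backward_step:
  assumes \<mu>: "\<mu> \<in> P2" and \<tau>: "0 < \<tau>" "\<tau> < 1 / L"
  defines "\<beta> \<equiv> forward_backward gradF H \<tau> \<mu>"
  shows "\<beta> \<in> dom_P2 H"
    and "\<rho> \<in> dom_P2 H \<Longrightarrow> 2 * \<tau> * (energy \<beta> - energy \<rho>)
      \<le> (wasserstein 2 \<mu> \<rho>)\<^sup>2 - (wasserstein 2 \<beta> \<rho>)\<^sup>2 - (1 - \<tau> * L) * (wasserstein 2 \<mu> \<beta>)\<^sup>2"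
proof -
  let ?\<nu> = "distr \<mu> borel (\<lambda>x. x - \<tau> *\<^sub>R gradF x)"
  let ?N = "\<integral>x. (norm (gradF x))\<^sup>2 \<partial>\<mu>" and ?E = "\<integral>x. F x \<partial>\<mu>"
  have P\<nu>: "?\<nu> \<in> P2" by (rule P2_gradient_step[OF \<mu>])
  obtain \<mu>0 where \<mu>0: "\<mu>0 \<in> dom_P2 H" "\<And>\<rho>. \<rho> \<in> dom_P2 H \<Longrightarrow> energy \<mu>0 \<le> energy \<rho>"
    using argmin is_arg_min_energy_iff by blast
  have c: "0 \<le> 1 - \<tau> * L" using \<tau> L_pos by (simp add: field_simps)
  have bdd: "energy \<mu>0 - ?E \<le> functional_value H \<rho> + (wasserstein 2 \<rho> ?\<nu>)\<^sup>2 / (2 * \<tau>)"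
    if \<rho>: "\<rho> \<in> dom_P2 H" for \<rho>
  proof -
    have "\<rho> \<in> P2" using \<rho> by (simp add: dom_P2_def)
    note gradient_step_lower[OF convex \<mu> this \<tau>]
    moreover have "0 \<le> (1 - \<tau> * L) * (wasserstein 2 \<mu> \<rho>)\<^sup>2" "0 \<le> \<tau>\<^sup>2 * ?N" using c by simp_all
    ultimately have "2 * \<tau> * ((\<integral>x. F x \<partial>\<rho>) - ?E) \<le> (wasserstein 2 \<rho> ?\<nu>)\<^sup>2"
      by linarith
    then have "(\<integral>x. F x \<partial>\<rho>) - ?E \<le> (wasserstein 2 \<rho> ?\<nu>)\<^sup>2 / (2 * \<tau>)"
      using \<tau> by (simp add: field_simps)
    then show ?thesis using \<mu>0(2)[OF \<rho>] by (simp add: energy_def)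
  qed
  have \<beta>: "\<beta> = J \<tau> H ?\<nu>" by (simp add: \<beta>_def forward_backward_def)
  note J = J_evi[OF convex proper lsc P\<nu> \<tau>(1) bdd, folded \<beta>]
  show dom: "\<beta> \<in> dom_P2 H" by (rule J(1))
  then have P\<beta>: "\<beta> \<in> P2" by (simp add: dom_P2_def)
  show "2 * \<tau> * (energy \<beta> - energy \<rho>)
      \<le> (wasserstein 2 \<mu> \<rho>)\<^sup>2 - (wasserstein 2 \<beta> \<rho>)\<^sup>2 - (1 - \<tau> * L) * (wasserstein 2 \<mu> \<beta>)\<^sup>2"
    if \<rho>: "\<rho> \<in> dom_P2 H"
  proof -
    have P\<rho>: "\<rho> \<in> P2" using \<rho> by (simp add: dom_P2_def)
    have "2 * \<tau> * functional_value H \<beta> + (wasserstein 2 \<beta> ?\<nu>)\<^sup>2 + (wasserstein 2 \<beta> \<rho>)\<^sup>2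
        \<le> 2 * \<tau> * functional_value H \<rho> + (wasserstein 2 \<rho> ?\<nu>)\<^sup>2"
    proof -
      have "2 * \<tau> * (functional_value H \<beta> + (wasserstein 2 \<beta> ?\<nu>)\<^sup>2 / (2 * \<tau>) + (wasserstein 2 \<beta> \<rho>)\<^sup>2 / (2 * \<tau>))
          \<le> 2 * \<tau> * (functional_value H \<rho> + (wasserstein 2 \<rho> ?\<nu>)\<^sup>2 / (2 * \<tau>))"
        using \<tau>(1) J(2)[OF _ \<rho>] by (intro mult_left_mono) auto
      then show ?thesis using \<tau>(1) by (simp add: distrib_left)
    qed
    then show ?thesis
      using gradient_step_lower[OF convex \<mu> P\<beta> \<tau>] gradient_step_upper[OF convex \<mu> P\<rho> \<tau>(1)]
      by (simp add: energy_def algebra_simps)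
  qed
qed

end

section \<open>Weak limits of integrals and distances\<close>

lemma C2w_growth:
  fixes f :: "'a::euclidean_space \<Rightarrow> real"
  assumes f: "f \<in> C2w" and e: "e > 0"
  obtains K where "\<And>x. \<bar>f x\<bar> \<le> K + e * (norm x)\<^sup>2"
proof -
  have "((\<lambda>x. f x / (1 + (norm x)\<^sup>2)) \<longlongrightarrow> 0) at_infinity" and c: "continuous_on UNIV f"
    using f by (auto simp: C2w_def)
  then obtain b where b: "\<And>x. norm x \<ge> b \<Longrightarrow> \<bar>f x / (1 + (norm x)\<^sup>2)\<bar> < e"
    using e unfolding Lim_at_infinity by (auto simp: dist_real_def)
  have "compact (f ` cball 0 b)"
    by (intro compact_continuous_image continuous_on_subset[OF c]) auto
  then have "bounded (f ` cball 0 b)" by (rule compact_imp_bounded)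
  then obtain K where "\<forall>y\<in>f ` cball 0 b. norm y \<le> K" unfolding bounded_iff by blast
  then have K: "\<bar>f x\<bar> \<le> K" if "x \<in> cball 0 b" for x using that by auto
  show thesis
  proof (rule that)
    fix x :: 'a
    have e2: "0 \<le> e * (norm x)\<^sup>2" using e by simp
    show "\<bar>f x\<bar> \<le> (\<bar>K\<bar> + e) + e * (norm x)\<^sup>2"
    proof (cases "norm x \<ge> b")
      case True
      have "0 < 1 + (norm x)\<^sup>2" by (simp add: add_pos_nonneg)
      then have "\<bar>f x\<bar> < e * (1 + (norm x)\<^sup>2)"
        using b[OF True] by (simp add: divide_simps)
      then show ?thesis by (simp add: algebra_simps)
    next
      case False
      then have "\<bar>f x\<bar> \<le> K" using K[of x] by simp
      then show ?thesis using e e2 by linarith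
    qed
  qed
qed

lemma powr_growth:
  fixes p e :: real
  assumes p: "1 \<le> p" "p < 2" and e: "e > 0"
  obtains K where "\<And>t. t \<ge> 0 \<Longrightarrow> t powr p \<le> K + e * t\<^sup>2"
proof -
  define T where "T = (1 / e) powr (1 / (2 - p))"
  have T: "T > 0" using e by (simp add: T_def)
  show thesis
  proof (rule that)
    fix t :: real assume t: "t \<ge> 0"
    have e2: "0 \<le> e * t\<^sup>2" using e by simp
    show "t powr p \<le> T powr p + e * t\<^sup>2"
    proof (cases "t \<le> T")
      case True
      then have "t powr p \<le> T powr p" using t p by (intro powr_mono2) auto
      then show ?thesis using e2 by linarith
    next
      case False
      then have tp: "t > 0" using T by simp
      have "1 / e = T powr (2 - p)" unfolding T_def using p e by (simp add: powr_powr)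
      also have "\<dots> \<le> t powr (2 - p)" using False T p by (intro powr_mono2) auto
      finally have "1 \<le> e * t powr (2 - p)" using e by (simp add: field_simps)
      then have "1 * t powr p \<le> (e * t powr (2 - p)) * t powr p" by (intro mult_right_mono) auto
      also have "\<dots> = e * t powr 2" by (simp add: mult.assoc powr_add[symmetric])
      also have "\<dots> = e * t\<^sup>2" using tp by simp
      finally show ?thesis using powr_ge_zero[of T p] by linarith
    qed
  qed
qed

lemma skorokhod_limit_integral:
  fixes f :: "'a::euclidean_space \<Rightarrow> real"
  assumes lim: "skorokhod_limit \<mu> \<mu>'" and P: "\<And>n. \<mu> n \<in> P2" and B: "\<And>n. second_moment (\<mu> n) \<le> B"
    and f: "f \<in> C2w"
  shows "(\<lambda>n. \<integral>x. f x \<partial>\<mu> n) \<longlonglongrightarrow> (\<integral>x. f x \<partial>\<mu>')"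
proof -
  note P' = second_moment_limit_bound[OF lim P B]
  obtain \<Omega> :: "real measure" and X X' where ps: "prob_space \<Omega>"
    and m[measurable]: "\<And>n. X n \<in> borel_measurable \<Omega>" "X' \<in> borel_measurable \<Omega>"
    and law: "\<And>n. distr \<Omega> borel (X n) = \<mu> n" "distr \<Omega> borel X' = \<mu>'"
    and l: "AE \<omega> in \<Omega>. (\<lambda>n. X n \<omega>) \<longlonglongrightarrow> X' \<omega>"
    by (rule skorokhod_limitE[OF lim]) (rule that)
  interpret prob_space \<Omega> by fact
  have c: "continuous_on UNIV f" using f by (simp add: C2w_def)
  have [measurable]: "f \<in> borel_measurable borel" using c by (rule borel_measurable_continuous_onI)
  have i: "integrable \<Omega> (\<lambda>\<omega>. (norm (X n \<omega>))\<^sup>2)" "(\<integral>\<omega>. (norm (X n \<omega>))\<^sup>2 \<partial>\<Omega>) \<le> B"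
    "integrable \<Omega> (\<lambda>\<omega>. (norm (X' \<omega>))\<^sup>2)" for n
    using integrable_sq_of_law[of "X n" \<Omega>] integrable_sq_of_law[of X' \<Omega>]
      second_moment_distr[of "X n" \<Omega>] m law P[of n] B[of n] P' by auto
  obtain K1 where K1: "\<And>x. \<bar>f x\<bar> \<le> K1 + 1 * (norm x)\<^sup>2"
    by (rule C2w_growth[OF f, of 1]) (simp, rule that)
  have if': "integrable \<Omega> (\<lambda>\<omega>. f (X' \<omega>))"
  proof (rule Bochner_Integration.integrable_bound)
    show "integrable \<Omega> (\<lambda>\<omega>. K1 + 1 * (norm (X' \<omega>))\<^sup>2)" using i(3) by simp
    show "AE \<omega> in \<Omega>. norm (f (X' \<omega>)) \<le> norm (K1 + 1 * (norm (X' \<omega>))\<^sup>2)"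
      using K1 by (auto intro: order_trans[OF _ abs_ge_self])
  qed simp
  define Z where "Z n \<omega> = f (X n \<omega>) - f (X' \<omega>)" for n \<omega>
  have Zm: "Z n \<in> borel_measurable \<Omega>" for n unfolding Z_def by measurable
  have Z0: "AE \<omega> in \<Omega>. (\<lambda>n. Z n \<omega>) \<longlonglongrightarrow> 0"
    using l
  proof eventually_elim
    case (elim \<omega>)
    have "(\<lambda>n. f (X n \<omega>)) \<longlonglongrightarrow> f (X' \<omega>)"
      using continuous_on_tendsto_compose[OF c elim] by simp
    then show ?case unfolding Z_def by (rule LIM_zero)
  qed
  have dom: "\<exists>g. integrable \<Omega> g \<and> (\<forall>n \<omega>. \<bar>Z n \<omega>\<bar> \<le> g \<omega> + e * (norm (X n \<omega>))\<^sup>2)" if e: "e > 0" for e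
  proof -
    obtain K where K: "\<And>x. \<bar>f x\<bar> \<le> K + e * (norm x)\<^sup>2" by (rule C2w_growth[OF f e]) (rule that)
    have "\<bar>Z n \<omega>\<bar> \<le> (K + \<bar>f (X' \<omega>)\<bar>) + e * (norm (X n \<omega>))\<^sup>2" for n \<omega>
      using K[of "X n \<omega>"] unfolding Z_def by linarith
    moreover have "integrable \<Omega> (\<lambda>\<omega>. K + \<bar>f (X' \<omega>)\<bar>)" using if' by simp
    ultimately show ?thesis by (intro exI[of _ "\<lambda>\<omega>. K + \<bar>f (X' \<omega>)\<bar>"]) simp
  qed
  have nn: "0 \<le> (norm (X n \<omega>))\<^sup>2" for n \<omega> by simp
  note Z = integral_tendsto_0_almost_dominated(1,3)[of Z, OF Zm Z0 i(1,2) nn dom]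
  have eq: "(\<integral>x. f x \<partial>\<mu> n) = (\<integral>\<omega>. Z n \<omega> \<partial>\<Omega>) + (\<integral>x. f x \<partial>\<mu>')" for n
  proof -
    have "(\<integral>x. f x \<partial>\<mu> n) = (\<integral>\<omega>. Z n \<omega> + f (X' \<omega>) \<partial>\<Omega>)"
      unfolding law(1)[symmetric] Z_def by (subst integral_distr) auto
    also have "\<dots> = (\<integral>\<omega>. Z n \<omega> \<partial>\<Omega>) + (\<integral>\<omega>. f (X' \<omega>) \<partial>\<Omega>)" using Z(1) if' by simp
    also have "(\<integral>\<omega>. f (X' \<omega>) \<partial>\<Omega>) = (\<integral>x. f x \<partial>\<mu>')"
      unfolding law(2)[symmetric] by (subst integral_distr) auto
    finally show ?thesis .
  qed
  show ?thesis unfolding eq using tendsto_add[OF Z(2) tendsto_const] by simp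
qed

lemma skorokhod_limit_wasserstein:
  assumes lim: "skorokhod_limit \<mu> \<mu>'" and P: "\<And>n. \<mu> n \<in> P2" and B: "\<And>n. second_moment (\<mu> n) \<le> B"
    and p: "1 \<le> p" "p < 2"
  shows "(\<lambda>n. wasserstein p (\<mu> n) \<mu>') \<longlonglongrightarrow> 0"
proof -
  note P' = second_moment_limit_bound[OF lim P B]
  obtain \<Omega> :: "real measure" and X X' where ps: "prob_space \<Omega>"
    and m[measurable]: "\<And>n. X n \<in> borel_measurable \<Omega>" "X' \<in> borel_measurable \<Omega>"
    and law: "\<And>n. distr \<Omega> borel (X n) = \<mu> n" "distr \<Omega> borel X' = \<mu>'"
    and l: "AE \<omega> in \<Omega>. (\<lambda>n. X n \<omega>) \<longlonglongrightarrow> X' \<omega>"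
    by (rule skorokhod_limitE[OF lim]) (rule that)
  interpret prob_space \<Omega> by fact
  have i: "integrable \<Omega> (\<lambda>\<omega>. (norm (X n \<omega>))\<^sup>2)" "(\<integral>\<omega>. (norm (X n \<omega>))\<^sup>2 \<partial>\<Omega>) \<le> B"
    "integrable \<Omega> (\<lambda>\<omega>. (norm (X' \<omega>))\<^sup>2)" "(\<integral>\<omega>. (norm (X' \<omega>))\<^sup>2 \<partial>\<Omega>) \<le> B" for n
    using integrable_sq_of_law[of "X n" \<Omega>] integrable_sq_of_law[of X' \<Omega>]
      second_moment_distr[of "X n" \<Omega>] second_moment_distr[of X' \<Omega>] m law P[of n] B[of n] P' by auto
  define Y where "Y n \<omega> = 2 * (norm (X n \<omega>))\<^sup>2 + 2 * (norm (X' \<omega>))\<^sup>2" for n \<omega>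
  have Y: "integrable \<Omega> (Y n)" "(\<integral>\<omega>. Y n \<omega> \<partial>\<Omega>) \<le> 4 * B" "0 \<le> Y n \<omega>" for n \<omega>
    unfolding Y_def using i(1,3) i(2)[of n] i(4) by simp_all
  define Z where "Z n \<omega> = dist (X n \<omega>) (X' \<omega>) powr p" for n \<omega>
  have Zm: "Z n \<in> borel_measurable \<Omega>" for n unfolding Z_def by measurable
  have Z0: "AE \<omega> in \<Omega>. (\<lambda>n. Z n \<omega>) \<longlonglongrightarrow> 0"
    using l
  proof eventually_elim
    case (elim \<omega>)
    then have "(\<lambda>n. dist (X n \<omega>) (X' \<omega>)) \<longlonglongrightarrow> 0" by (rule iffD1[OF tendsto_dist_iff])
    then show ?case unfolding Z_def
      by (rule tendsto_zero_powrI) (use p in auto)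
  qed
  have dom: "\<exists>g. integrable \<Omega> g \<and> (\<forall>n \<omega>. \<bar>Z n \<omega>\<bar> \<le> g \<omega> + e * Y n \<omega>)" if e: "e > 0" for e
  proof -
    obtain K where K: "\<And>t. t \<ge> 0 \<Longrightarrow> t powr p \<le> K + e * t\<^sup>2" by (rule powr_growth[OF p e]) (rule that)
    have "\<bar>Z n \<omega>\<bar> \<le> K + e * Y n \<omega>" for n \<omega>
    proof -
      have "(dist (X n \<omega>) (X' \<omega>))\<^sup>2 \<le> Y n \<omega>"
        unfolding Y_def dist_norm by (rule norm_diff_sq_le)
      then have "e * (dist (X n \<omega>) (X' \<omega>))\<^sup>2 \<le> e * Y n \<omega>" using e by (intro mult_left_mono) auto
      then show ?thesis using K[of "dist (X n \<omega>) (X' \<omega>)"] unfolding Z_def by simp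
    qed
    then show ?thesis by (intro exI[of _ "\<lambda>\<omega>. K"]) simp
  qed
  note Z = integral_tendsto_0_almost_dominated(1,3)[of Z, OF Zm Z0 Y(1,2,3) dom]
  have le: "wasserstein p (\<mu> n) \<mu>' powr p \<le> (\<integral>\<omega>. Z n \<omega> \<partial>\<Omega>)" for n
    using wasserstein_powr_le[OF ps m(1)[of n] m(2), of p] Z(1)[of n] p law unfolding Z_def by simp
  have "(\<lambda>n. wasserstein p (\<mu> n) \<mu>' powr p) \<longlonglongrightarrow> 0"
    by (rule Lim_null_comparison[OF always_eventually Z(2)]) (use le in simp)
  then have "(\<lambda>n. (wasserstein p (\<mu> n) \<mu>' powr p) powr (1 / p)) \<longlonglongrightarrow> 0"
    by (rule tendsto_zero_powrI) (use p in auto)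
  then show ?thesis using p by (simp add: powr_powr)
qed

lemma tendsto_of_subsubseq:
  assumes "\<And>s :: nat \<Rightarrow> nat. strict_mono s \<Longrightarrow> \<exists>r :: nat \<Rightarrow> nat. strict_mono r \<and> (\<lambda>n. x (s (r n))) \<longlonglongrightarrow> l"
  shows "x \<longlonglongrightarrow> l"
proof (rule topological_tendstoI, rule ccontr)
  fix V assume V: "open V" "l \<in> V" and nev: "\<not> (\<forall>\<^sub>F n in sequentially. x n \<in> V)"
  obtain s :: "nat \<Rightarrow> nat" where s: "strict_mono s" "\<And>n. x (s n) \<notin> V"
    by (rule not_eventually_subseq[OF nev]) (rule that)
  obtain r :: "nat \<Rightarrow> nat" where "(\<lambda>n. x (s (r n))) \<longlonglongrightarrow> l" using assms[OF s(1)] by blast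
  then have "\<forall>\<^sub>F n in sequentially. x (s (r n)) \<in> V" using V by (rule topological_tendstoD)
  then show False using s(2) by (simp add: eventually_sequentially)
qed

lemma ereal_bigo_inverse:
  assumes f: "\<And>n. n \<ge> 1 \<Longrightarrow> f n = ereal (b n)" and b: "\<And>n. n \<ge> 1 \<Longrightarrow> 0 \<le> b n"
    and \<sigma>: "\<And>n. n \<ge> 1 \<Longrightarrow> 0 < \<sigma> n" and le: "\<And>n. n \<ge> 1 \<Longrightarrow> \<sigma> n * b n \<le> C"
  shows "ereal_bigo f (\<lambda>n. 1 / \<sigma> n)"
  unfolding ereal_bigo_def
proof
  show "\<forall>\<^sub>F n in sequentially. \<bar>f n\<bar> \<noteq> \<infinity>"
    using f by (intro eventually_sequentiallyI[of 1]) simp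
  have "\<forall>\<^sub>F n in sequentially. norm (real_of_ereal (f n)) \<le> C * norm (1 / \<sigma> n)"
  proof (rule eventually_sequentiallyI[of 1])
    fix n :: nat assume n: "1 \<le> n"
    show "norm (real_of_ereal (f n)) \<le> C * norm (1 / \<sigma> n)"
      using le[OF n] b[OF n] \<sigma>[OF n] by (simp add: f[OF n] field_simps)
  qed
  then show "(\<lambda>n. real_of_ereal (f n)) \<in> O(\<lambda>n. 1 / \<sigma> n)" by (rule bigoI)
qed

section \<open>Convergence of the inexact scheme\<close>

locale inexact_forward_backward = forward_backward_problem F gradF L H
  for F :: "'a::euclidean_space \<Rightarrow> real" and gradF L H +
  fixes \<epsilon> \<tau> \<sigma> :: "nat \<Rightarrow> real" and \<mu> \<beta> :: "nat \<Rightarrow> 'a measure"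
  assumes \<epsilon>: "\<And>n. 0 \<le> \<epsilon> n" "summable \<epsilon>"
    and \<tau>: "\<And>n. 0 < \<tau> n" "\<And>n. \<tau> n < 1 / L"
    and \<sigma>_def: "\<And>n. \<sigma> n = (\<Sum>i<n. \<tau> i)"
    and \<sigma>_at_top: "filterlim \<sigma> at_top sequentially"
    and \<mu>: "\<And>n. \<mu> n \<in> P2"
    and \<beta>_def: "\<And>n. \<beta> n = forward_backward gradF H (\<tau> n) (\<mu> n)"
    and inexact: "\<And>n. wasserstein 2 (\<mu> (Suc n)) (\<beta> n) \<le> \<epsilon> n"
begin

definition minimizer :: "'a measure \<Rightarrow> bool" where
  "minimizer \<rho> \<longleftrightarrow> \<rho> \<in> dom_P2 H \<and> (\<forall>\<nu>\<in>dom_P2 H. energy \<rho> \<le> energy \<nu>)"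

lemma minimizer_exists: "\<exists>\<rho>. minimizer \<rho>"
  using argmin is_arg_min_energy_iff unfolding minimizer_def by blast

lemma minimizerD:
  assumes "minimizer \<rho>"
  shows "\<rho> \<in> dom_P2 H" "\<rho> \<in> P2" "\<nu> \<in> dom_P2 H \<Longrightarrow> energy \<rho> \<le> energy \<nu>"
  using assms by (auto simp: minimizer_def dom_P2_def)

lemma \<beta>: "\<beta> n \<in> dom_P2 H" "\<beta> n \<in> P2"
  using forward_backward_step(1)[OF \<mu>[of n] \<tau>[of n]] by (auto simp: \<beta>_def dom_P2_def)

lemma step:
  assumes "\<rho> \<in> dom_P2 H"
  shows "2 * \<tau> n * (energy (\<beta> n) - energy \<rho>) \<le> (wasserstein 2 (\<mu> n) \<rho>)\<^sup>2 - (wasserstein 2 (\<beta> n) \<rho>)\<^sup>2"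
proof -
  have "0 \<le> 1 - \<tau> n * L" using \<tau>[of n] L_pos by (simp add: field_simps)
  then have "0 \<le> (1 - \<tau> n * L) * (wasserstein 2 (\<mu> n) (\<beta> n))\<^sup>2" by simp
  then show ?thesis
    using forward_backward_step(2)[OF \<mu>[of n] \<tau>[of n] assms] unfolding \<beta>_def by linarith
qed

lemma \<epsilon>_le_suminf: "\<epsilon> n \<le> suminf \<epsilon>"
  using sum_le_suminf[OF \<epsilon>(2), of "{n}"] \<epsilon>(1) by simp

lemma fejer_\<beta>:
  assumes "minimizer \<rho>"
  shows "wasserstein 2 (\<beta> n) \<rho> \<le> wasserstein 2 (\<mu> n) \<rho>"
proof (rule power2_le_imp_le)
  have "0 \<le> 2 * \<tau> n * (energy (\<beta> n) - energy \<rho>)"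
    using minimizerD(3)[OF assms \<beta>(1)] \<tau>(1)[of n] by simp
  then show "(wasserstein 2 (\<beta> n) \<rho>)\<^sup>2 \<le> (wasserstein 2 (\<mu> n) \<rho>)\<^sup>2"
    using step[OF minimizerD(1)[OF assms], of n] by linarith
qed simp

lemma fejer_\<mu>:
  assumes "minimizer \<rho>"
  shows "wasserstein 2 (\<mu> (Suc n)) \<rho> \<le> wasserstein 2 (\<mu> n) \<rho> + \<epsilon> n"
  using wasserstein2_triangle[OF convex \<mu>[of "Suc n"] \<beta>(2)[of n] minimizerD(2)[OF assms]]
    inexact[of n] fejer_\<beta>[OF assms, of n] by linarith

lemma fejer_bounded:
  assumes "minimizer \<rho>"
  shows "wasserstein 2 (\<mu> n) \<rho> \<le> wasserstein 2 (\<mu> 0) \<rho> + suminf \<epsilon>"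
proof -
  have "wasserstein 2 (\<mu> n) \<rho> \<le> wasserstein 2 (\<mu> 0) \<rho> + (\<Sum>i<n. \<epsilon> i)"
  proof (induction n)
    case (Suc n)
    then show ?case using fejer_\<mu>[OF assms, of n] by simp
  qed simp
  also have "(\<Sum>i<n. \<epsilon> i) \<le> suminf \<epsilon>" by (rule sum_le_suminf) (use \<epsilon> in auto)
  finally show ?thesis by simp
qed

lemma fejer_convergent:
  assumes "minimizer \<rho>"
  shows "convergent (\<lambda>n. wasserstein 2 (\<mu> n) \<rho>)"
proof -
  define b where "b n = wasserstein 2 (\<mu> n) \<rho> - (\<Sum>i<n. \<epsilon> i)" for n
  have dec: "decseq b"
    by (rule decseq_SucI) (use fejer_\<mu>[OF assms] in \<open>simp add: b_def algebra_simps\<close>)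
  have low: "- suminf \<epsilon> \<le> b n" for n
  proof -
    have "(\<Sum>i<n. \<epsilon> i) \<le> suminf \<epsilon>" by (rule sum_le_suminf) (use \<epsilon> in auto)
    then show ?thesis using wasserstein_nonneg[of 2 "\<mu> n" \<rho>] unfolding b_def by linarith
  qed
  obtain l where "b \<longlonglongrightarrow> l" by (rule decseq_convergent[OF dec, of "- suminf \<epsilon>"]) (use low in blast)+
  then have "(\<lambda>n. b n + (\<Sum>i<n. \<epsilon> i)) \<longlonglongrightarrow> l + suminf \<epsilon>"
    by (intro tendsto_add summable_LIMSEQ \<epsilon>(2))
  then show ?thesis unfolding convergent_def b_def by auto
qed

lemma weighted_gap_sum_bounded:
  assumes m: "minimizer \<rho>"
  obtains C where "\<And>n. (\<Sum>i<n. \<tau> i * (energy (\<beta> i) - energy \<rho>)) \<le> C"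
proof -
  define R where "R = wasserstein 2 (\<mu> 0) \<rho> + suminf \<epsilon>"
  define D where "D = 2 * R + suminf \<epsilon>"
  have E0: "0 \<le> suminf \<epsilon>" by (rule suminf_nonneg) (use \<epsilon> in auto)
  then have D0: "0 \<le> D" by (simp add: D_def R_def)
  have one: "2 * (\<tau> n * (energy (\<beta> n) - energy \<rho>))
      \<le> (wasserstein 2 (\<mu> n) \<rho>)\<^sup>2 - (wasserstein 2 (\<mu> (Suc n)) \<rho>)\<^sup>2 + D * \<epsilon> n" for n
  proof -
    let ?b = "wasserstein 2 (\<beta> n) \<rho>"
    have b: "0 \<le> ?b" "?b \<le> R"
      using fejer_\<beta>[OF m, of n] fejer_bounded[OF m, of n] by (simp_all add: R_def)
    have "wasserstein 2 (\<mu> (Suc n)) \<rho> \<le> ?b + \<epsilon> n"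
      using wasserstein2_triangle[OF convex \<mu>[of "Suc n"] \<beta>(2)[of n] minimizerD(2)[OF m]] inexact[of n]
      by linarith
    then have "(wasserstein 2 (\<mu> (Suc n)) \<rho>)\<^sup>2 \<le> (?b + \<epsilon> n)\<^sup>2" by (rule power_mono) simp
    also have "\<dots> = ?b\<^sup>2 + (2 * ?b + \<epsilon> n) * \<epsilon> n" by (simp add: power2_eq_square algebra_simps)
    also have "\<dots> \<le> ?b\<^sup>2 + D * \<epsilon> n"
      using b(2) \<epsilon>_le_suminf[of n] \<epsilon>(1)[of n] unfolding D_def by (intro add_left_mono mult_right_mono) auto
    finally show ?thesis using step[OF minimizerD(1)[OF m], of n] by (simp add: mult.assoc)
  qed
  have tele: "2 * (\<Sum>i<n. \<tau> i * (energy (\<beta> i) - energy \<rho>))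
      \<le> (wasserstein 2 (\<mu> 0) \<rho>)\<^sup>2 - (wasserstein 2 (\<mu> n) \<rho>)\<^sup>2 + D * (\<Sum>i<n. \<epsilon> i)" for n
  proof (induction n)
    case (Suc n)
    then show ?case using one[of n] by (simp add: algebra_simps)
  qed simp
  show thesis
  proof (rule that)
    fix n
    have "D * (\<Sum>i<n. \<epsilon> i) \<le> D * suminf \<epsilon>"
      using D0 \<epsilon> by (intro mult_left_mono sum_le_suminf) auto
    then have "2 * (\<Sum>i<n. \<tau> i * (energy (\<beta> i) - energy \<rho>))
        \<le> (wasserstein 2 (\<mu> 0) \<rho>)\<^sup>2 + D * suminf \<epsilon>"
      using tele[of n] zero_le_power2[of "wasserstein 2 (\<mu> n) \<rho>"] by linarith
    then show "(\<Sum>i<n. \<tau> i * (energy (\<beta> i) - energy \<rho>))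
        \<le> ((wasserstein 2 (\<mu> 0) \<rho>)\<^sup>2 + D * suminf \<epsilon>) / 2"
      by (simp only: le_divide_eq_numeral1 mult.commute[of _ 2])
  qed
qed

lemma \<sigma>_pos: "n \<ge> 1 \<Longrightarrow> 0 < \<sigma> n"
  unfolding \<sigma>_def using \<tau>(1) by (intro sum_pos) (auto simp: lessThan_empty_iff)

lemma best_iterate_rate:
  assumes m: "minimizer \<rho>" and j: "\<And>n i. n \<ge> 1 \<Longrightarrow> i < n \<Longrightarrow> energy (\<beta> (j n)) \<le> energy (\<beta> i)"
  obtains C where "\<And>n. n \<ge> 1 \<Longrightarrow> \<sigma> n * (energy (\<beta> (j n)) - energy \<rho>) \<le> C"
proof -
  obtain C where C: "\<And>n. (\<Sum>i<n. \<tau> i * (energy (\<beta> i) - energy \<rho>)) \<le> C"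
    by (rule weighted_gap_sum_bounded[OF m]) (rule that)
  show thesis
  proof (rule that)
    fix n :: nat assume n: "n \<ge> 1"
    have "\<sigma> n * (energy (\<beta> (j n)) - energy \<rho>) = (\<Sum>i<n. \<tau> i * (energy (\<beta> (j n)) - energy \<rho>))"
      unfolding \<sigma>_def by (simp add: sum_distrib_right)
    also have "\<dots> \<le> (\<Sum>i<n. \<tau> i * (energy (\<beta> i) - energy \<rho>))"
      using j[OF n] \<tau>(1) by (intro sum_mono mult_left_mono) (auto intro: less_imp_le)
    finally show "\<sigma> n * (energy (\<beta> (j n)) - energy \<rho>) \<le> C" using C[of n] by linarith
  qed
qed

text \<open>Comparing with the previous iterate shows that the energy gap increases by at most
  \<open>\<epsilon>\<^sub>n\<^sup>2 / (2 \<tau>\<^sub>n\<^sub>+\<^sub>1)\<close>, so the summed gap controls \<open>\<sigma>\<^sub>n\<^sub>+\<^sub>1\<close> times the last gap.\<close>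

lemma last_iterate_rate:
  assumes m: "minimizer \<rho>" and s: "summable (\<lambda>n. \<sigma> (Suc n) / \<tau> (Suc n) * \<epsilon> n)"
  obtains C where "\<And>n. \<sigma> (Suc n) * (energy (\<beta> n) - energy \<rho>) \<le> C"
proof -
  obtain C where C: "\<And>n. (\<Sum>i<n. \<tau> i * (energy (\<beta> i) - energy \<rho>)) \<le> C"
    by (rule weighted_gap_sum_bounded[OF m]) (rule that)
  let ?s = "\<lambda>n. \<sigma> (Suc n) / \<tau> (Suc n) * \<epsilon> n" and ?E = "suminf \<epsilon>"
  have s0: "0 \<le> ?s n" for n using \<sigma>_pos[of "Suc n"] \<tau>(1)[of "Suc n"] \<epsilon>(1)[of n] by simp
  have E0: "0 \<le> ?E" by (rule suminf_nonneg) (use \<epsilon> in auto)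
  have inc: "\<sigma> (Suc n) * (energy (\<beta> (Suc n)) - energy (\<beta> n)) \<le> ?E * ?s n" for n
  proof -
    have "2 * \<tau> (Suc n) * (energy (\<beta> (Suc n)) - energy (\<beta> n)) \<le> (wasserstein 2 (\<mu> (Suc n)) (\<beta> n))\<^sup>2"
      using step[OF \<beta>(1)[of n], of "Suc n"] zero_le_power2[of "wasserstein 2 (\<beta> (Suc n)) (\<beta> n)"] by linarith
    also have "\<dots> \<le> \<epsilon> n * \<epsilon> n"
      unfolding power2_eq_square using inexact[of n] by (intro mult_mono) (auto intro: \<epsilon>)
    also have "\<dots> \<le> 2 * (?E * \<epsilon> n)"
      using \<epsilon>_le_suminf[of n] \<epsilon>(1)[of n] E0 mult_right_mono[OF \<epsilon>_le_suminf[of n] \<epsilon>(1)[of n]]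
        mult_nonneg_nonneg[OF E0 \<epsilon>(1)[of n]] by linarith
    finally have "energy (\<beta> (Suc n)) - energy (\<beta> n) \<le> ?E * \<epsilon> n / \<tau> (Suc n)"
      using \<tau>(1)[of "Suc n"] by (simp add: field_simps)
    then have "\<sigma> (Suc n) * (energy (\<beta> (Suc n)) - energy (\<beta> n)) \<le> \<sigma> (Suc n) * (?E * \<epsilon> n / \<tau> (Suc n))"
      using \<sigma>_pos[of "Suc n"] by (intro mult_left_mono) auto
    then show ?thesis by (simp add: mult_ac)
  qed
  have ind: "\<sigma> (Suc n) * (energy (\<beta> n) - energy \<rho>)
      \<le> ?E * (\<Sum>i<n. ?s i) + (\<Sum>i<Suc n. \<tau> i * (energy (\<beta> i) - energy \<rho>))" for n
  proof (induction n)
    case 0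
    show ?case by (simp add: \<sigma>_def)
  next
    case (Suc n)
    have "\<sigma> (Suc (Suc n)) * (energy (\<beta> (Suc n)) - energy \<rho>)
      = \<sigma> (Suc n) * (energy (\<beta> n) - energy \<rho>) + \<sigma> (Suc n) * (energy (\<beta> (Suc n)) - energy (\<beta> n))
        + \<tau> (Suc n) * (energy (\<beta> (Suc n)) - energy \<rho>)"
      unfolding \<sigma>_def[of "Suc (Suc n)"] sum.lessThan_Suc[of \<tau> "Suc n"] \<sigma>_def[of "Suc n", symmetric]
      by (simp add: algebra_simps)
    also have "\<dots> \<le> (?E * (\<Sum>i<n. ?s i) + (\<Sum>i<Suc n. \<tau> i * (energy (\<beta> i) - energy \<rho>))) + ?E * ?s n
        + \<tau> (Suc n) * (energy (\<beta> (Suc n)) - energy \<rho>)"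
      using Suc inc[of n] by linarith
    also have "\<dots> = ?E * (\<Sum>i<Suc n. ?s i) + (\<Sum>i<Suc (Suc n). \<tau> i * (energy (\<beta> i) - energy \<rho>))"
      unfolding sum.lessThan_Suc[of ?s n] sum.lessThan_Suc[of _ "Suc n"] by (simp add: distrib_left)
    finally show ?case .
  qed
  show thesis
  proof (rule that)
    fix n
    have "?E * (\<Sum>i<n. ?s i) \<le> ?E * suminf ?s"
      using E0 s s0 by (intro mult_left_mono sum_le_suminf) auto
    then show "\<sigma> (Suc n) * (energy (\<beta> n) - energy \<rho>) \<le> ?E * suminf ?s + C"
      using ind[of n] C[of "Suc n"] by linarith
  qed
qed

lemma gap_tendsto_0:
  assumes m: "minimizer \<rho>" and C: "\<And>n. \<sigma> (Suc n) * (energy (\<beta> n) - energy \<rho>) \<le> C"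
  shows "(\<lambda>n. energy (\<beta> n) - energy \<rho>) \<longlonglongrightarrow> 0"
proof (rule tendsto_sandwich)
  show "\<forall>\<^sub>F n in sequentially. 0 \<le> energy (\<beta> n) - energy \<rho>"
    using minimizerD(3)[OF m \<beta>(1)] by simp
  show "\<forall>\<^sub>F n in sequentially. energy (\<beta> n) - energy \<rho> \<le> C / \<sigma> (Suc n)"
  proof (intro always_eventually allI)
    fix n show "energy (\<beta> n) - energy \<rho> \<le> C / \<sigma> (Suc n)"
      using C[of n] \<sigma>_pos[of "Suc n"] by (simp add: field_simps)
  qed
  have "filterlim (\<lambda>n. \<sigma> (Suc n)) at_top sequentially"
    using \<sigma>_at_top filterlim_sequentially_Suc by blast
  then show "(\<lambda>n. C / \<sigma> (Suc n)) \<longlonglongrightarrow> 0"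
    by (intro tendsto_divide_0[OF tendsto_const] filterlim_at_top_imp_at_infinity)
qed simp

lemma wasserstein2_\<mu>_bounded:
  assumes "\<nu> \<in> P2"
  obtains K where "\<And>n. wasserstein 2 (\<mu> n) \<nu> \<le> K"
proof -
  obtain \<rho> where m: "minimizer \<rho>" using minimizer_exists by blast
  show thesis
  proof (rule that)
    fix n
    show "wasserstein 2 (\<mu> n) \<nu> \<le> (wasserstein 2 (\<mu> 0) \<rho> + suminf \<epsilon>) + wasserstein 2 \<rho> \<nu>"
      using wasserstein2_triangle[OF convex \<mu>[of n] minimizerD(2)[OF m] assms] fejer_bounded[OF m, of n]
      by linarith
  qed
qed

lemma second_moment_\<mu>_bounded:
  obtains B where "\<And>n. second_moment (\<mu> n) \<le> B"
proof -
  obtain K where "\<And>n. wasserstein 2 (\<mu> n) (\<mu> 0) \<le> K" by (rule wasserstein2_\<mu>_bounded[OF \<mu>]) (rule that)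
  then have "wasserstein 2 (\<mu> 0) (\<mu> n) \<le> K" for n unfolding wasserstein_commute[of 2 "\<mu> 0"] .
  from wasserstein2_bounded[OF convex \<mu> \<mu> this] show thesis by (rule that)
qed

lemma wasserstein2_\<beta>_\<mu>:
  assumes \<nu>: "\<nu> \<in> P2"
  obtains K where "\<And>n. \<bar>(wasserstein 2 (\<beta> n) \<nu>)\<^sup>2 - (wasserstein 2 (\<mu> (Suc n)) \<nu>)\<^sup>2\<bar> \<le> \<epsilon> n * K"
proof -
  obtain K where K: "\<And>n. wasserstein 2 (\<mu> n) \<nu> \<le> K" by (rule wasserstein2_\<mu>_bounded[OF \<nu>]) (rule that)
  show thesis
  proof (rule that)
    fix n
    let ?b = "wasserstein 2 (\<beta> n) \<nu>" and ?m = "wasserstein 2 (\<mu> (Suc n)) \<nu>"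
    have d: "\<bar>?b - ?m\<bar> \<le> \<epsilon> n"
      using wasserstein2_triangle[OF convex \<mu>[of "Suc n"] \<beta>(2)[of n] \<nu>]
        wasserstein2_triangle[OF convex \<beta>(2)[of n] \<mu>[of "Suc n"] \<nu>] inexact[of n]
        wasserstein_commute[of 2 "\<beta> n" "\<mu> (Suc n)"] by linarith
    have "\<bar>?b\<^sup>2 - ?m\<^sup>2\<bar> = \<bar>?b - ?m\<bar> * (?b + ?m)"
      using wasserstein_nonneg[of 2 "\<beta> n" \<nu>] wasserstein_nonneg[of 2 "\<mu> (Suc n)" \<nu>]
      by (simp add: power2_eq_square square_diff_square_factored abs_mult del: wasserstein_nonneg)
    also have "\<dots> \<le> \<epsilon> n * (2 * K + suminf \<epsilon>)"
      using d K[of "Suc n"] \<epsilon>(1)[of n] \<epsilon>_le_suminf[of n] wasserstein_nonneg[of 2 "\<beta> n" \<nu>]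
        wasserstein_nonneg[of 2 "\<mu> (Suc n)" \<nu>]
      by (intro mult_mono) linarith+
    finally show "\<bar>?b\<^sup>2 - ?m\<^sup>2\<bar> \<le> \<epsilon> n * (2 * K + suminf \<epsilon>)" .
  qed
qed

text \<open>Demiclosedness: by Opial's property a limit \<open>\<mu>'\<close> of a minimizing sequence is a fixed point of the
  exact step \<open>\<mu>' \<mapsto> \<beta>'\<close>, and the energy of \<open>\<beta>'\<close> is minimal.\<close>

lemma cluster_point_minimizer:
  assumes m: "minimizer \<rho>" and gap: "(\<lambda>n. energy (\<beta> n) - energy \<rho>) \<longlonglongrightarrow> 0"
    and r: "strict_mono r" and lim: "skorokhod_limit (\<lambda>n. \<mu> (r n)) \<mu>'"
  shows "minimizer \<mu>'"
proof -
  obtain B where B: "\<And>n. second_moment (\<mu> n) \<le> B" by (rule second_moment_\<mu>_bounded) (rule that)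
  have P': "\<mu>' \<in> P2" by (rule second_moment_limit_bound[OF lim \<mu> B])
  define t where "t = 1 / (2 * L)"
  have t: "0 < t" "t < 1 / L" using L_pos by (simp_all add: t_def field_simps)
  define \<beta>' where "\<beta>' = forward_backward gradF H t \<mu>'"
  note fb = forward_backward_step[OF P' t, folded \<beta>'_def]
  have P\<beta>': "\<beta>' \<in> P2" using fb(1) by (simp add: dom_P2_def)
  obtain K1 where K1: "\<And>n. \<bar>(wasserstein 2 (\<beta> n) \<mu>')\<^sup>2 - (wasserstein 2 (\<mu> (Suc n)) \<mu>')\<^sup>2\<bar> \<le> \<epsilon> n * K1"
    by (rule wasserstein2_\<beta>_\<mu>[OF P']) (rule that)
  obtain K2 where K2: "\<And>n. \<bar>(wasserstein 2 (\<beta> n) \<beta>')\<^sup>2 - (wasserstein 2 (\<mu> (Suc n)) \<beta>')\<^sup>2\<bar> \<le> \<epsilon> n * K2"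
    by (rule wasserstein2_\<beta>_\<mu>[OF P\<beta>']) (rule that)
  define k where "k n = r (Suc n) - 1" for n
  have rk: "r (Suc n) = Suc (k n)" for n
    using seq_suble[OF r, of "Suc n"] by (simp add: k_def)
  have kmono: "strict_mono k"
  proof (rule strict_monoI)
    fix a b :: nat assume "a < b"
    then have "r (Suc a) < r (Suc b)" using r by (simp add: strict_mono_less)
    then show "k a < k b" by (simp add: rk)
  qed
  have lim': "skorokhod_limit (\<lambda>n. \<mu> (Suc (k n))) \<mu>'"
    using skorokhod_limit_subseq[OF lim, of Suc] by (simp add: rk strict_mono_Suc_iff)
  let ?Q = "2 * t * (energy \<beta>' - energy \<rho>) + (wasserstein 2 \<mu>' \<beta>')\<^sup>2"
  have "?Q \<le> 0 + e" if e: "e > 0" for e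
  proof (rule tendsto_lowerbound)
    show "(\<lambda>n. 2 * t * (energy (\<beta> (k n)) - energy \<rho>) + \<epsilon> (k n) * K1 + \<epsilon> (k n) * K2 + e) \<longlonglongrightarrow> 0 + e"
    proof -
      have "(\<lambda>n. energy (\<beta> (k n)) - energy \<rho>) \<longlonglongrightarrow> 0" "(\<lambda>n. \<epsilon> (k n)) \<longlonglongrightarrow> 0"
        using LIMSEQ_subseq_LIMSEQ[OF gap kmono] LIMSEQ_subseq_LIMSEQ[OF summable_LIMSEQ_zero[OF \<epsilon>(2)] kmono]
        by (simp_all add: comp_def)
      then have "(\<lambda>n. 2 * t * (energy (\<beta> (k n)) - energy \<rho>) + \<epsilon> (k n) * K1 + \<epsilon> (k n) * K2 + e)
          \<longlonglongrightarrow> 2 * t * 0 + 0 * K1 + 0 * K2 + e"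
        by (intro tendsto_intros)
      then show ?thesis by simp
    qed
    have "\<forall>\<^sub>F n in sequentially. (wasserstein 2 (\<mu> (Suc (k n))) \<mu>')\<^sup>2 + (wasserstein 2 \<mu>' \<beta>')\<^sup>2 - e
        \<le> (wasserstein 2 (\<mu> (Suc (k n))) \<beta>')\<^sup>2"
      by (rule wasserstein2_opial[OF convex lim' \<mu> B P\<beta>' e])
    then show "\<forall>\<^sub>F n in sequentially. ?Q \<le> 2 * t * (energy (\<beta> (k n)) - energy \<rho>) + \<epsilon> (k n) * K1 + \<epsilon> (k n) * K2 + e"
    proof eventually_elim
      case (elim n)
      have "0 \<le> (1 - t * L) * (wasserstein 2 \<mu>' \<beta>')\<^sup>2" using L_pos by (simp add: t_def)
      then have "2 * t * (energy \<beta>' - energy (\<beta> (k n))) \<le> (wasserstein 2 (\<beta> (k n)) \<mu>')\<^sup>2 - (wasserstein 2 (\<beta> (k n)) \<beta>')\<^sup>2"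
        using fb(2)[OF \<beta>(1)[of "k n"]]
        unfolding wasserstein_commute[of 2 _ "\<beta> (k n)"] by linarith
      then have "2 * t * (energy \<beta>' - energy \<rho>) \<le> 2 * t * (energy (\<beta> (k n)) - energy \<rho>)
          + (wasserstein 2 (\<beta> (k n)) \<mu>')\<^sup>2 - (wasserstein 2 (\<beta> (k n)) \<beta>')\<^sup>2"
        by (simp add: algebra_simps)
      then show ?case using K1[of "k n"] K2[of "k n"] elim by linarith
    qed
  qed simp
  then have Q: "?Q \<le> 0" by (rule field_le_epsilon)
  have E: "0 \<le> 2 * t * (energy \<beta>' - energy \<rho>)" using minimizerD(3)[OF m fb(1)] t by simp
  have "(wasserstein 2 \<mu>' \<beta>')\<^sup>2 \<le> 0" using Q E by linarith
  then have "wasserstein 2 \<mu>' \<beta>' = 0" by simp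
  then have eq: "\<mu>' = \<beta>'" by (rule wasserstein2_eq_0_imp[OF convex P' P\<beta>'])
  have "2 * t * (energy \<beta>' - energy \<rho>) \<le> 0"
    using Q zero_le_power2[of "wasserstein 2 \<mu>' \<beta>'"] by linarith
  then have "energy \<beta>' \<le> energy \<rho>" using t by (simp add: mult_le_0_iff)
  then show ?thesis
    unfolding minimizer_def eq using fb(1) minimizerD(3)[OF m] by (auto intro: order_trans)
qed

lemma cluster_point_unique:
  assumes m: "minimizer \<mu>'" "minimizer \<mu>''"
    and r: "strict_mono r" "skorokhod_limit (\<lambda>n. \<mu> (r n)) \<mu>'"
    and s: "strict_mono s" "skorokhod_limit (\<lambda>n. \<mu> (s n)) \<mu>''"
  shows "\<mu>' = \<mu>''"
proof -
  obtain B where B: "\<And>n. second_moment (\<mu> n) \<le> B" by (rule second_moment_\<mu>_bounded) (rule that)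
  note P = minimizerD(2)[OF m(1)] minimizerD(2)[OF m(2)]
  define A where "A n = (wasserstein 2 (\<mu> n) \<mu>')\<^sup>2 - (wasserstein 2 (\<mu> n) \<mu>'')\<^sup>2" for n
  let ?w = "(wasserstein 2 \<mu>' \<mu>'')\<^sup>2"
  obtain a b where "(\<lambda>n. wasserstein 2 (\<mu> n) \<mu>') \<longlonglongrightarrow> a" "(\<lambda>n. wasserstein 2 (\<mu> n) \<mu>'') \<longlonglongrightarrow> b"
    using fejer_convergent[OF m(1)] fejer_convergent[OF m(2)] unfolding convergent_def by blast
  then have lim: "A \<longlonglongrightarrow> a\<^sup>2 - b\<^sup>2" unfolding A_def by (intro tendsto_intros)
  have "?w \<le> 0 + e" if e: "e > 0" for e
  proof -
    have ev: "\<forall>\<^sub>F n in sequentially. A (r n) \<le> e - ?w"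
      using wasserstein2_opial[OF convex r(2) \<mu> B P(2) e]
      by eventually_elim (simp add: A_def)
    have 1: "a\<^sup>2 - b\<^sup>2 \<le> e - ?w"
      by (rule tendsto_upperbound[OF LIMSEQ_subseq_LIMSEQ[OF lim r(1), unfolded comp_def] ev]) simp
    have ev: "\<forall>\<^sub>F n in sequentially. ?w - e \<le> A (s n)"
      using wasserstein2_opial[OF convex s(2) \<mu> B P(1) e]
      by eventually_elim (simp add: A_def wasserstein_commute[of 2 \<mu>'' \<mu>'])
    have 2: "?w - e \<le> a\<^sup>2 - b\<^sup>2"
      by (rule tendsto_lowerbound[OF LIMSEQ_subseq_LIMSEQ[OF lim s(1), unfolded comp_def] ev]) simp
    show ?thesis using 1 2 by linarith
  qed
  then have "?w \<le> 0" by (rule field_le_epsilon)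
  then have "wasserstein 2 \<mu>' \<mu>'' = 0" by simp
  then show ?thesis by (rule wasserstein2_eq_0_imp[OF convex P])
qed

lemma weak_convergence:
  assumes m: "minimizer \<rho>" and gap: "(\<lambda>n. energy (\<beta> n) - energy \<rho>) \<longlonglongrightarrow> 0"
  obtains \<mu>' where "minimizer \<mu>'" "limitin tau_w2 \<mu> \<mu>' sequentially"
    "\<And>p. p \<in> {1..<2} \<Longrightarrow> (\<lambda>n. wasserstein p (\<mu> n) \<mu>') \<longlonglongrightarrow> 0"
proof -
  obtain B where B: "\<And>n. second_moment (\<mu> n) \<le> B" by (rule second_moment_\<mu>_bounded) (rule that)
  obtain r0 \<mu>' where r0: "strict_mono r0" "skorokhod_limit (\<lambda>n. \<mu> (r0 n)) \<mu>'" and P': "\<mu>' \<in> P2"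
    by (rule skorokhod_limit_compactness[of \<mu>, OF \<mu> B]) (rule that)
  have m': "minimizer \<mu>'" by (rule cluster_point_minimizer[OF m gap r0])
  have sub: "\<exists>r :: nat \<Rightarrow> nat. strict_mono r \<and> skorokhod_limit (\<lambda>n. \<mu> (s (r n))) \<mu>'" if s: "strict_mono s" for s
  proof -
    obtain r \<mu>'' where r: "strict_mono r" "skorokhod_limit (\<lambda>n. \<mu> (s (r n))) \<mu>''" and "\<mu>'' \<in> P2"
      by (rule skorokhod_limit_compactness[of "\<lambda>n. \<mu> (s n)", OF \<mu> B]) (rule that)
    have sr: "strict_mono (\<lambda>n. s (r n))" using strict_mono_o[OF s r(1)] by (simp add: comp_def)
    have "minimizer \<mu>''" by (rule cluster_point_minimizer[OF m gap sr r(2)])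
    then have "\<mu>' = \<mu>''" by (rule cluster_point_unique[OF m' _ r0 sr r(2)])
    then show ?thesis using r by blast
  qed
  have "(\<lambda>n. \<integral>x. f x \<partial>\<mu> n) \<longlonglongrightarrow> (\<integral>x. f x \<partial>\<mu>')" if f: "f \<in> C2w" for f
  proof (rule tendsto_of_subsubseq)
    fix s :: "nat \<Rightarrow> nat" assume "strict_mono s"
    then obtain r where r: "strict_mono r" "skorokhod_limit (\<lambda>n. \<mu> (s (r n))) \<mu>'" using sub by blast
    show "\<exists>r. strict_mono r \<and> (\<lambda>n. \<integral>x. f x \<partial>\<mu> (s (r n))) \<longlonglongrightarrow> (\<integral>x. f x \<partial>\<mu>')"
      using skorokhod_limit_integral[OF r(2) \<mu> B f] r(1) by blast
  qed
  then have lim: "limitin tau_w2 \<mu> \<mu>' sequentially"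
    using limitin_tau_w2_iff[of \<mu> \<mu>', OF \<mu> P'] by blast
  show thesis
  proof (rule that[OF m' lim])
    fix p :: real assume p: "p \<in> {1..<2}"
    show "(\<lambda>n. wasserstein p (\<mu> n) \<mu>') \<longlonglongrightarrow> 0"
    proof (rule tendsto_of_subsubseq)
      fix s :: "nat \<Rightarrow> nat" assume "strict_mono s"
      then obtain r where r: "strict_mono r" "skorokhod_limit (\<lambda>n. \<mu> (s (r n))) \<mu>'" using sub by blast
      show "\<exists>r. strict_mono r \<and> (\<lambda>n. wasserstein p (\<mu> (s (r n))) \<mu>') \<longlonglongrightarrow> 0"
        using skorokhod_limit_wasserstein[OF r(2) \<mu> B, of p] p r(1) by auto
    qed
  qed
qed

end

theorem theorem4p6:
  fixes F :: "'a::euclidean_space \<Rightarrow> real"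
    and gradF :: "'a \<Rightarrow> 'a"
    and H :: "'a measure \<Rightarrow> ereal"
    and L lam :: real
    and \<epsilon> \<tau> \<sigma> :: "nat \<Rightarrow> real"
    and G :: "'a measure \<Rightarrow> ereal"
    and S :: "real \<Rightarrow> 'a measure \<Rightarrow> 'a measure"
    and \<mu> :: "nat \<Rightarrow> 'a measure"
  assumes "convex_on UNIV F"
    and "\<And>x. GDERIV F x :> gradF x"
    and "L > 0" and "L-lipschitz_on UNIV gradF"
    and "lam \<ge> 0" and "strongly_convex lam F"
    and "proper_P2 H" and "lsc_W2 H" and "convex_gen_geodesics H"
    and "dom_P2 H \<subseteq> P2r"
    and G_def: "G = total_energy F H"
    and "\<exists>\<nu>. is_arg_min G (\<lambda>\<nu>. \<nu> \<in> P2) \<nu>"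
    and "\<And>n. \<epsilon> n \<ge> 0" and "summable \<epsilon>"
    and "\<And>n. \<tau> n \<in> {0<..<1 / L}"
    and "filterlim (\<lambda>n. \<Sum>i<n. \<tau> i) at_top sequentially"
    and "(SUP i. \<tau> i) < 1 / L"
    and \<sigma>_def: "\<sigma> = (\<lambda>n. \<Sum>i<n. \<tau> i)"
    and S_def: "S = forward_backward gradF H"
    and "\<And>n. \<mu> n \<in> P2"
    and "\<And>n. wasserstein 2 (\<mu> (Suc n)) (S (\<tau> n) (\<mu> n)) \<le> \<epsilon> n"
  shows "(\<forall>j :: nat \<Rightarrow> nat.
            (\<forall>n\<ge>1. is_arg_min (\<lambda>i. G (S (\<tau> i) (\<mu> i))) (\<lambda>i. i \<in> {..<n}) (j n)) \<longrightarrow>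
            ereal_bigo (\<lambda>n. G (S (\<tau> (j n)) (\<mu> (j n))) - (INF \<nu>\<in>P2. G \<nu>)) (\<lambda>n. 1 / \<sigma> n))
       \<and> (summable (\<lambda>n. \<sigma> (Suc n) / \<tau> (Suc n) * \<epsilon> n) \<longrightarrow>
            ereal_bigo (\<lambda>n. G (S (\<tau> n) (\<mu> n)) - (INF \<nu>\<in>P2. G \<nu>)) (\<lambda>n. 1 / \<sigma> n) \<and>
            (\<exists>\<mu>'. is_arg_min G (\<lambda>\<nu>. \<nu> \<in> P2) \<mu>' \<and>
                   limitin tau_w2 \<mu> \<mu>' sequentially \<and>
                   (\<forall>p\<in>{1..<2}. (\<lambda>n. wasserstein p (\<mu> n) \<mu>') \<longlonglongrightarrow> 0)))"
proof -
  interpret forward_backward_problem F gradF L H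
    using assms by unfold_locales auto
  interpret inexact_forward_backward F gradF L H \<epsilon> \<tau> \<sigma> \<mu> "\<lambda>n. S (\<tau> n) (\<mu> n)"
    using assms by unfold_locales auto
  define \<beta> where "\<beta> n = S (\<tau> n) (\<mu> n)" for n
  obtain \<rho> where m: "minimizer \<rho>" using minimizer_exists by blast
  have dom: "\<beta> n \<in> dom_P2 H" for n unfolding \<beta>_def by (rule \<beta>)
  have G\<beta>: "G (\<beta> n) = ereal (energy (\<beta> n))" for n
    unfolding G_def by (rule total_energy_eq[OF dom])
  have argmin_iff: "is_arg_min G (\<lambda>\<nu>. \<nu> \<in> P2) \<nu> \<longleftrightarrow> minimizer \<nu>" for \<nu>
    unfolding G_def is_arg_min_energy_iff minimizer_def ..
  have inf: "(INF \<nu>\<in>P2. G \<nu>) = ereal (energy \<rho>)"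
  proof -
    have "is_arg_min G (\<lambda>\<nu>. \<nu> \<in> P2) \<rho>" using m argmin_iff by simp
    then have "(INF \<nu>\<in>P2. G \<nu>) = G \<rho>"
      unfolding is_arg_min_linorder by (intro antisym INF_lower INF_greatest) auto
    then show ?thesis using total_energy_eq[OF minimizerD(1)[OF m]] by (simp add: G_def)
  qed
  have gap: "G (\<beta> n) - (INF \<nu>\<in>P2. G \<nu>) = ereal (energy (\<beta> n) - energy \<rho>)" for n
    unfolding inf G\<beta> by simp
  have gap_nonneg: "0 \<le> energy (\<beta> n) - energy \<rho>" for n
    using minimizerD(3)[OF m dom] by simp
  show ?thesis
  proof (intro conjI allI impI)
    fix j :: "nat \<Rightarrow> nat"
    assume j: "\<forall>n\<ge>1. is_arg_min (\<lambda>i. G (S (\<tau> i) (\<mu> i))) (\<lambda>i. i \<in> {..<n}) (j n)"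
    have best: "energy (\<beta> (j n)) \<le> energy (\<beta> i)" if "n \<ge> 1" "i < n" for n i
      using j that unfolding \<beta>_def[symmetric] G\<beta> is_arg_min_linorder by auto
    obtain C where C: "\<And>n. n \<ge> 1 \<Longrightarrow> \<sigma> n * (energy (\<beta> (j n)) - energy \<rho>) \<le> C"
      by (rule best_iterate_rate[OF m, folded \<beta>_def, of j, OF best], assumption+) (rule that)
    show "ereal_bigo (\<lambda>n. G (S (\<tau> (j n)) (\<mu> (j n))) - (INF \<nu>\<in>P2. G \<nu>)) (\<lambda>n. 1 / \<sigma> n)"
      unfolding \<beta>_def[symmetric] gap by (rule ereal_bigo_inverse[OF refl gap_nonneg \<sigma>_pos C])
  next
    assume s: "summable (\<lambda>n. \<sigma> (Suc n) / \<tau> (Suc n) * \<epsilon> n)"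
    obtain C where C: "\<And>n. \<sigma> (Suc n) * (energy (\<beta> n) - energy \<rho>) \<le> C"
      by (rule last_iterate_rate[OF m s, folded \<beta>_def]) (rule that)
    have "\<sigma> n * (energy (\<beta> n) - energy \<rho>) \<le> C" for n
    proof -
      have "\<sigma> n \<le> \<sigma> (Suc n)" unfolding \<sigma>_def using \<tau>(1)[of n] by simp
      then have "\<sigma> n * (energy (\<beta> n) - energy \<rho>) \<le> \<sigma> (Suc n) * (energy (\<beta> n) - energy \<rho>)"
        using gap_nonneg by (rule mult_right_mono)
      then show ?thesis using C[of n] by linarith
    qed
    then show "ereal_bigo (\<lambda>n. G (S (\<tau> n) (\<mu> n)) - (INF \<nu>\<in>P2. G \<nu>)) (\<lambda>n. 1 / \<sigma> n)"
      unfolding \<beta>_def[symmetric] gap by (intro ereal_bigo_inverse[OF refl gap_nonneg \<sigma>_pos])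
    have "(\<lambda>n. energy (\<beta> n) - energy \<rho>) \<longlonglongrightarrow> 0"
      using C unfolding \<beta>_def by (rule gap_tendsto_0[OF m])
    then obtain \<mu>' where "minimizer \<mu>'" "limitin tau_w2 \<mu> \<mu>' sequentially"
      "\<And>p. p \<in> {1..<2} \<Longrightarrow> (\<lambda>n. wasserstein p (\<mu> n) \<mu>') \<longlonglongrightarrow> 0"
      by (rule weak_convergence[OF m, folded \<beta>_def]) (rule that)
    then show "\<exists>\<mu>'. is_arg_min G (\<lambda>\<nu>. \<nu> \<in> P2) \<mu>' \<and> limitin tau_w2 \<mu> \<mu>' sequentially \<and>
        (\<forall>p\<in>{1..<2}. (\<lambda>n. wasserstein p (\<mu> n) \<mu>') \<longlonglongrightarrow> 0)"
      using argmin_iff by blast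
  qed
qed

end
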